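(* Let $\Psi:[0,\infty)\to\mathbb{R}$ be a function of bounded variation, let $m_k=\int_0^\infty e^{-kt}\,d\Psi(t)$ for $k\in\mathbb{N}_0$, and let $M_{H,m}$ be the associated multiplier operator for Hermite expansions, $M_{H,m}f\sim\sum_{k=0}^\infty c_k(f)\,m_k\,h_k$. Assume that: (H1h) $\int_0^\infty|d\Psi|(t)<+\infty$; (H2h) there exist $\delta>0$, $0<\sigma<\frac12$ and $C>0$ such that $|\Psi(t)|\le Ct^\sigma$ for $0\le t\le\delta$. Let $p,q,a,b$ be real numbers such that $$1<p\le q<\infty,\qquad a<\frac1{p'},\qquad b<\frac1q,\qquad 0\le a+b\le\frac1q-\frac1p+2\sigma .$$ Then $M_{H,m}$ (initially defined on the finite linear combinations of the Hermite functions $h_k$) can be extended to a bounded operator from $L^p(\mathbb{R},|x|^{ap}dx)$ to $L^q(\mathbb{R},|x|^{-bq}dx)$; that is, there is a constant $C$ independent of $f$ such that $$\|M_{H,m}f\|_{L^q(\mathbb{R},|x|^{-bq}dx)}\le C\,\|f\|_{L^p(\mathbb{R},|x|^{ap}dx)} .$$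
   Context: Here $p'=p/(p-1)$ and $\|f\|_{L^p(\mathbb{R},w\,dx)}=\left(\int_{\mathbb{R}}|f(x)|^pw(x)\,dx\right)^{1/p}$. The Hermite functions are $$h_k(x)=\frac{(-1)^k}{(2^kk!\,\pi^{1/2})^{1/2}}H_k(x)e^{-x^2/2},\qquad k\in\mathbb{N}_0,$$ where $H_k$ are the (physicists') Hermite polynomials; they form an orthonormal basis of $L^2(\mathbb{R})$ and are the normalized eigenfunctions of $-\frac{d^2}{dx^2}+|x|^2$. The Hermite coefficients of $f$ are $c_k(f)=\int_{-\infty}^\infty f(x)h_k(x)\,dx$. Given a bounded sequence $\{m_k\}$, the multiplier operator $M_{H,m}$ is given by $M_{H,m}f\sim\sum_{k=0}^\infty c_k(f)\,m_k\,h_k$; for $f$ a finite linear combination of the $h_k$ the sum is finite. Integrals against $d\Psi$ are Stieltjes integrals over $[0,\infty)$, and $|d\Psi|$ is the total variation measure of $\Psi$. *)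

theory Defs
  imports "HOL-Analysis.Analysis"
begin

section \<open>Bounded variation and Stieltjes integrals\<close>

definition total_variation :: "(real \<Rightarrow> real) \<Rightarrow> real set \<Rightarrow> ennreal" where
  "total_variation f S =
     (SUP ts \<in> {ts. sorted ts \<and> set ts \<subseteq> S}.
        \<Sum>i<length ts - 1. ennreal \<bar>f (ts ! Suc i) - f (ts ! i)\<bar>)"

definition bounded_variation_on :: "(real \<Rightarrow> real) \<Rightarrow> real set \<Rightarrow> bool" where
  "bounded_variation_on f S \<longleftrightarrow> total_variation f S < \<infinity>"

text \<open>
  Functions on \<open>[0,\<infinity>)\<close> are total functions on the reals whose values at negative arguments are
  ignored. A function of bounded variation need not be right-continuous, whereas
  \<^const>\<open>interval_measure\<close> represents the Stieltjes measure of a right-continuous increasing function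
  only. So \<open>\<Psi>\<close> is first replaced by its right limits on \<open>[0,\<infinity>)\<close> and by the constant \<open>\<Psi> 0\<close> on
  \<open>(-\<infinity>,0)\<close>, which turns a jump of \<open>\<Psi>\<close> at \<open>0\<close> into an atom at \<open>0\<close>. The total variation measure
  is then the Stieltjes measure of the variation function of this normalisation; the left endpoint
  \<open>-1\<close> is immaterial, as the normalisation is constant on \<open>(-\<infinity>,0)\<close>.
\<close>

definition stieltjes_normalisation :: "(real \<Rightarrow> real) \<Rightarrow> real \<Rightarrow> real" where
  "stieltjes_normalisation \<Psi> t = (if t < 0 then \<Psi> 0 else Lim (at_right t) \<Psi>)"

definition total_variation_measure :: "(real \<Rightarrow> real) \<Rightarrow> real measure" where
  "total_variation_measure \<Psi> =
     interval_measure (\<lambda>t. enn2real (total_variation (stieltjes_normalisation \<Psi>) {-1..t}))"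

text \<open>
  Riemann--Stieltjes integral of \<open>f\<close> with respect to \<open>g\<close> over \<open>[a,b]\<close>, as the limit of the
  Riemann--Stieltjes sums as the mesh tends to \<open>0\<close> (the gauge has constant radius \<open>d\<close>).
\<close>

definition has_rs_integral ::
    "(real \<Rightarrow> real) \<Rightarrow> (real \<Rightarrow> real) \<Rightarrow> real \<Rightarrow> real \<Rightarrow> real \<Rightarrow> bool" where
  "has_rs_integral f g a b I \<longleftrightarrow>
     (\<forall>e>0. \<exists>d>0. \<forall>P. P tagged_division_of {a..b} \<longrightarrow> (\<lambda>x. ball x d) fine P \<longrightarrow>
        \<bar>(\<Sum>(x, K) \<in> P. f x * (g (Sup K) - g (Inf K))) - I\<bar> < e)"

definition rs_integral :: "(real \<Rightarrow> real) \<Rightarrow> (real \<Rightarrow> real) \<Rightarrow> real \<Rightarrow> real \<Rightarrow> real" where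
  "rs_integral f g a b = (THE I. has_rs_integral f g a b I)"

text \<open>The integral of \<open>f\<close> over \<open>[0,\<infinity>)\<close> with respect to \<open>d\<Psi>\<close>.\<close>

definition stieltjes_integral :: "(real \<Rightarrow> real) \<Rightarrow> (real \<Rightarrow> real) \<Rightarrow> real" where
  "stieltjes_integral f \<Psi> = Lim at_top (\<lambda>R. rs_integral f \<Psi> 0 R)"

section \<open>Hermite expansions\<close>

text \<open>The physicists' Hermite polynomials, by the Rodrigues formula.\<close>

definition hermite_poly :: "nat \<Rightarrow> real \<Rightarrow> real" where
  "hermite_poly k x = (-1) ^ k * exp (x\<^sup>2) * (deriv ^^ k) (\<lambda>y. exp (- (y\<^sup>2))) x"

definition hermite_fun :: "nat \<Rightarrow> real \<Rightarrow> real" where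
  "hermite_fun k x =
     (-1) ^ k / sqrt (2 ^ k * fact k * sqrt pi) * hermite_poly k x * exp (- (x\<^sup>2) / 2)"

definition hermite_coeff :: "nat \<Rightarrow> (real \<Rightarrow> complex) \<Rightarrow> complex" where
  "hermite_coeff k f = (\<integral>x. f x * of_real (hermite_fun k x) \<partial>lborel)"

definition hermite_span :: "(real \<Rightarrow> complex) set" where
  "hermite_span = {f. \<exists>n c. f = (\<lambda>x. \<Sum>k<n. c k * of_real (hermite_fun k x))}"

text \<open>On \<^const>\<open>hermite_span\<close> only finitely many terms of the series are nonzero.\<close>

definition hermite_multiplier :: "(nat \<Rightarrow> real) \<Rightarrow> (real \<Rightarrow> complex) \<Rightarrow> real \<Rightarrow> complex" where
  "hermite_multiplier m f x =
     (\<Sum>k. hermite_coeff k f * of_real (m k) * of_real (hermite_fun k x))"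

section \<open>Weighted Lebesgue spaces\<close>

text \<open>
  The elements are functions rather than classes modulo null sets, hence the almost-everywhere
  equalities in the linearity of an operator.
\<close>

definition weighted_Lp :: "real \<Rightarrow> (real \<Rightarrow> real) \<Rightarrow> (real \<Rightarrow> complex) set" where
  "weighted_Lp p w =
     {f \<in> borel_measurable lborel. integrable lborel (\<lambda>x. norm (f x) powr p * w x)}"

definition weighted_Lp_norm :: "real \<Rightarrow> (real \<Rightarrow> real) \<Rightarrow> (real \<Rightarrow> complex) \<Rightarrow> real" where
  "weighted_Lp_norm p w f = (\<integral>x. norm (f x) powr p * w x \<partial>lborel) powr (1 / p)"

definition linear_on_Lp ::
    "real \<Rightarrow> (real \<Rightarrow> real) \<Rightarrow> ((real \<Rightarrow> complex) \<Rightarrow> (real \<Rightarrow> complex)) \<Rightarrow> bool" where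
  "linear_on_Lp p w T \<longleftrightarrow>
     (\<forall>f \<in> weighted_Lp p w. \<forall>g \<in> weighted_Lp p w.
        AE x in lborel. T (\<lambda>y. f y + g y) x = T f x + T g x) \<and>
     (\<forall>c. \<forall>f \<in> weighted_Lp p w. AE x in lborel. T (\<lambda>y. c * f y) x = c * T f x)"

end

(*
  Write m_k = k int e^{-kt} \<Psi>(t) dt + [k = 0] \<Psi>(infinity), by integration by parts. Since e^{-kt} h_k is the
  image of h_k under the Mehler semigroup, the operator has the kernel
    K(x,y) = \<Psi>(infinity) h_0(x) h_0(y) - int D_t(x,y) \<Psi>(t) dt,
  where D_t is the derivative in t of the Mehler kernel. The bounds |D_t(x,y)| \<le> C t^{-3/2} e^{-z^2/16t} e^{-z^2/16}
  with z = x - y and |\<Psi>(t)| \<le> C t^\<sigma> give |K(x,y)| \<le> C |z|^{2\<sigma>-1} e^{-z^2/16}. This is integrable and at most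
  C |z|^{\<theta>-1} for 0 \<le> \<theta> \<le> 2\<sigma>. For \<theta> = a + b + 1/p - 1/q the weighted inequality is that of Stein and Weiss:
  where |x| and |y| are not comparable it reduces to Hardy inequalities, and where they are comparable to
  the Hardy-Littlewood-Sobolev inequality if p < q and to Schur's test if p = q.
*)
theory Submission
  imports Defs "HOL-Probability.Probability" "HOL-Real_Asymp.Real_Asymp"
begin

section \<open>Integral operators on Lebesgue spaces\<close>

text \<open>The Mehler series is never summed. The kernel is a closed formula, and only its action
  on each \<open>hermite_fun k\<close> is verified, by Gaussian integration by parts, because finite
  combinations are the only functions on which the operator is prescribed. The extension is the
  integral operator itself, so no density argument is needed. The obstacle is the time integral. Of
  the exponent -3/2 in the bound for D_t, -1/2 is the size of a heat kernel and -1 comes from the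
  time derivative, and t^(\<sigma> - 3/2) is not integrable at 0. Off the diagonal the factor
  e^{-z^2/16t} repairs this, and the substitution t = z^2 u shows the price to be |z|^{2\<sigma>-1}.
  At infinity the integral converges because \<sigma> < 1/2. Integration by parts is what lets the
  size of \<Psi> enter here instead of d\<Psi>; it leaves no boundary term at 0 because the bound by
  t^\<sigma> forces \<Psi>(0) = 0. The value \<theta> = 0, possible only for p = q and a + b = 0, is
  critical: |z|^{-1} is not locally integrable, so there the bound by a power is replaced by the
  integrability of the kernel.\<close>

abbreviation lp_integral :: "real \<Rightarrow> (real \<Rightarrow> real) \<Rightarrow> ennreal" where
  "lp_integral p F \<equiv> \<integral>\<^sup>+y. ennreal (F y powr p) \<partial>lborel"

text \<open>The inner integral of a kernel against F may be infinite at some points before any bound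
  is known, so its power is formed in \<open>ennreal\<close>, with \<open>top\<close> kept at
  \<open>top\<close>.\<close>

definition epowr :: "ennreal \<Rightarrow> real \<Rightarrow> ennreal" where
  "epowr x r = (if x = top then top else ennreal (enn2real x powr r))"

lemma epowr_ennreal: "0 \<le> x \<Longrightarrow> epowr (ennreal x) r = ennreal (x powr r)"
  by (simp add: epowr_def)

lemma epowr_mono: "x \<le> y \<Longrightarrow> 0 \<le> r \<Longrightarrow> epowr x r \<le> epowr y r"
  by (auto simp: epowr_def top_unique less_top intro!: ennreal_leI powr_mono2 enn2real_mono)

lemma epowr_mult:
  assumes "0 < c"
  shows "epowr (ennreal c * x) r = ennreal (c powr r) * epowr x r"
  using assms
  by (cases x) (auto simp: epowr_def ennreal_mult[symmetric] powr_mult ennreal_mult_top less_imp_le ennreal_mult_eq_top_iff)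

lemma epowr_eq_top_iff: "epowr x r = top \<longleftrightarrow> x = top"
  by (simp add: epowr_def)

lemma epowr_add3:
  assumes "0 \<le> r"
  shows "epowr (x + y + z) r \<le> ennreal (3 powr r) * (epowr x r + epowr y r + epowr z r)"
proof -
  define w where "w = max x (max y z)"
  have "x + y + z \<le> w + w + w"
    unfolding w_def by (intro add_mono) (auto simp: le_max_iff_disj)
  also have "\<dots> = ennreal 3 * w"
    by (metis (no_types, lifting) ennreal_numeral mult_numeral_1 numeral_plus_numeral numeral_Bit1 numeral_One distrib_right)
  finally have "epowr (x + y + z) r \<le> epowr (ennreal 3 * w) r"
    by (rule epowr_mono) fact
  also have "\<dots> = ennreal (3 powr r) * epowr w r"
    by (rule epowr_mult) simp
  also have "epowr w r \<le> epowr x r + epowr y r + epowr z r"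
    unfolding w_def by (auto simp: max_def add_increasing add_increasing2)
  finally show ?thesis by (simp add: mult_left_mono)
qed

lemma measurable_epowr [measurable (raw)]:
  assumes [measurable]: "f \<in> borel_measurable M"
  shows "(\<lambda>x. epowr (f x) r) \<in> borel_measurable M"
proof -
  have [measurable]: "Measurable.pred M (\<lambda>x. f x = top)"
    by (rule pred_eq_const1[where N = borel]) auto
  show ?thesis unfolding epowr_def by measurable
qed

text \<open>Young's inequality for f/u and g/v, integrated, where u and v are the roots of the
  bounds U and V. Upper bounds instead of norms suit the later uses. A zero bound forbids the
  division, but then one factor vanishes almost everywhere.\<close>

lemma nn_integral_Holder:
  fixes f g :: "'a \<Rightarrow> real"
  assumes [measurable]: "f \<in> borel_measurable M" "g \<in> borel_measurable M"
    and nn: "\<And>x. 0 \<le> f x" "\<And>x. 0 \<le> g x"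
    and p: "1 < p" "1 < p'" "1 / p + 1 / p' = 1"
    and UV: "0 \<le> U" "0 \<le> V"
    and f: "(\<integral>\<^sup>+x. ennreal (f x powr p') \<partial>M) \<le> ennreal U"
    and g: "(\<integral>\<^sup>+x. ennreal (g x powr p) \<partial>M) \<le> ennreal V"
  shows "(\<integral>\<^sup>+x. ennreal (f x * g x) \<partial>M) \<le> ennreal (U powr (1 / p') * V powr (1 / p))"
proof (cases "U = 0 \<or> V = 0")
  case True
  have "AE x in M. f x * g x = 0"
  proof (cases "U = 0")
    case True
    with f have "(\<integral>\<^sup>+x. ennreal (f x powr p') \<partial>M) = 0" by simp
    then have "AE x in M. ennreal (f x powr p') = 0" by (subst (asm) nn_integral_0_iff_AE) auto
    then show ?thesis by eventually_elim auto
  next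
    case False
    with g True have "(\<integral>\<^sup>+x. ennreal (g x powr p) \<partial>M) = 0" by simp
    then have "AE x in M. ennreal (g x powr p) = 0" by (subst (asm) nn_integral_0_iff_AE) auto
    then show ?thesis by eventually_elim auto
  qed
  then have "AE x in M. ennreal (f x * g x) = 0" by eventually_elim auto
  then have "(\<integral>\<^sup>+x. ennreal (f x * g x) \<partial>M) = 0" by (subst nn_integral_0_iff_AE) auto
  then show ?thesis by simp
next
  case False
  with UV have UV: "0 < U" "0 < V" by auto
  define u where "u = U powr (1 / p')"
  define v where "v = V powr (1 / p)"
  have uv: "0 < u" "0 < v" using UV by (auto simp: u_def v_def)
  have up: "u powr p' = U" "v powr p = V"
    using UV p by (auto simp: u_def v_def powr_powr)
  have *: "f x * g x \<le> u * v * (f x powr p' / (p' * U) + g x powr p / (p * V))" for x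
  proof -
    have "(f x / u) * (g x / v) \<le> (f x / u) powr p' / p' + (g x / v) powr p / p"
      using p nn uv by (intro Youngs_inequality) (auto simp: algebra_simps)
    also have "\<dots> = f x powr p' / (p' * U) + g x powr p / (p * V)"
      using nn uv up by (simp add: powr_divide mult.commute)
    finally show ?thesis using uv by (simp add: field_simps)
  qed
  have "(\<integral>\<^sup>+x. ennreal (f x * g x) \<partial>M)
    \<le> (\<integral>\<^sup>+x. ennreal (u * v / (p' * U)) * ennreal (f x powr p') + ennreal (u * v / (p * V)) * ennreal (g x powr p) \<partial>M)"
    using * uv UV p by (intro nn_integral_mono) (simp add: ennreal_mult[symmetric] ennreal_plus[symmetric] algebra_simps del: ennreal_plus)
  also have "\<dots> = ennreal (u * v / (p' * U)) * (\<integral>\<^sup>+x. ennreal (f x powr p') \<partial>M) + ennreal (u * v / (p * V)) * (\<integral>\<^sup>+x. ennreal (g x powr p) \<partial>M)"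
    by (simp add: nn_integral_add nn_integral_cmult)
  also have "\<dots> \<le> ennreal (u * v / (p' * U)) * ennreal U + ennreal (u * v / (p * V)) * ennreal V"
    by (intro add_mono mult_left_mono f g) auto
  also have "\<dots> = ennreal (u * v / (p' * U) * U + u * v / (p * V) * V)"
    using uv UV p by (simp add: ennreal_mult[symmetric] ennreal_plus[symmetric] del: ennreal_plus)
  also have "u * v / (p' * U) * U + u * v / (p * V) * V = u * v * (1 / p + 1 / p')"
    using UV by (simp add: field_simps)
  finally show ?thesis using p by (simp add: u_def v_def)
qed

text \<open>Split the kernel as A B and apply Hoelder in y to A and B F: the q-th power of the
  integral is at most \<alpha>^q G^(q/p), with G the integral of (B F)^p. The bound B \<le> \<beta>
  makes G^(q/p) linear in G, after which Tonelli leaves exactly the integral in x that is assumed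
  bounded.\<close>

lemma kernel_test:
  fixes A B :: "real \<Rightarrow> real \<Rightarrow> real" and F :: "real \<Rightarrow> real"
  assumes meas [measurable]: "case_prod A \<in> borel_measurable (borel \<Otimes>\<^sub>M borel)"
      "case_prod B \<in> borel_measurable (borel \<Otimes>\<^sub>M borel)"
      "F \<in> borel_measurable borel" "\<alpha> \<in> borel_measurable borel" "\<beta> \<in> borel_measurable borel"
    and nn: "\<And>x y. 0 \<le> A x y" "\<And>x y. 0 \<le> B x y" "\<And>x. 0 \<le> F x" "\<And>x. 0 \<le> \<alpha> x"
    and p: "1 < p" "1 < p'" "1 / p + 1 / p' = 1" "p \<le> q"
    and F: "lp_integral p F \<le> 1"
    and A: "AE x in lborel. (\<integral>\<^sup>+y. ennreal (A x y powr p') \<partial>lborel) \<le> ennreal (\<alpha> x powr p')"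
    and B: "\<And>x y. B x y \<le> \<beta> x"
    and C: "AE y in lborel. (\<integral>\<^sup>+x. ennreal (\<alpha> x powr q * \<beta> x powr (q - p) * B x y powr p) \<partial>lborel) \<le> ennreal C"
  shows "(\<integral>\<^sup>+x. epowr (\<integral>\<^sup>+y. ennreal (A x y * B x y * F y) \<partial>lborel) q \<partial>lborel) \<le> ennreal C"
proof -
  have \<beta>: "0 \<le> \<beta> x" for x using B[of x 0] nn(2)[of x 0] by linarith
  have [measurable]: "A x \<in> borel_measurable borel" "B x \<in> borel_measurable borel" for x
    by measurable
  define G where "G x = (\<integral>\<^sup>+y. ennreal ((B x y * F y) powr p) \<partial>lborel)" for x
  have G_le: "G x \<le> ennreal (\<beta> x powr p)" for x
  proof -
    have "G x \<le> (\<integral>\<^sup>+y. ennreal (\<beta> x powr p) * ennreal (F y powr p) \<partial>lborel)"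
      unfolding G_def using nn B p \<beta>
      by (intro nn_integral_mono) (auto simp: powr_mult ennreal_mult[symmetric] intro!: mult_right_mono powr_mono2)
    also have "\<dots> = ennreal (\<beta> x powr p) * lp_integral p F"
      by (simp add: nn_integral_cmult)
    also have "\<dots> \<le> ennreal (\<beta> x powr p) * 1"
      by (intro mult_left_mono F) auto
    finally show ?thesis by simp
  qed
  have "AE x in lborel. epowr (\<integral>\<^sup>+y. ennreal (A x y * B x y * F y) \<partial>lborel) q
      \<le> ennreal (\<alpha> x powr q * \<beta> x powr (q - p)) * G x"
    using A
  proof eventually_elim
    case (elim x)
    define g where "g = enn2real (G x)"
    have Gg: "G x = ennreal g"
      using G_le[of x] by (simp add: g_def top_unique less_top order.strict_trans1)
    have g: "0 \<le> g" "g \<le> \<beta> x powr p"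
      using G_le[of x] unfolding Gg by (auto simp: g_def)
    have "(\<integral>\<^sup>+y. ennreal (A x y * (B x y * F y)) \<partial>lborel)
        \<le> ennreal ((\<alpha> x powr p') powr (1 / p') * g powr (1 / p))"
      using nn p g elim Gg by (intro nn_integral_Holder) (auto simp: G_def)
    also have "(\<alpha> x powr p') powr (1 / p') = \<alpha> x"
      using p nn(4)[of x] by (simp add: powr_powr)
    finally have "epowr (\<integral>\<^sup>+y. ennreal (A x y * B x y * F y) \<partial>lborel) q
        \<le> epowr (ennreal (\<alpha> x * g powr (1 / p))) q"
      using p by (intro epowr_mono) (auto simp: mult.assoc)
    also have "\<dots> = ennreal (\<alpha> x powr q * g powr (q / p))"
      using nn by (simp add: epowr_ennreal powr_mult powr_powr)
    \<comment> \<open>This is the passage from p to q: the surplus power q/p - 1 of G is estimated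
      pointwise by G \<le> \<beta>^p, which uses the normalisation of F, and a single factor G is
      kept for Tonelli.\<close>
    also have "g powr (q / p) \<le> \<beta> x powr (q - p) * g"
    proof (cases "g = 0")
      case False
      with g have "0 < g" by simp
      have "g powr (q / p) = g powr (q / p - 1) * g"
        using \<open>0 < g\<close> by (simp add: powr_diff)
      also have "g powr (q / p - 1) \<le> (\<beta> x powr p) powr (q / p - 1)"
        using g p by (intro powr_mono2) auto
      also have "\<dots> = \<beta> x powr (q - p)"
        using p by (simp add: powr_powr right_diff_distrib)
      finally show ?thesis using g by (simp add: mult_right_mono)
    qed simp
    finally show ?case unfolding Gg
      using g by (simp add: ennreal_mult[symmetric] ennreal_leI mult_left_mono mult.assoc)
  qed
  then have "(\<integral>\<^sup>+x. epowr (\<integral>\<^sup>+y. ennreal (A x y * B x y * F y) \<partial>lborel) q \<partial>lborel)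
     \<le> (\<integral>\<^sup>+x. ennreal (\<alpha> x powr q * \<beta> x powr (q - p)) * G x \<partial>lborel)"
    by (rule nn_integral_mono_AE)
  also have "\<dots> = (\<integral>\<^sup>+x. \<integral>\<^sup>+y. ennreal (\<alpha> x powr q * \<beta> x powr (q - p) * B x y powr p) * ennreal (F y powr p) \<partial>lborel \<partial>lborel)"
    unfolding G_def using nn
    by (subst nn_integral_cmult[symmetric]) (auto simp: powr_mult ennreal_mult[symmetric] mult.assoc intro!: nn_integral_cong)
  also have "\<dots> = (\<integral>\<^sup>+y. \<integral>\<^sup>+x. ennreal (\<alpha> x powr q * \<beta> x powr (q - p) * B x y powr p) * ennreal (F y powr p) \<partial>lborel \<partial>lborel)"
    by (rule lborel_pair.Fubini') measurable
  also have "\<dots> = (\<integral>\<^sup>+y. (\<integral>\<^sup>+x. ennreal (\<alpha> x powr q * \<beta> x powr (q - p) * B x y powr p) \<partial>lborel) * ennreal (F y powr p) \<partial>lborel)"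
    by (simp add: nn_integral_multc)
  also have "\<dots> \<le> (\<integral>\<^sup>+y. ennreal C * ennreal (F y powr p) \<partial>lborel)"
    by (rule nn_integral_mono_AE, use C in eventually_elim) (auto intro: mult_right_mono)
  also have "\<dots> = ennreal C * lp_integral p F"
    by (simp add: nn_integral_cmult)
  also have "\<dots> \<le> ennreal C * 1"
    by (intro mult_left_mono F) auto
  finally show ?thesis by simp
qed

text \<open>C bounds the q-th power of the norm, for F normalised in L^p. A negative C acts as 0
  through \<open>ennreal\<close>, which is why absolute values of such constants are taken when they
  are added or scaled.\<close>

definition kernel_bound :: "real \<Rightarrow> real \<Rightarrow> (real \<Rightarrow> real \<Rightarrow> real) \<Rightarrow> real \<Rightarrow> bool" where
  "kernel_bound p q K C \<longleftrightarrow> (\<forall>F. F \<in> borel_measurable borel \<longrightarrow> (\<forall>x. 0 \<le> F x) \<longrightarrow>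
     lp_integral p F \<le> 1 \<longrightarrow>
     (\<integral>\<^sup>+x. epowr (\<integral>\<^sup>+y. ennreal (K x y * F y) \<partial>lborel) q \<partial>lborel) \<le> ennreal C)"

definition kernel_bounded :: "real \<Rightarrow> real \<Rightarrow> (real \<Rightarrow> real \<Rightarrow> real) \<Rightarrow> bool" where
  "kernel_bounded p q K \<longleftrightarrow> (\<exists>C. kernel_bound p q K C)"

lemma kernel_boundedI:
  assumes "\<And>F. F \<in> borel_measurable borel \<Longrightarrow> (\<And>x. 0 \<le> F x) \<Longrightarrow>
     lp_integral p F \<le> 1 \<Longrightarrow>
     (\<integral>\<^sup>+x. epowr (\<integral>\<^sup>+y. ennreal (K x y * F y) \<partial>lborel) q \<partial>lborel) \<le> ennreal C"
  shows "kernel_bounded p q K"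
  using assms unfolding kernel_bounded_def kernel_bound_def by blast

lemma kernel_boundD:
  assumes "kernel_bound p q K C" "F \<in> borel_measurable borel" "\<And>x. 0 \<le> F x"
    "lp_integral p F \<le> 1"
  shows "(\<integral>\<^sup>+x. epowr (\<integral>\<^sup>+y. ennreal (K x y * F y) \<partial>lborel) q \<partial>lborel) \<le> ennreal C"
  using assms unfolding kernel_bound_def by blast

section \<open>Power integrals, substitutions and the layer cake formula\<close>

lemma powr_divide_minus:
  fixes x d t :: real
  shows "(x / d) powr (- t) = d powr t * x powr (- t)"
  unfolding powr_minus powr_divide by (simp add: divide_inverse)

lemma powr_mult_powr:
  fixes x s t u :: real
  shows "s + t = u \<Longrightarrow> x powr s * x powr t = x powr u"
  by (auto simp: powr_add)

lemma nn_integral_powr_0: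
  assumes "-1 < c" "0 \<le> X"
  shows "(\<integral>\<^sup>+x. ennreal (x powr c) * indicator {0<..<X} x \<partial>lborel) = ennreal (X powr (c + 1) / (c + 1))"
proof -
  have "(\<integral>\<^sup>+x. ennreal (x powr c) * indicator {0..X} x \<partial>lborel) = ennreal (X powr (c + 1) / (c + 1))"
    using assms has_integral_powr_from_0[of c X]
    by (intro nn_integral_has_integral_lebesgue') auto
  also have "(\<integral>\<^sup>+x. ennreal (x powr c) * indicator {0..X} x \<partial>lborel) = (\<integral>\<^sup>+x. ennreal (x powr c) * indicator {0<..<X} x \<partial>lborel)"
    by (rule nn_integral_cong_AE, use AE_lborel_singleton[of 0] AE_lborel_singleton[of X] in eventually_elim) (auto simp: indicator_def)
  finally show ?thesis .
qed

lemma nn_integral_powr_inf: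
  assumes "c < -1" "0 < X"
  shows "(\<integral>\<^sup>+x. ennreal (x powr c) * indicator {X..} x \<partial>lborel) = ennreal (X powr (c + 1) / (- c - 1))"
proof -
  have "(\<integral>\<^sup>+x. ennreal (x powr c) * indicator {X..} x \<partial>lborel) = ennreal (- (X powr (c + 1)) / (c + 1))"
    using assms has_integral_powr_to_inf[of c X]
    by (intro nn_integral_has_integral_lebesgue') auto
  also have "- (X powr (c + 1)) / (c + 1) = X powr (c + 1) / (- c - 1)"
    using assms by (simp add: field_simps)
  finally show ?thesis .
qed

lemma nn_integral_even:
  fixes f :: "real \<Rightarrow> ennreal"
  assumes [measurable]: "f \<in> borel_measurable borel" and even: "\<And>x. f (- x) = f x"
  shows "(\<integral>\<^sup>+x. f x \<partial>lborel) = 2 * (\<integral>\<^sup>+x. f x * indicator {0<..} x \<partial>lborel)"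
proof -
  have "(\<integral>\<^sup>+x. f x \<partial>lborel) = (\<integral>\<^sup>+x. f x * indicator {0<..} x + f x * indicator {..<0} x \<partial>lborel)"
    by (rule nn_integral_cong_AE, use AE_lborel_singleton[of 0] in eventually_elim) (auto simp: indicator_def)
  also have "\<dots> = (\<integral>\<^sup>+x. f x * indicator {0<..} x \<partial>lborel) + (\<integral>\<^sup>+x. f x * indicator {..<0} x \<partial>lborel)"
    by (intro nn_integral_add) auto
  also have "(\<integral>\<^sup>+x. f x * indicator {..<0} x \<partial>lborel) = (\<integral>\<^sup>+x. f x * indicator {0<..} x \<partial>lborel)"
    by (subst nn_integral_real_affine[where c = "-1" and t = 0])
      (auto simp: even indicator_def intro!: nn_integral_cong)
  finally show ?thesis by (simp add: mult_2)
qed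

lemma nn_integral_abs_powr_0:
  assumes "-1 < c" "0 \<le> X"
  shows "(\<integral>\<^sup>+x. ennreal (\<bar>x\<bar> powr c) * indicator {x. \<bar>x\<bar> < X} x \<partial>lborel) = ennreal (2 * X powr (c + 1) / (c + 1))"
proof -
  have "(\<integral>\<^sup>+x. ennreal (\<bar>x\<bar> powr c) * indicator {x. \<bar>x\<bar> < X} x \<partial>lborel)
     = 2 * (\<integral>\<^sup>+x. ennreal (\<bar>x\<bar> powr c) * indicator {x. \<bar>x\<bar> < X} x * indicator {0<..} x \<partial>lborel)"
    by (rule nn_integral_even) (auto simp: indicator_def)
  also have "(\<integral>\<^sup>+x. ennreal (\<bar>x\<bar> powr c) * indicator {x. \<bar>x\<bar> < X} x * indicator {0<..} x \<partial>lborel)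
     = (\<integral>\<^sup>+x. ennreal (x powr c) * indicator {0<..<X} x \<partial>lborel)"
    by (intro nn_integral_cong) (auto simp: indicator_def)
  finally show ?thesis using assms
    by (simp add: nn_integral_powr_0 ennreal_mult[symmetric] flip: ennreal_numeral)
qed

lemma nn_integral_abs_powr_inf:
  assumes "c < -1" "0 < X"
  shows "(\<integral>\<^sup>+x. ennreal (\<bar>x\<bar> powr c) * indicator {x. X \<le> \<bar>x\<bar>} x \<partial>lborel) = ennreal (2 * X powr (c + 1) / (- c - 1))"
proof -
  have "(\<integral>\<^sup>+x. ennreal (\<bar>x\<bar> powr c) * indicator {x. X \<le> \<bar>x\<bar>} x \<partial>lborel)
     = 2 * (\<integral>\<^sup>+x. ennreal (\<bar>x\<bar> powr c) * indicator {x. X \<le> \<bar>x\<bar>} x * indicator {0<..} x \<partial>lborel)"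
    by (rule nn_integral_even) (auto simp: indicator_def)
  also have "(\<integral>\<^sup>+x. ennreal (\<bar>x\<bar> powr c) * indicator {x. X \<le> \<bar>x\<bar>} x * indicator {0<..} x \<partial>lborel)
     = (\<integral>\<^sup>+x. ennreal (x powr c) * indicator {X..} x \<partial>lborel)"
    using assms by (intro nn_integral_cong) (auto simp: indicator_def)
  finally show ?thesis using assms
    by (simp add: nn_integral_powr_inf ennreal_mult[symmetric] flip: ennreal_numeral)
qed

lemma nn_integral_translate_reflect:
  fixes f :: "real \<Rightarrow> ennreal"
  assumes [measurable]: "f \<in> borel_measurable borel"
  shows "(\<integral>\<^sup>+y. f (x - y) \<partial>lborel) = (\<integral>\<^sup>+y. f y \<partial>lborel)" "(\<integral>\<^sup>+y. f (y - x) \<partial>lborel) = (\<integral>\<^sup>+y. f y \<partial>lborel)"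
  using nn_integral_real_affine[of f "-1" x] nn_integral_real_affine[of f 1 "-x"]
  by (simp_all add: add.commute)

text \<open>For finite T this is the integral of the derivative of s^q from 0 to T. For T =
  \<open>top\<close> the integrals over bounded intervals are already arbitrarily large.\<close>

lemma epowr_layer_cake:
  assumes "0 < q"
  shows "epowr T q = (\<integral>\<^sup>+s. ennreal (q * s powr (q - 1)) * indicator {s. 0 < s \<and> ennreal s < T} s \<partial>lborel)"
proof (cases "T = top")
  case False
  then obtain t where t: "T = ennreal t" "0 \<le> t" by (cases T) auto
  have "(\<integral>\<^sup>+s. ennreal (q * s powr (q - 1)) * indicator {s. 0 < s \<and> ennreal s < T} s \<partial>lborel)
     = (\<integral>\<^sup>+s. ennreal q * (ennreal (s powr (q - 1)) * indicator {0<..<t} s) \<partial>lborel)"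
    using assms t by (intro nn_integral_cong) (auto simp: indicator_def ennreal_mult ennreal_less_iff)
  also have "\<dots> = ennreal q * ennreal (t powr q / q)"
    using assms t by (subst nn_integral_cmult) (auto simp: nn_integral_powr_0)
  finally show ?thesis using assms t by (simp add: epowr_ennreal ennreal_mult[symmetric])
next
  case True
  have "ennreal (real n) \<le> (\<integral>\<^sup>+s. ennreal (q * s powr (q - 1)) * indicator {s. 0 < s \<and> ennreal s < T} s \<partial>lborel)" for n
  proof -
    \<comment> \<open>Chosen so that t^q = n.\<close>
    define t where "t = real n powr (1 / q)"
    have "(\<integral>\<^sup>+s. ennreal q * (ennreal (s powr (q - 1)) * indicator {0<..<t} s) \<partial>lborel)
      \<le> (\<integral>\<^sup>+s. ennreal (q * s powr (q - 1)) * indicator {s. 0 < s \<and> ennreal s < T} s \<partial>lborel)"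
      using assms True by (intro nn_integral_mono) (auto simp: indicator_def ennreal_mult)
    also have "(\<integral>\<^sup>+s. ennreal q * (ennreal (s powr (q - 1)) * indicator {0<..<t} s) \<partial>lborel) = ennreal q * ennreal (t powr q / q)"
      using assms by (subst nn_integral_cmult) (auto simp: nn_integral_powr_0 t_def)
    also have "\<dots> = ennreal (real n)"
      using assms by (simp add: ennreal_mult[symmetric] t_def powr_powr)
    finally show ?thesis .
  qed
  then have "(\<integral>\<^sup>+s. ennreal (q * s powr (q - 1)) * indicator {s. 0 < s \<and> ennreal s < T} s \<partial>lborel) = top"
    by (metis ennreal_Ex_less_of_nat ennreal_of_nat_eq_real_of_nat less_top not_less)
  with True show ?thesis by (simp add: epowr_def)
qed

section \<open>The Stein--Weiss inequality\<close>


text \<open>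
  At each level \<open>s\<close> the kernel is cut at a radius \<open>R\<close> and \<open>F\<close> at a height \<open>\<gamma>\<close>, chosen so that the far
  part of the kernel and the low part of \<open>F\<close> together contribute at most \<open>3s/4\<close>. The remaining piece
  is estimated in \<open>L\<^sup>1\<close>.
\<close>

lemma riesz_potential_weak_estimate:
  fixes F :: "real \<Rightarrow> real"
  assumes p: "1 < p" "p < q" and p': "1 / p + 1 / p' = 1" and s: "0 < s"
    and [measurable]: "F \<in> borel_measurable borel" and nn: "\<And>x. 0 \<le> F x"
    and F: "lp_integral p F \<le> 1"
  defines "\<alpha> \<equiv> 1 / p - 1 / q"
  defines "D \<equiv> 8 * (2 * (2 * q / p') powr (1 / p')) powr (q * \<alpha>) / \<alpha>"
  shows "emeasure lborel {x. ennreal s < (\<integral>\<^sup>+y. ennreal (\<bar>x - y\<bar> powr (\<alpha> - 1) * F y) \<partial>lborel)}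
     \<le> ennreal (D * s powr (- q / p)) * (\<integral>\<^sup>+y. ennreal (F y) * indicator {y. s powr (q / p) / D < F y} y \<partial>lborel)"
proof -
  have "1 / p' = 1 - 1 / p" using p' by linarith
  then have p'1: "1 < p'" using p by (smt (verit) divide_less_eq_1_pos divide_pos_pos less_divide_eq_1 zero_less_divide_1_iff)
  have "1 / p < 1" "0 < 1 / q" "1 / q < 1 / p" using p by (auto simp: field_simps)
  then have \<alpha>: "0 < \<alpha>" "\<alpha> < 1" unfolding \<alpha>_def by linarith+
  define c where "c = (2 * q / p') powr (1 / p')"
  have c: "0 < c" using p p'1 by (simp add: c_def)
  have D: "D = 8 * (2 * c) powr (q * \<alpha>) / \<alpha>" by (simp add: D_def c_def)
  have D0: "0 < D" using \<alpha> c by (simp add: D)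
  define R where "R = (2 * c / s) powr q"
  have R0: "0 < R" using c s by (simp add: R_def)
  \<comment> \<open>The factor 8 in D gives the near part of the kernel the L^1 norm D s^(1 - q/p) /
    4, so values of F below this \<gamma> contribute at most s/4.\<close>
  define \<gamma> where "\<gamma> = s powr (q / p) / D"
  have \<gamma>0: "0 < \<gamma>" using s D0 by (simp add: \<gamma>_def)
  have qa: "q * \<alpha> = q / p - 1" using p by (simp add: \<alpha>_def field_simps)
  have R\<alpha>: "2 * R powr \<alpha> / \<alpha> = D * s powr (1 - q / p) / 4"
  proof -
    have "R powr \<alpha> = (2 * c) powr (q * \<alpha>) * s powr (- (q * \<alpha>))"
      using c s by (simp add: R_def powr_powr powr_divide powr_minus_divide)
    then show ?thesis using \<alpha> by (simp add: D qa)
  qed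
  define k1 where "k1 z = \<bar>z\<bar> powr (\<alpha> - 1) * indicator {z. \<bar>z\<bar> < R} z" for z :: real
  define k2 where "k2 z = \<bar>z\<bar> powr (\<alpha> - 1) * indicator {z. R \<le> \<bar>z\<bar>} z" for z :: real
  have [measurable]: "k1 \<in> borel_measurable borel" "k2 \<in> borel_measurable borel"
    unfolding k1_def k2_def by measurable
  have k_nn: "0 \<le> k1 z" "0 \<le> k2 z" for z by (auto simp: k1_def k2_def)
  have k1: "(\<integral>\<^sup>+z. ennreal (k1 z) \<partial>lborel) = ennreal (2 * R powr \<alpha> / \<alpha>)"
    using nn_integral_abs_powr_0[of "\<alpha> - 1" R] \<alpha> R0 by (simp add: k1_def ennreal_mult'' ennreal_indicator)
  have k2: "(\<integral>\<^sup>+z. ennreal (k2 z powr p') \<partial>lborel) = ennreal (2 * q / p' * R powr (- p' / q))"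
  proof -
    have "\<alpha> - 1 = - (1 / p') - 1 / q" unfolding \<alpha>_def using p' by linarith
    \<comment> \<open>The exponent (\<alpha> - 1) p' is thus below -1, so the far part of the kernel
      lies in L^p'.\<close>
    then have e: "(\<alpha> - 1) * p' + 1 = - p' / q"
      using p p'1 by (simp add: field_simps)
    have e2: "- ((\<alpha> - 1) * p') - 1 = p' / q" using e by simp
    have "k2 z powr p' = \<bar>z\<bar> powr ((\<alpha> - 1) * p') * indicator {z. R \<le> \<bar>z\<bar>} z" for z
      using p'1 by (auto simp: k2_def indicator_def powr_powr)
    moreover have "(\<alpha> - 1) * p' < -1" using e p p'1 by (smt (verit) divide_pos_pos minus_divide_left)
    ultimately have "(\<integral>\<^sup>+z. ennreal (k2 z powr p') \<partial>lborel) = ennreal (2 * R powr (- p' / q) / (p' / q))"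
      using nn_integral_abs_powr_inf[of "(\<alpha> - 1) * p'" R] R0 by (simp add: e e2 ennreal_mult'' ennreal_indicator)
    then show ?thesis by (simp add: mult_ac)
  qed
  define W where "W x = (\<integral>\<^sup>+y. ennreal (k1 (x - y)) * (ennreal (F y) * indicator {y. \<gamma> < F y} y) \<partial>lborel)" for x
  have [measurable]: "W \<in> borel_measurable borel" unfolding W_def by measurable
  have T: "(\<integral>\<^sup>+y. ennreal (\<bar>x - y\<bar> powr (\<alpha> - 1) * F y) \<partial>lborel) \<le> ennreal (3 * s / 4) + W x" for x
  proof -
    have A: "(\<integral>\<^sup>+y. ennreal (k2 (x - y) * F y) \<partial>lborel) \<le> ennreal (s / 2)"
    proof -
      have "(\<integral>\<^sup>+y. ennreal (k2 (x - y) * F y) \<partial>lborel)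
        \<le> ennreal ((2 * q / p' * R powr (- p' / q)) powr (1 / p') * 1 powr (1 / p))"
        using p p' p'1 k_nn nn F k2 nn_integral_translate_reflect(1)[of "\<lambda>z. ennreal (k2 z powr p')" x]
        by (intro nn_integral_Holder) auto
      also have "(2 * q / p' * R powr (- p' / q)) powr (1 / p') = c * R powr (- 1 / q)"
        using p p'1 powr_mult[of "2 * q / p'" "R powr (- p' / q)" "1 / p'"]
        by (simp only: powr_powr c_def) simp
      also have "\<dots> = s / 2"
        using c s p by (simp add: R_def powr_powr powr_minus field_simps)
      finally show ?thesis by simp
    qed
    have B: "(\<integral>\<^sup>+y. ennreal \<gamma> * ennreal (k1 (x - y)) \<partial>lborel) = ennreal (s / 4)"
    proof -
      have "(\<integral>\<^sup>+y. ennreal \<gamma> * ennreal (k1 (x - y)) \<partial>lborel) = ennreal \<gamma> * ennreal (2 * R powr \<alpha> / \<alpha>)"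
        using nn_integral_translate_reflect(1)[of "\<lambda>z. ennreal (k1 z)" x] k1 by (simp add: nn_integral_cmult)
      also have "\<dots> = ennreal (s / 4)"
        using \<gamma>0 s D0 unfolding R\<alpha> by (simp add: \<gamma>_def powr_diff ennreal_mult[symmetric])
      finally show ?thesis .
    qed
    have "(\<integral>\<^sup>+y. ennreal (\<bar>x - y\<bar> powr (\<alpha> - 1) * F y) \<partial>lborel)
      \<le> (\<integral>\<^sup>+y. ennreal (k2 (x - y) * F y) + ennreal \<gamma> * ennreal (k1 (x - y)) +
            ennreal (k1 (x - y)) * (ennreal (F y) * indicator {y. \<gamma> < F y} y) \<partial>lborel)"
    proof (intro nn_integral_mono)
      fix y
      show "ennreal (\<bar>x - y\<bar> powr (\<alpha> - 1) * F y) \<le> ennreal (k2 (x - y) * F y) + ennreal \<gamma> * ennreal (k1 (x - y)) +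
            ennreal (k1 (x - y)) * (ennreal (F y) * indicator {y. \<gamma> < F y} y)"
        using \<gamma>0 nn[of y]
        by (auto simp: k1_def k2_def indicator_def ennreal_mult[symmetric] mult.commute[of \<gamma>] not_less intro!: ennreal_leI mult_left_mono)
    qed
    also have "\<dots> = (\<integral>\<^sup>+y. ennreal (k2 (x - y) * F y) \<partial>lborel) + (\<integral>\<^sup>+y. ennreal \<gamma> * ennreal (k1 (x - y)) \<partial>lborel) + W x"
      unfolding W_def by (simp add: nn_integral_add)
    also have "\<dots> \<le> ennreal (s / 2) + ennreal (s / 4) + W x"
      using A B by (intro add_mono) auto
    also have "ennreal (s / 2) + ennreal (s / 4) = ennreal (3 * s / 4)"
      using s by (simp add: ennreal_plus[symmetric] del: ennreal_plus)
    finally show ?thesis .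
  qed
  \<comment> \<open>Where the potential exceeds s, the remaining piece W exceeds s/4, and Markov's
    inequality applies to W.\<close>
  have "emeasure lborel {x. ennreal s < (\<integral>\<^sup>+y. ennreal (\<bar>x - y\<bar> powr (\<alpha> - 1) * F y) \<partial>lborel)}
    \<le> emeasure lborel {x \<in> UNIV. 1 \<le> ennreal (4 / s) * W x}"
  proof (intro emeasure_mono subsetI CollectI conjI)
    fix x assume "x \<in> {x. ennreal s < (\<integral>\<^sup>+y. ennreal (\<bar>x - y\<bar> powr (\<alpha> - 1) * F y) \<partial>lborel)}"
    then have *: "ennreal s < ennreal (3 * s / 4) + W x" using T[of x] by auto
    show "1 \<le> ennreal (4 / s) * W x"
    proof (cases "W x")
      case (real w)
      have "s < 3 * s / 4 + w"
        using * real s by (simp add: ennreal_plus[symmetric] ennreal_less_iff del: ennreal_plus)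
      then have "1 \<le> 4 / s * w" using s by (simp add: field_simps)
      then show ?thesis using real s by (simp add: ennreal_mult[symmetric] ennreal_leI flip: ennreal_1)
    next
      case top
      then show ?thesis using s by (simp add: ennreal_mult_top)
    qed
  qed auto
  also have "\<dots> \<le> ennreal (4 / s) * (\<integral>\<^sup>+x\<in>UNIV. W x \<partial>lborel)"
    using nn_integral_Markov_inequality[where u = W and M = lborel and A = UNIV and c = "ennreal (4 / s)"] by simp
  also have "(\<integral>\<^sup>+x\<in>UNIV. W x \<partial>lborel) = (\<integral>\<^sup>+y. \<integral>\<^sup>+x. ennreal (k1 (x - y)) * (ennreal (F y) * indicator {y. \<gamma> < F y} y) \<partial>lborel \<partial>lborel)"
    unfolding W_def by (simp, rule lborel_pair.Fubini') measurable
  also have "\<dots> = (\<integral>\<^sup>+y. ennreal (2 * R powr \<alpha> / \<alpha>) * (ennreal (F y) * indicator {y. \<gamma> < F y} y) \<partial>lborel)"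
    using nn_integral_translate_reflect(2)[of "\<lambda>z. ennreal (k1 z)"] k1 by (simp add: nn_integral_multc)
  also have "\<dots> = ennreal (2 * R powr \<alpha> / \<alpha>) * (\<integral>\<^sup>+y. ennreal (F y) * indicator {y. \<gamma> < F y} y \<partial>lborel)"
    by (simp add: nn_integral_cmult)
  also have "ennreal (4 / s) * (ennreal (2 * R powr \<alpha> / \<alpha>) * (\<integral>\<^sup>+y. ennreal (F y) * indicator {y. \<gamma> < F y} y \<partial>lborel))
     = ennreal (D * s powr (- q / p)) * (\<integral>\<^sup>+y. ennreal (F y) * indicator {y. \<gamma> < F y} y \<partial>lborel)"
    unfolding R\<alpha> using s D0
    by (simp add: mult.assoc[symmetric] ennreal_mult[symmetric] powr_diff powr_minus_divide)
  finally show ?thesis by (simp add: \<gamma>_def)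
qed

text \<open>Marcinkiewicz interpolation carried out by hand. In the weak estimate the truncation
  height of F depends on the level s, so inserting it into the layer cake formula and integrating in
  s first gives the strong bound directly: each y contributes a multiple of (D F y)^p.\<close>

theorem hardy_littlewood_sobolev:
  assumes p: "1 < p" "p < q"
  shows "kernel_bounded p q (\<lambda>x y. \<bar>x - y\<bar> powr (1 / p - 1 / q - 1))"
proof -
  define p' where "p' = p / (p - 1)"
  have p': "1 / p + 1 / p' = 1" "1 < p'" using p by (auto simp: p'_def field_simps)
  define \<alpha> where "\<alpha> = 1 / p - 1 / q"
  have \<alpha>: "0 < \<alpha>" using p by (simp add: \<alpha>_def field_simps)
  define D where "D = 8 * (2 * (2 * q / p') powr (1 / p')) powr (q * \<alpha>) / \<alpha>"
  have D0: "0 < D" using \<alpha> p p' by (simp add: D_def)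
  show ?thesis
  proof (rule kernel_boundedI[where C = "p' * D powr p"])
    fix F :: "real \<Rightarrow> real"
    assume [measurable]: "F \<in> borel_measurable borel" and nn: "\<And>x. 0 \<le> F x"
      and F: "lp_integral p F \<le> 1"
    define T where "T x = (\<integral>\<^sup>+y. ennreal (\<bar>x - y\<bar> powr (\<alpha> - 1) * F y) \<partial>lborel)" for x
    have [measurable]: "T \<in> borel_measurable borel" unfolding T_def by measurable
    have "(\<integral>\<^sup>+x. epowr (T x) q \<partial>lborel)
      = (\<integral>\<^sup>+x. \<integral>\<^sup>+s. ennreal (q * s powr (q - 1)) * indicator {s. 0 < s \<and> ennreal s < T x} s \<partial>lborel \<partial>lborel)"
      using p by (simp add: epowr_layer_cake)
    also have "\<dots> = (\<integral>\<^sup>+s. \<integral>\<^sup>+x. ennreal (q * s powr (q - 1)) * indicator {s. 0 < s \<and> ennreal s < T x} s \<partial>lborel \<partial>lborel)"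
      by (rule lborel_pair.Fubini') (simp add: indicator_def)
    also have "\<dots> \<le> (\<integral>\<^sup>+s. \<integral>\<^sup>+y. ennreal (q * D * s powr (q - 1 - q / p)) * (ennreal (F y) * indicator {0<..<(D * F y) powr (p / q)} s) \<partial>lborel \<partial>lborel)"
    proof (rule nn_integral_mono)
      fix s :: real
      show "(\<integral>\<^sup>+x. ennreal (q * s powr (q - 1)) * indicator {s. 0 < s \<and> ennreal s < T x} s \<partial>lborel)
        \<le> (\<integral>\<^sup>+y. ennreal (q * D * s powr (q - 1 - q / p)) * (ennreal (F y) * indicator {0<..<(D * F y) powr (p / q)} s) \<partial>lborel)"
      proof (cases "0 < s")
        case True
        have "(\<integral>\<^sup>+x. ennreal (q * s powr (q - 1)) * indicator {s. 0 < s \<and> ennreal s < T x} s \<partial>lborel)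
          = (\<integral>\<^sup>+x. ennreal (q * s powr (q - 1)) * indicator {x. ennreal s < T x} x \<partial>lborel)"
          using True by (intro nn_integral_cong) (auto simp: indicator_def)
        also have "\<dots> = ennreal (q * s powr (q - 1)) * emeasure lborel {x. ennreal s < T x}"
          by (subst nn_integral_cmult_indicator) auto
        also have "\<dots> \<le> ennreal (q * s powr (q - 1)) * (ennreal (D * s powr (- q / p)) *
           (\<integral>\<^sup>+y. ennreal (F y) * indicator {y. s powr (q / p) / D < F y} y \<partial>lborel))"
          unfolding T_def D_def \<alpha>_def using p p' True nn F
          by (intro mult_left_mono riesz_potential_weak_estimate) auto
        also have "\<dots> = ennreal (q * D * s powr (q - 1 - q / p)) *
           (\<integral>\<^sup>+y. ennreal (F y) * indicator {y. s powr (q / p) / D < F y} y \<partial>lborel)"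
        proof -
          have e: "q * s powr (q - 1) * (D * s powr (- q / p)) = q * D * s powr (q - 1 - q / p)"
            using powr_add[of s "q - 1" "- q / p"] by (simp add: algebra_simps)
          then show ?thesis
            using p D0 by (simp only: flip: e) (simp add: ennreal_mult mult.assoc)
        qed
        \<comment> \<open>The condition on F y is solved for s, so that after Tonelli the integral
          in s runs over an interval.\<close>
        also have "(\<integral>\<^sup>+y. ennreal (F y) * indicator {y. s powr (q / p) / D < F y} y \<partial>lborel)
          = (\<integral>\<^sup>+y. ennreal (F y) * indicator {0<..<(D * F y) powr (p / q)} s \<partial>lborel)"
        proof (intro nn_integral_cong)
          fix y
          have "s powr (q / p) / D < F y \<longleftrightarrow> s powr (q / p) < D * F y"
            using D0 by (simp add: field_simps)
          also have "\<dots> \<longleftrightarrow> (s powr (q / p)) powr (p / q) < (D * F y) powr (p / q)"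
          proof
            assume "s powr (q / p) < D * F y"
            then show "(s powr (q / p)) powr (p / q) < (D * F y) powr (p / q)"
              using p by (intro powr_less_mono2) auto
          next
            assume *: "(s powr (q / p)) powr (p / q) < (D * F y) powr (p / q)"
            show "s powr (q / p) < D * F y"
            proof (rule ccontr)
              assume "\<not> s powr (q / p) < D * F y"
              then have "(D * F y) powr (p / q) \<le> (s powr (q / p)) powr (p / q)"
                using p D0 nn[of y] by (intro powr_mono2) auto
              with * show False by simp
            qed
          qed
          also have "(s powr (q / p)) powr (p / q) = s"
            using p True by (simp add: powr_powr)
          finally show "ennreal (F y) * indicator {y. s powr (q / p) / D < F y} y
             = ennreal (F y) * indicator {0<..<(D * F y) powr (p / q)} s"
            using True by (simp add: indicator_def)
        qed
        also have "ennreal (q * D * s powr (q - 1 - q / p)) * (\<integral>\<^sup>+y. ennreal (F y) * indicator {0<..<(D * F y) powr (p / q)} s \<partial>lborel)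
          = (\<integral>\<^sup>+y. ennreal (q * D * s powr (q - 1 - q / p)) * (ennreal (F y) * indicator {0<..<(D * F y) powr (p / q)} s) \<partial>lborel)"
          by (rule nn_integral_cmult[symmetric]) (simp add: indicator_def)
        finally show ?thesis .
      qed simp
    qed
    also have "\<dots> = (\<integral>\<^sup>+y. \<integral>\<^sup>+s. ennreal (q * D * s powr (q - 1 - q / p)) * (ennreal (F y) * indicator {0<..<(D * F y) powr (p / q)} s) \<partial>lborel \<partial>lborel)"
      by (rule lborel_pair.Fubini') (simp add: indicator_def)
    also have "\<dots> = (\<integral>\<^sup>+y. ennreal (p' * D powr p) * ennreal (F y powr p) \<partial>lborel)"
    proof (intro nn_integral_cong)
      fix y
      define X where "X = (D * F y) powr (p / q)"
      have "1 / p' = 1 - 1 / p" using p' by linarith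
      then have "q * (1 / p') = q * (1 - 1 / p)" by simp
      \<comment> \<open>Since q/p' > 0, the power of s is integrable at 0; this is where 1 < p
        enters.\<close>
      then have e: "q - 1 - q / p + 1 = q / p'" by (simp add: algebra_simps)
      have e0: "0 < q / p'" using p p' by simp
      have "(\<integral>\<^sup>+s. ennreal (q * D * s powr (q - 1 - q / p)) * (ennreal (F y) * indicator {0<..<X} s) \<partial>lborel)
        = (\<integral>\<^sup>+s. ennreal (q * D * F y) * (ennreal (s powr (q - 1 - q / p)) * indicator {0<..<X} s) \<partial>lborel)"
        using p D0 nn by (intro nn_integral_cong) (auto simp: indicator_def ennreal_mult[symmetric] mult_ac)
      also have "\<dots> = ennreal (q * D * F y) * ennreal (X powr (q / p') / (q / p'))"
        using e e0 by (subst nn_integral_cmult) (auto simp: nn_integral_powr_0 X_def)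
      also have "\<dots> = ennreal (p' * (D * F y * X powr (q / p')))"
        using p p' D0 nn by (simp add: ennreal_mult[symmetric])
      also have "X powr (q / p') = (D * F y) powr (p - 1)"
        using p p' by (simp add: X_def powr_powr p'_def)
      also have "D * F y * (D * F y) powr (p - 1) = (D * F y) powr p"
        using D0 nn[of y] by (cases "F y = 0") (auto simp: powr_diff)
      finally show "(\<integral>\<^sup>+s. ennreal (q * D * s powr (q - 1 - q / p)) * (ennreal (F y) * indicator {0<..<(D * F y) powr (p / q)} s) \<partial>lborel)
        = ennreal (p' * D powr p) * ennreal (F y powr p)"
        using D0 nn p' by (simp add: X_def powr_mult ennreal_mult[symmetric] mult.assoc)
    qed
    also have "\<dots> = ennreal (p' * D powr p) * lp_integral p F"
      by (simp add: nn_integral_cmult)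
    also have "\<dots> \<le> ennreal (p' * D powr p) * 1"
      by (intro mult_left_mono F) auto
    finally show "(\<integral>\<^sup>+x. epowr (\<integral>\<^sup>+y. ennreal (\<bar>x - y\<bar> powr (1 / p - 1 / q - 1) * F y) \<partial>lborel) q \<partial>lborel) \<le> ennreal (p' * D powr p)"
      by (simp add: T_def \<alpha>_def)
  qed
qed

section \<open>Schur's test, Hardy's inequalities and the three regions of the weighted
  kernel\<close>

abbreviation near :: "real \<Rightarrow> real \<Rightarrow> real" where
  "near x y \<equiv> indicator {y. \<bar>x\<bar> < 2 * \<bar>y\<bar> \<and> \<bar>y\<bar> < 2 * \<bar>x\<bar>} y"

text \<open>The value x = 0 is removed because \<open>0 powr r\<close> is 0: the pointwise bound
  |y|^(-\<epsilon>) \<le> |x|^(-\<epsilon>) would fail there.\<close>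

abbreviation outer :: "real \<Rightarrow> real \<Rightarrow> real" where
  "outer x y \<equiv> indicator {y. 0 < \<bar>x\<bar> \<and> \<bar>x\<bar> < \<bar>y\<bar>} y"

abbreviation inner :: "real \<Rightarrow> real \<Rightarrow> real" where
  "inner x y \<equiv> indicator {y. \<bar>y\<bar> < \<bar>x\<bar>} y"

text \<open>With F = |y|^a |f| both weights move into the kernel, and a bound between the weighted
  spaces becomes an unweighted one.\<close>

abbreviation weighted :: "real \<Rightarrow> real \<Rightarrow> (real \<Rightarrow> real) \<Rightarrow> real \<Rightarrow> real \<Rightarrow> real" where
  "weighted a b k x y \<equiv> \<bar>x\<bar> powr (- b) * k (x - y) * \<bar>y\<bar> powr (- a)"

text \<open>Hoelder for S = S^(1/p') S^(1/p) bounds the p-th power of the integral by c^(p-1) times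
  the integral of S F^p, by the first marginal. Tonelli and the second marginal finish.\<close>

lemma schur_test:
  fixes S :: "real \<Rightarrow> real \<Rightarrow> real" and F :: "real \<Rightarrow> real"
  assumes meas [measurable]: "case_prod S \<in> borel_measurable (borel \<Otimes>\<^sub>M borel)" "F \<in> borel_measurable borel"
    and nn: "\<And>x y. 0 \<le> S x y" "\<And>x. 0 \<le> F x" "0 \<le> c"
    and p: "1 < p"
    and F: "lp_integral p F \<le> 1"
    and S1: "AE x in lborel. (\<integral>\<^sup>+y. ennreal (S x y) \<partial>lborel) \<le> ennreal c"
    and S2: "AE y in lborel. (\<integral>\<^sup>+x. ennreal (S x y) \<partial>lborel) \<le> ennreal c"
  shows "(\<integral>\<^sup>+x. epowr (\<integral>\<^sup>+y. ennreal (S x y * F y) \<partial>lborel) p \<partial>lborel) \<le> ennreal (c powr p)"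
proof -
  define p' where "p' = p / (p - 1)"
  have p': "1 / p + 1 / p' = 1" "1 < p'" using p by (auto simp: p'_def field_simps)
  have [measurable]: "S x \<in> borel_measurable borel" for x by measurable
  define G where "G x = (\<integral>\<^sup>+y. ennreal (S x y) * ennreal (F y powr p) \<partial>lborel)" for x
  have [measurable]: "G \<in> borel_measurable borel" unfolding G_def by measurable
  have G: "(\<integral>\<^sup>+x. G x \<partial>lborel) \<le> ennreal c"
  proof -
    have "(\<integral>\<^sup>+x. G x \<partial>lborel) = (\<integral>\<^sup>+y. \<integral>\<^sup>+x. ennreal (S x y) * ennreal (F y powr p) \<partial>lborel \<partial>lborel)"
      unfolding G_def by (rule lborel_pair.Fubini') measurable
    also have "\<dots> = (\<integral>\<^sup>+y. (\<integral>\<^sup>+x. ennreal (S x y) \<partial>lborel) * ennreal (F y powr p) \<partial>lborel)"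
      by (simp add: nn_integral_multc)
    also have "\<dots> \<le> (\<integral>\<^sup>+y. ennreal c * ennreal (F y powr p) \<partial>lborel)"
      by (rule nn_integral_mono_AE, use S2 in eventually_elim) (auto intro: mult_right_mono)
    also have "\<dots> = ennreal c * lp_integral p F"
      by (simp add: nn_integral_cmult)
    also have "\<dots> \<le> ennreal c * 1" by (intro mult_left_mono F) auto
    finally show ?thesis by simp
  qed
  \<comment> \<open>Finiteness almost everywhere turns G x into a real number, as Hoelder's
    inequality requires.\<close>
  then have "AE x in lborel. G x \<noteq> \<infinity>"
    by (intro nn_integral_PInf_AE) (auto simp: top_unique)
  with S1 have "AE x in lborel. epowr (\<integral>\<^sup>+y. ennreal (S x y * F y) \<partial>lborel) p \<le> ennreal (c powr (p - 1)) * G x"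
  proof eventually_elim
    case (elim x)
    then obtain g where g: "G x = ennreal g" "0 \<le> g" by (cases "G x") auto
    have eq: "(S x y powr (1 / p) * F y) powr p = S x y * F y powr p" for y
      using p nn by (simp add: powr_mult powr_powr)
    have "(\<integral>\<^sup>+y. ennreal (S x y powr (1 / p') * (S x y powr (1 / p) * F y)) \<partial>lborel) \<le> ennreal (c powr (1 / p') * g powr (1 / p))"
      using p p' nn elim g
      by (intro nn_integral_Holder) (auto simp: powr_powr eq G_def ennreal_mult)
    moreover have "S x y powr (1 / p') * (S x y powr (1 / p) * F y) = S x y * F y" for y
      using p' nn by (simp add: mult.assoc[symmetric] powr_add[symmetric] add.commute)
    ultimately have "epowr (\<integral>\<^sup>+y. ennreal (S x y * F y) \<partial>lborel) p \<le> epowr (ennreal (c powr (1 / p') * g powr (1 / p))) p"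
      using p by (intro epowr_mono) auto
    also have "\<dots> = ennreal (c powr (p - 1) * g)"
      using nn g p by (simp add: epowr_ennreal powr_mult powr_powr p'_def)
    finally show ?case using g nn by (simp add: ennreal_mult)
  qed
  then have "(\<integral>\<^sup>+x. epowr (\<integral>\<^sup>+y. ennreal (S x y * F y) \<partial>lborel) p \<partial>lborel) \<le> (\<integral>\<^sup>+x. ennreal (c powr (p - 1)) * G x \<partial>lborel)"
    by (rule nn_integral_mono_AE)
  also have "\<dots> = ennreal (c powr (p - 1)) * (\<integral>\<^sup>+x. G x \<partial>lborel)"
    by (simp add: nn_integral_cmult)
  also have "\<dots> \<le> ennreal (c powr (p - 1)) * ennreal c"
    by (intro mult_left_mono G) auto
  also have "\<dots> = ennreal (c powr p)"
    using nn by (cases "c = 0") (auto simp: ennreal_mult[symmetric] powr_diff)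
  finally show ?thesis .
qed

text \<open>\<open>kernel_test\<close> with |y|^(-a) split as |y|^(-a-\<epsilon>) |y|^\<epsilon>,
  where \<epsilon> is half of the slack 1/p' - a. The first factor is still p'-integrable at 0, the
  second is at most |x|^\<epsilon> in the region, and the positive \<epsilon> makes the integral in
  x converge at infinity. By homogeneity all powers of x and y cancel in the end.\<close>

lemma hardy_inequality_inner:
  assumes p: "1 < p" "p \<le> q" and a: "a < 1 - 1 / p"
  shows "kernel_bounded p q (\<lambda>x y. \<bar>x\<bar> powr (a + 1 / p - 1 / q - 1) * \<bar>y\<bar> powr (- a) * indicator {y. \<bar>y\<bar> < \<bar>x\<bar>} y)"
proof -
  define p' where "p' = p / (p - 1)"
  have p': "1 / p + 1 / p' = 1" "1 < p'" using p by (auto simp: p'_def field_simps)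
  define \<epsilon> where "\<epsilon> = (1 - 1 / p - a) / 2"
  define \<eta> where "\<eta> = 1 - (a + \<epsilon>) * p'"
  have \<epsilon>: "0 < \<epsilon>" using a by (simp add: \<epsilon>_def)
  have half: "a + (u - a) / 2 < u" if "a < u" for u using that by (simp add: field_simps)
  have \<eta>: "0 < \<eta>"
  proof -
    have "a + \<epsilon> < 1 - 1 / p" unfolding \<epsilon>_def by (rule half) (rule a)
    also have "1 - 1 / p = 1 / p'" using p'(1) by linarith
    finally have "a + \<epsilon> < 1 / p'" .
    then show ?thesis using p' by (simp add: \<eta>_def field_simps)
  qed
  have ae: "(- a - \<epsilon>) * p' = \<eta> - 1" by (simp add: \<eta>_def algebra_simps)
  \<comment> \<open>Its p'-th power 2/\<eta> is the constant in the integral of |y|^(\<eta> - 1)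
    over |y| < |x|.\<close>
  define c where "c = (2 / \<eta>) powr (1 / p')"
  define s where "s = a + 1 / p - 1 / q - 1"
  have se: "s * p' + \<eta> = (- 1 / q - \<epsilon>) * p'"
  proof -
    have "s + 1 / p' - (a + \<epsilon>) = - 1 / q - \<epsilon>" using p' by (simp add: s_def)
    then have "(s + 1 / p' - (a + \<epsilon>)) * p' = (- 1 / q - \<epsilon>) * p'" by simp
    then show ?thesis using p' by (simp add: \<eta>_def algebra_simps)
  qed
  show ?thesis
  proof (rule kernel_boundedI[where C = "2 * c powr q / (\<epsilon> * p)"])
    fix F :: "real \<Rightarrow> real"
    assume [measurable]: "F \<in> borel_measurable borel" and nn: "\<And>x. 0 \<le> F x"
      and F: "lp_integral p F \<le> 1"
    define A where "A x y = \<bar>x\<bar> powr s * \<bar>y\<bar> powr (- a - \<epsilon>) * indicator {y. \<bar>y\<bar> < \<bar>x\<bar>} y" for x y :: real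
    define B where "B x y = \<bar>y\<bar> powr \<epsilon> * indicator {y. \<bar>y\<bar> < \<bar>x\<bar>} y" for x y :: real
    have "(\<integral>\<^sup>+x. epowr (\<integral>\<^sup>+y. ennreal (A x y * B x y * F y) \<partial>lborel) q \<partial>lborel) \<le> ennreal (2 * c powr q / (\<epsilon> * p))"
    proof (rule kernel_test[where p = p and p' = p' and \<alpha> = "\<lambda>x. c * \<bar>x\<bar> powr (- 1 / q - \<epsilon>)" and \<beta> = "\<lambda>x. \<bar>x\<bar> powr \<epsilon>"])
      show "B x y \<le> \<bar>x\<bar> powr \<epsilon>" for x y
        using \<epsilon> by (auto simp: B_def indicator_def intro: powr_mono2)
      show "AE x in lborel. (\<integral>\<^sup>+y. ennreal (A x y powr p') \<partial>lborel) \<le> ennreal ((c * \<bar>x\<bar> powr (- 1 / q - \<epsilon>)) powr p')"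
        using AE_lborel_singleton[of 0]
      proof eventually_elim
        case (elim x)
        have "(\<integral>\<^sup>+y. ennreal (A x y powr p') \<partial>lborel)
          = (\<integral>\<^sup>+y. ennreal (\<bar>x\<bar> powr (s * p')) * (ennreal (\<bar>y\<bar> powr (\<eta> - 1)) * indicator {y. \<bar>y\<bar> < \<bar>x\<bar>} y) \<partial>lborel)"
          by (intro nn_integral_cong) (auto simp: A_def indicator_def powr_mult powr_powr ennreal_mult ae)
        also have "\<dots> = ennreal (\<bar>x\<bar> powr (s * p')) * ennreal (2 * \<bar>x\<bar> powr \<eta> / \<eta>)"
          using \<eta> by (subst nn_integral_cmult) (auto simp: nn_integral_abs_powr_0)
        also have "\<dots> = ennreal (2 / \<eta> * \<bar>x\<bar> powr (s * p' + \<eta>))"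
          using \<eta> by (simp add: ennreal_mult[symmetric] powr_add mult_ac)
        also have "2 / \<eta> * \<bar>x\<bar> powr (s * p' + \<eta>) = (c * \<bar>x\<bar> powr (- 1 / q - \<epsilon>)) powr p'"
          unfolding se using \<eta> p' by (simp add: powr_mult powr_powr c_def)
        finally show ?case by simp
      qed
      show "AE y in lborel. (\<integral>\<^sup>+x. ennreal ((c * \<bar>x\<bar> powr (- 1 / q - \<epsilon>)) powr q * (\<bar>x\<bar> powr \<epsilon>) powr (q - p) * B x y powr p) \<partial>lborel)
         \<le> ennreal (2 * c powr q / (\<epsilon> * p))"
        using AE_lborel_singleton[of 0]
      proof eventually_elim
        case (elim y)
        have "(c * \<bar>x\<bar> powr (- 1 / q - \<epsilon>)) powr q * (\<bar>x\<bar> powr \<epsilon>) powr (q - p) = c powr q * \<bar>x\<bar> powr (- 1 - \<epsilon> * p)" for x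
        proof -
          \<comment> \<open>The exponent is below -1, and integrating it over |x| \<ge> |y| produces
            |y|^(-\<epsilon> p), the inverse of the p-th power of B.\<close>
          have "(- 1 / q - \<epsilon>) * q + \<epsilon> * (q - p) = - 1 - \<epsilon> * p" using p by (simp add: field_simps)
          then show ?thesis
            using p by (simp add: powr_mult powr_powr mult.assoc powr_add[symmetric] c_def)
        qed
        then have "(\<integral>\<^sup>+x. ennreal ((c * \<bar>x\<bar> powr (- 1 / q - \<epsilon>)) powr q * (\<bar>x\<bar> powr \<epsilon>) powr (q - p) * B x y powr p) \<partial>lborel)
          \<le> (\<integral>\<^sup>+x. ennreal (c powr q * \<bar>y\<bar> powr (\<epsilon> * p)) * (ennreal (\<bar>x\<bar> powr (- 1 - \<epsilon> * p)) * indicator {x. \<bar>y\<bar> \<le> \<bar>x\<bar>} x) \<partial>lborel)"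
          by (intro nn_integral_mono) (auto simp: B_def indicator_def powr_powr ennreal_mult[symmetric] mult_ac)
        also have "\<dots> = ennreal (c powr q * \<bar>y\<bar> powr (\<epsilon> * p)) * ennreal (2 * \<bar>y\<bar> powr (- (\<epsilon> * p)) / (\<epsilon> * p))"
          using \<epsilon> p elim by (subst nn_integral_cmult) (auto simp: nn_integral_abs_powr_inf)
        also have "\<dots> = ennreal (2 * c powr q / (\<epsilon> * p))"
          using \<epsilon> p elim by (simp add: ennreal_mult[symmetric] powr_minus field_simps)
        finally show ?case by simp
      qed
    qed (use p p' nn F in \<open>simp_all add: A_def B_def c_def indicator_def\<close>)
    moreover have "A x y * B x y * F y = \<bar>x\<bar> powr s * \<bar>y\<bar> powr (- a) * inner x y * F y" for x y
      by (auto simp: A_def B_def indicator_def mult.assoc powr_add[symmetric])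
    ultimately show "(\<integral>\<^sup>+x. epowr (\<integral>\<^sup>+y. ennreal (\<bar>x\<bar> powr (a + 1 / p - 1 / q - 1) * \<bar>y\<bar> powr (- a) * inner x y * F y) \<partial>lborel) q \<partial>lborel)
        \<le> ennreal (2 * c powr q / (\<epsilon> * p))"
      by (simp add: s_def)
  qed
qed

text \<open>The mirror image of the inner inequality, with 2 \<epsilon> the slack 1/q - b: now the
  integral in y converges at infinity and the one in x at 0, again with a factor |y|^(-\<epsilon>)
  moved from A to B.\<close>

lemma hardy_inequality_outer:
  assumes p: "1 < p" "p \<le> q" and b: "b < 1 / q"
  shows "kernel_bounded p q (\<lambda>x y. \<bar>x\<bar> powr (- b) * \<bar>y\<bar> powr (b + 1 / p - 1 / q - 1) * outer x y)"
proof -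
  define p' where "p' = p / (p - 1)"
  have p': "1 / p + 1 / p' = 1" "1 < p'" using p by (auto simp: p'_def field_simps)
  define \<epsilon> where "\<epsilon> = (1 / q - b) / 2"
  have \<epsilon>: "0 < \<epsilon>" "1 / q - b = 2 * \<epsilon>" using b by (auto simp: \<epsilon>_def)
  define c where "c = (2 / (\<epsilon> * p')) powr (1 / p')"
  define s where "s = b + 1 / p - 1 / q - 1"
  have se: "(s + \<epsilon>) * p' = - 1 - \<epsilon> * p'"
  proof -
    have "s + \<epsilon> = - (1 / p') - \<epsilon>" using p' \<epsilon> by (simp add: s_def)
    then show ?thesis using p' by (simp add: field_simps)
  qed
  show ?thesis
  proof (rule kernel_boundedI[where C = "2 * c powr q / (\<epsilon> * p)"])
    fix F :: "real \<Rightarrow> real"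
    assume [measurable]: "F \<in> borel_measurable borel" and nn: "\<And>x. 0 \<le> F x"
      and F: "lp_integral p F \<le> 1"
    define A where "A x y = \<bar>x\<bar> powr (- b) * \<bar>y\<bar> powr (s + \<epsilon>) * outer x y" for x y :: real
    define B where "B x y = \<bar>y\<bar> powr (- \<epsilon>) * outer x y" for x y :: real
    have "(\<integral>\<^sup>+x. epowr (\<integral>\<^sup>+y. ennreal (A x y * B x y * F y) \<partial>lborel) q \<partial>lborel) \<le> ennreal (2 * c powr q / (\<epsilon> * p))"
    proof (rule kernel_test[where p = p and p' = p' and \<alpha> = "\<lambda>x. c * \<bar>x\<bar> powr (\<epsilon> - 1 / q)" and \<beta> = "\<lambda>x. \<bar>x\<bar> powr (- \<epsilon>)"])
      show "B x y \<le> \<bar>x\<bar> powr (- \<epsilon>)" for x y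
        using \<epsilon> by (auto simp: B_def indicator_def intro: powr_mono2')
      show "AE x in lborel. (\<integral>\<^sup>+y. ennreal (A x y powr p') \<partial>lborel) \<le> ennreal ((c * \<bar>x\<bar> powr (\<epsilon> - 1 / q)) powr p')"
        using AE_lborel_singleton[of 0]
      proof eventually_elim
        case (elim x)
        have "(\<integral>\<^sup>+y. ennreal (A x y powr p') \<partial>lborel)
          \<le> (\<integral>\<^sup>+y. ennreal (\<bar>x\<bar> powr (- b * p')) * (ennreal (\<bar>y\<bar> powr (- 1 - \<epsilon> * p')) * indicator {y. \<bar>x\<bar> \<le> \<bar>y\<bar>} y) \<partial>lborel)"
          by (intro nn_integral_mono) (auto simp: A_def indicator_def powr_mult powr_powr ennreal_mult se)
        also have "\<dots> = ennreal (\<bar>x\<bar> powr (- b * p')) * ennreal (2 * \<bar>x\<bar> powr (- (\<epsilon> * p')) / (\<epsilon> * p'))"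
          using \<epsilon> p' elim by (subst nn_integral_cmult) (auto simp: nn_integral_abs_powr_inf)
        also have "\<dots> = ennreal (2 / (\<epsilon> * p') * \<bar>x\<bar> powr (- b * p' + - (\<epsilon> * p')))"
          using \<epsilon> p' unfolding powr_add by (simp add: ennreal_mult[symmetric] mult_ac)
        also have "- b * p' + - (\<epsilon> * p') = (\<epsilon> - 1 / q) * p'"
        proof -
          have "1 / q = 2 * \<epsilon> + b" using \<epsilon> by simp
          then show ?thesis by (simp add: algebra_simps)
        qed
        also have "2 / (\<epsilon> * p') * \<bar>x\<bar> powr ((\<epsilon> - 1 / q) * p') = (c * \<bar>x\<bar> powr (\<epsilon> - 1 / q)) powr p'"
          using \<epsilon> p' by (simp add: powr_mult powr_powr c_def)
        finally show ?case by simp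
      qed
      show "AE y in lborel. (\<integral>\<^sup>+x. ennreal ((c * \<bar>x\<bar> powr (\<epsilon> - 1 / q)) powr q * (\<bar>x\<bar> powr (- \<epsilon>)) powr (q - p) * B x y powr p) \<partial>lborel)
         \<le> ennreal (2 * c powr q / (\<epsilon> * p))"
        using AE_lborel_singleton[of 0]
      proof eventually_elim
        case (elim y)
        have "(c * \<bar>x\<bar> powr (\<epsilon> - 1 / q)) powr q * (\<bar>x\<bar> powr (- \<epsilon>)) powr (q - p) = c powr q * \<bar>x\<bar> powr (\<epsilon> * p - 1)" for x
        proof -
          have "(\<epsilon> - 1 / q) * q + - \<epsilon> * (q - p) = \<epsilon> * p - 1" using p by (simp add: field_simps)
          then show ?thesis
            using p by (simp add: powr_mult powr_powr mult.assoc powr_add[symmetric] c_def)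
        qed
        then have "(\<integral>\<^sup>+x. ennreal ((c * \<bar>x\<bar> powr (\<epsilon> - 1 / q)) powr q * (\<bar>x\<bar> powr (- \<epsilon>)) powr (q - p) * B x y powr p) \<partial>lborel)
          \<le> (\<integral>\<^sup>+x. ennreal (c powr q * \<bar>y\<bar> powr (- (\<epsilon> * p))) * (ennreal (\<bar>x\<bar> powr (\<epsilon> * p - 1)) * indicator {x. \<bar>x\<bar> < \<bar>y\<bar>} x) \<partial>lborel)"
          by (intro nn_integral_mono) (auto simp: B_def indicator_def powr_powr ennreal_mult[symmetric] mult_ac)
        also have "\<dots> = ennreal (c powr q * \<bar>y\<bar> powr (- (\<epsilon> * p))) * ennreal (2 * \<bar>y\<bar> powr (\<epsilon> * p) / (\<epsilon> * p))"
          using \<epsilon> p elim by (subst nn_integral_cmult) (auto simp: nn_integral_abs_powr_0)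
        also have "\<dots> = ennreal (2 * c powr q / (\<epsilon> * p))"
          using \<epsilon> p elim by (simp add: ennreal_mult[symmetric] powr_minus field_simps)
        finally show ?case by simp
      qed
    qed (use p p' nn F in \<open>simp_all add: A_def B_def c_def indicator_def\<close>)
    moreover have "A x y * B x y * F y = \<bar>x\<bar> powr (- b) * \<bar>y\<bar> powr s * outer x y * F y" for x y
      by (auto simp: A_def B_def indicator_def mult.assoc powr_add[symmetric])
    ultimately show "(\<integral>\<^sup>+x. epowr (\<integral>\<^sup>+y. ennreal (\<bar>x\<bar> powr (- b) * \<bar>y\<bar> powr (b + 1 / p - 1 / q - 1) * outer x y * F y) \<partial>lborel) q \<partial>lborel)
        \<le> ennreal (2 * c powr q / (\<epsilon> * p))"
      by (simp add: s_def)
  qed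
qed

text \<open>In the region |x - y| < 3 |x| and |x - y| < 3 |y|, so both marginals reduce to
  X^(-\<theta>) times the integral of k over |z| < 3 X. For \<theta> > 0 the power bound makes this
  independent of X. For \<theta> = 0 the power is not integrable and the total integral of k takes
  over.\<close>

lemma schur_near_diagonal:
  fixes k :: "real \<Rightarrow> real"
  assumes [measurable]: "k \<in> borel_measurable borel" and k_nn: "\<And>z. 0 \<le> k z"
    and k_le: "\<And>z. z \<noteq> 0 \<Longrightarrow> k z \<le> A * \<bar>z\<bar> powr (\<theta> - 1)" and A: "0 \<le> A"
    and k_int: "(\<integral>\<^sup>+z. ennreal (k z) \<partial>lborel) \<le> ennreal N" and N: "0 \<le> N"
    and \<theta>: "0 \<le> \<theta>" and p: "1 < p"
  shows "kernel_bounded p p (\<lambda>x y. \<bar>x\<bar> powr (- \<theta>) * k (x - y) * near x y)"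
proof -
  define B where "B = (if \<theta> = 0 then N else 2 * A * 3 powr \<theta> / \<theta>)"
  have B: "0 \<le> B" using \<theta> A N by (simp add: B_def)
  have k0: "(\<integral>\<^sup>+z. ennreal (X powr (- \<theta>)) * (ennreal (k z) * indicator {z. \<bar>z\<bar> < 3 * X} z) \<partial>lborel) \<le> ennreal B"
    if X: "0 < X" for X
  proof (cases "\<theta> = 0")
    case True
    then have "(\<integral>\<^sup>+z. ennreal (X powr (- \<theta>)) * (ennreal (k z) * indicator {z. \<bar>z\<bar> < 3 * X} z) \<partial>lborel) \<le> (\<integral>\<^sup>+z. ennreal (k z) \<partial>lborel)"
      using X by (intro nn_integral_mono) (auto simp: indicator_def)
    with k_int True show ?thesis by (simp add: B_def)
  next
    case False
    have "(\<integral>\<^sup>+z. ennreal (X powr (- \<theta>)) * (ennreal (k z) * indicator {z. \<bar>z\<bar> < 3 * X} z) \<partial>lborel)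
      \<le> (\<integral>\<^sup>+z. ennreal (X powr (- \<theta>) * A) * (ennreal (\<bar>z\<bar> powr (\<theta> - 1)) * indicator {z. \<bar>z\<bar> < 3 * X} z) \<partial>lborel)"
    proof (rule nn_integral_mono_AE, use AE_lborel_singleton[of "0 :: real"] in eventually_elim)
      case (elim z)
      have "X powr (- \<theta>) * k z \<le> X powr (- \<theta>) * (A * \<bar>z\<bar> powr (\<theta> - 1))"
        by (intro mult_left_mono k_le elim) auto
      then show ?case using A k_nn by (auto simp: indicator_def ennreal_mult[symmetric] mult.assoc intro!: ennreal_leI)
    qed
    also have "\<dots> = ennreal (X powr (- \<theta>) * A) * ennreal (2 * (3 * X) powr \<theta> / \<theta>)"
      using False \<theta> X by (subst nn_integral_cmult) (auto simp: nn_integral_abs_powr_0)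
    also have "\<dots> = ennreal B"
      using False \<theta> X A by (simp add: ennreal_mult[symmetric] B_def powr_mult powr_minus field_simps)
    finally show ?thesis .
  qed
  define S where "S x y = \<bar>x\<bar> powr (- \<theta>) * k (x - y) * near x y" for x y
  have S_nn: "0 \<le> S x y" for x y using k_nn by (simp add: S_def)
  have [measurable]: "case_prod S \<in> borel_measurable (borel \<Otimes>\<^sub>M borel)"
    unfolding S_def[abs_def] by (simp add: indicator_def)
  have S1: "(\<integral>\<^sup>+y. ennreal (S x y) \<partial>lborel) \<le> ennreal (2 powr \<theta> * B)" if "x \<noteq> 0" for x
  proof -
    have "(\<integral>\<^sup>+y. ennreal (S x y) \<partial>lborel)
       \<le> (\<integral>\<^sup>+y. ennreal (\<bar>x\<bar> powr (- \<theta>)) * (ennreal (k (x - y)) * indicator {z. \<bar>z\<bar> < 3 * \<bar>x\<bar>} (x - y)) \<partial>lborel)"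
      using k_nn by (intro nn_integral_mono) (auto simp: S_def indicator_def ennreal_mult)
    also have "\<dots> = (\<integral>\<^sup>+z. ennreal (\<bar>x\<bar> powr (- \<theta>)) * (ennreal (k z) * indicator {z. \<bar>z\<bar> < 3 * \<bar>x\<bar>} z) \<partial>lborel)"
      by (rule nn_integral_translate_reflect(1)[where f = "\<lambda>z. ennreal (\<bar>x\<bar> powr (- \<theta>)) * (ennreal (k z) * indicator {z. \<bar>z\<bar> < 3 * \<bar>x\<bar>} z)"]) simp
    also have "\<dots> \<le> ennreal B" using that by (intro k0) simp
    also have "\<dots> \<le> ennreal (2 powr \<theta> * B)"
      using B \<theta> ge_one_powr_ge_zero[of 2 \<theta>] by (intro ennreal_leI) (simp add: mult_le_cancel_right1)
    finally show ?thesis .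
  qed
  \<comment> \<open>Here x is the variable of integration, so its weight is exchanged for that of y
    at the cost of 2^\<theta>.\<close>
  have S2: "(\<integral>\<^sup>+x. ennreal (S x y) \<partial>lborel) \<le> ennreal (2 powr \<theta> * B)" if "y \<noteq> 0" for y
  proof -
    have "(\<integral>\<^sup>+x. ennreal (S x y) \<partial>lborel)
       \<le> (\<integral>\<^sup>+x. ennreal (2 powr \<theta>) * (ennreal (\<bar>y\<bar> powr (- \<theta>)) * (ennreal (k (x - y)) * indicator {z. \<bar>z\<bar> < 3 * \<bar>y\<bar>} (x - y))) \<partial>lborel)"
    proof (rule nn_integral_mono)
      fix x
      have "\<bar>x\<bar> powr (- \<theta>) \<le> 2 powr \<theta> * \<bar>y\<bar> powr (- \<theta>)" if "\<bar>y\<bar> < 2 * \<bar>x\<bar>"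
      proof -
        have "\<bar>x\<bar> powr (- \<theta>) \<le> (\<bar>y\<bar> / 2) powr (- \<theta>)"
          using that \<open>y \<noteq> 0\<close> \<theta> by (intro powr_mono2') auto
        also have "\<dots> = 2 powr \<theta> * \<bar>y\<bar> powr (- \<theta>)" by (rule powr_divide_minus)
        finally show ?thesis .
      qed
      then have *: "\<bar>x\<bar> powr (- \<theta>) * k (x - y) \<le> 2 powr \<theta> * (\<bar>y\<bar> powr (- \<theta>) * k (x - y))" if "\<bar>y\<bar> < 2 * \<bar>x\<bar>"
        unfolding mult.assoc[symmetric] using that by (intro mult_right_mono k_nn) auto
      show "ennreal (S x y) \<le> ennreal (2 powr \<theta>) * (ennreal (\<bar>y\<bar> powr (- \<theta>)) * (ennreal (k (x - y)) * indicator {z. \<bar>z\<bar> < 3 * \<bar>y\<bar>} (x - y)))"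
      proof (cases "\<bar>x\<bar> < 2 * \<bar>y\<bar> \<and> \<bar>y\<bar> < 2 * \<bar>x\<bar>")
        case True
        then have "\<bar>x - y\<bar> < 3 * \<bar>y\<bar>" by linarith
        then show ?thesis using True * k_nn by (simp add: S_def ennreal_mult[symmetric] ennreal_leI)
      qed (simp add: S_def)
    qed
    also have "\<dots> = ennreal (2 powr \<theta>) * (\<integral>\<^sup>+x. ennreal (\<bar>y\<bar> powr (- \<theta>)) * (ennreal (k (x - y)) * indicator {z. \<bar>z\<bar> < 3 * \<bar>y\<bar>} (x - y)) \<partial>lborel)"
      by (rule nn_integral_cmult) (simp add: indicator_def)
    also have "(\<integral>\<^sup>+x. ennreal (\<bar>y\<bar> powr (- \<theta>)) * (ennreal (k (x - y)) * indicator {z. \<bar>z\<bar> < 3 * \<bar>y\<bar>} (x - y)) \<partial>lborel)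
       = (\<integral>\<^sup>+z. ennreal (\<bar>y\<bar> powr (- \<theta>)) * (ennreal (k z) * indicator {z. \<bar>z\<bar> < 3 * \<bar>y\<bar>} z) \<partial>lborel)"
      by (rule nn_integral_translate_reflect(2)[where f = "\<lambda>z. ennreal (\<bar>y\<bar> powr (- \<theta>)) * (ennreal (k z) * indicator {z. \<bar>z\<bar> < 3 * \<bar>y\<bar>} z)"]) simp
    also have "\<dots> \<le> ennreal B" using that by (intro k0) simp
    finally show ?thesis using B by (simp add: ennreal_mult mult_left_mono)
  qed
  show ?thesis
  proof (rule kernel_boundedI[where C = "(2 powr \<theta> * B) powr p"])
    fix F :: "real \<Rightarrow> real"
    assume F: "F \<in> borel_measurable borel" "\<And>x. 0 \<le> F x" "lp_integral p F \<le> 1"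
    have "AE x in lborel. (\<integral>\<^sup>+y. ennreal (S x y) \<partial>lborel) \<le> ennreal (2 powr \<theta> * B)"
      "AE y in lborel. (\<integral>\<^sup>+x. ennreal (S x y) \<partial>lborel) \<le> ennreal (2 powr \<theta> * B)"
      using AE_lborel_singleton[of 0] S1 S2 by (auto elim!: eventually_mono)
    then have "(\<integral>\<^sup>+x. epowr (\<integral>\<^sup>+y. ennreal (S x y * F y) \<partial>lborel) p \<partial>lborel) \<le> ennreal ((2 powr \<theta> * B) powr p)"
      using F p S_nn B by (intro schur_test) auto
    then show "(\<integral>\<^sup>+x. epowr (\<integral>\<^sup>+y. ennreal (\<bar>x\<bar> powr (- \<theta>) * k (x - y) * near x y * F y) \<partial>lborel) p \<partial>lborel)
        \<le> ennreal ((2 powr \<theta> * B) powr p)"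
      by (simp add: S_def)
  qed
qed

text \<open>If p < q, then |x - y| \<le> 3 |x| lets |x|^(-c) be absorbed into the power of |x - y|,
  leaving the Hardy-Littlewood-Sobolev kernel. For p = q that kernel would be |x - y|^(-1), hence
  the separate appeal to Schur's test.\<close>

lemma near_diagonal:
  fixes k :: "real \<Rightarrow> real"
  assumes meas [measurable]: "k \<in> borel_measurable borel" and k_nn: "\<And>z. 0 \<le> k z"
    and k_le: "\<And>z. z \<noteq> 0 \<Longrightarrow> k z \<le> A * \<bar>z\<bar> powr (c + 1 / p - 1 / q - 1)" and A: "0 \<le> A"
    and k_int: "(\<integral>\<^sup>+z. ennreal (k z) \<partial>lborel) \<le> ennreal N" and N: "0 \<le> N"
    and c: "0 \<le> c" and p: "1 < p" "p \<le> q"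
  shows "kernel_bounded p q (\<lambda>x y. \<bar>x\<bar> powr (- c) * k (x - y) * near x y)"
proof (cases "p = q")
  case True
  have "k z \<le> A * \<bar>z\<bar> powr (c - 1)" if "z \<noteq> 0" for z using k_le[OF that] True by simp
  from schur_near_diagonal[OF meas k_nn this A k_int N c p(1)] show ?thesis by (simp add: True)
next
  case False
  with p have pq: "p < q" by simp
  obtain C where C: "kernel_bound p q (\<lambda>x y. \<bar>x - y\<bar> powr (1 / p - 1 / q - 1)) C"
    using hardy_littlewood_sobolev[OF p(1) pq] unfolding kernel_bounded_def by blast
  \<comment> \<open>The summand 1 keeps K positive when A = 0, as \<open>epowr_mult\<close>
    demands.\<close>
  define K where "K = A * 3 powr c + 1"
  have K: "0 < K" using A by (simp add: K_def add_nonneg_pos)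
  show ?thesis
  proof (rule kernel_boundedI[where C = "K powr q * C"])
    fix F :: "real \<Rightarrow> real"
    assume F: "F \<in> borel_measurable borel" "\<And>x. 0 \<le> F x" "lp_integral p F \<le> 1"
    note [measurable] = F(1)
    let ?T = "\<lambda>x. \<integral>\<^sup>+y. ennreal (\<bar>x - y\<bar> powr (1 / p - 1 / q - 1) * F y) \<partial>lborel"
    have "(\<integral>\<^sup>+y. ennreal (\<bar>x\<bar> powr (- c) * k (x - y) * near x y * F y) \<partial>lborel)
      \<le> ennreal K * ?T x" for x
    proof -
      have "(\<integral>\<^sup>+y. ennreal (\<bar>x\<bar> powr (- c) * k (x - y) * near x y * F y) \<partial>lborel)
         \<le> (\<integral>\<^sup>+y. ennreal K * ennreal (\<bar>x - y\<bar> powr (1 / p - 1 / q - 1) * F y) \<partial>lborel)"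
      proof (rule nn_integral_mono_AE, use AE_lborel_singleton[of x] in eventually_elim)
        case (elim y)
        have "\<bar>x\<bar> powr (- c) * k (x - y) * F y \<le> K * (\<bar>x - y\<bar> powr (1 / p - 1 / q - 1) * F y)"
          if *: "\<bar>x\<bar> < 2 * \<bar>y\<bar>" "\<bar>y\<bar> < 2 * \<bar>x\<bar>"
        proof -
          have z: "0 < \<bar>x - y\<bar>" "\<bar>x - y\<bar> / 3 \<le> \<bar>x\<bar>" using * elim by auto
          have "\<bar>x\<bar> powr (- c) \<le> (\<bar>x - y\<bar> / 3) powr (- c)"
            using z c by (intro powr_mono2') auto
          also have "\<dots> = 3 powr c * \<bar>x - y\<bar> powr (- c)" by (rule powr_divide_minus)
          finally have "\<bar>x\<bar> powr (- c) * k (x - y) \<le> (3 powr c * \<bar>x - y\<bar> powr (- c)) * (A * \<bar>x - y\<bar> powr (c + 1 / p - 1 / q - 1))"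
            using k_le[of "x - y"] elim k_nn by (intro mult_mono) auto
          also have "\<dots> = A * 3 powr c * (\<bar>x - y\<bar> powr (- c) * \<bar>x - y\<bar> powr (c + 1 / p - 1 / q - 1))" by simp
          also have "\<bar>x - y\<bar> powr (- c) * \<bar>x - y\<bar> powr (c + 1 / p - 1 / q - 1) = \<bar>x - y\<bar> powr (1 / p - 1 / q - 1)"
            by (rule powr_mult_powr) simp
          also have "A * 3 powr c * \<bar>x - y\<bar> powr (1 / p - 1 / q - 1) \<le> K * \<bar>x - y\<bar> powr (1 / p - 1 / q - 1)"
            by (intro mult_right_mono) (auto simp: K_def)
          finally show ?thesis using F(2)[of y] by (simp add: mult_right_mono mult.assoc[symmetric])
        qed
        then show ?case
          using K F(2)[of y] by (auto simp: indicator_def ennreal_mult[symmetric] intro!: ennreal_leI)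
      qed
      also have "\<dots> = ennreal K * ?T x" by (rule nn_integral_cmult) measurable
      finally show ?thesis .
    qed
    then have "(\<integral>\<^sup>+x. epowr (\<integral>\<^sup>+y. ennreal (\<bar>x\<bar> powr (- c) * k (x - y) * near x y * F y) \<partial>lborel) q \<partial>lborel)
      \<le> (\<integral>\<^sup>+x. epowr (ennreal K * ?T x) q \<partial>lborel)"
      using p by (intro nn_integral_mono epowr_mono) auto
    also have "\<dots> = ennreal (K powr q) * (\<integral>\<^sup>+x. epowr (?T x) q \<partial>lborel)"
      using K by (simp add: epowr_mult nn_integral_cmult)
    also have "\<dots> \<le> ennreal (K powr q) * ennreal C" by (intro mult_left_mono kernel_boundD[OF C] F) auto
    finally show "(\<integral>\<^sup>+x. epowr (\<integral>\<^sup>+y. ennreal (\<bar>x\<bar> powr (- c) * k (x - y) * near x y * F y) \<partial>lborel) q \<partial>lborel)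
        \<le> ennreal (K powr q * C)"
      by (simp add: ennreal_mult')
  qed
qed

text \<open>The condition \<theta> \<le> 1 makes |z|^(\<theta> - 1) decreasing in |z|. If one of
  |x|, |y| is at least twice the other, then |x - y| is at least half the larger, and k may be
  replaced by a power of the larger variable alone; this is a Hardy kernel.\<close>

theorem stein_weiss:
  fixes k :: "real \<Rightarrow> real"
  assumes meas [measurable]: "k \<in> borel_measurable borel" and k_nn: "\<And>z. 0 \<le> k z"
    and k_le: "\<And>z. z \<noteq> 0 \<Longrightarrow> k z \<le> A * \<bar>z\<bar> powr (a + b + 1 / p - 1 / q - 1)" and A: "0 \<le> A"
    and k_int: "(\<integral>\<^sup>+z. ennreal (k z) \<partial>lborel) \<le> ennreal N" and N: "0 \<le> N"
    and p: "1 < p" "p \<le> q" and a: "a < 1 - 1 / p" and b: "b < 1 / q"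
    and ab: "0 \<le> a + b" "a + b + 1 / p - 1 / q \<le> 1"
  shows "kernel_bounded p q (weighted a b k)"
proof -
  define \<theta> where "\<theta> = a + b + 1 / p - 1 / q"
  have \<theta>: "\<theta> \<le> 1" using ab by (simp add: \<theta>_def)
  obtain C1 where C1: "kernel_bound p q (\<lambda>x y. \<bar>x\<bar> powr (a + 1 / p - 1 / q - 1) * \<bar>y\<bar> powr (- a) * indicator {y. \<bar>y\<bar> < \<bar>x\<bar>} y) C1"
    using hardy_inequality_inner[OF p a] unfolding kernel_bounded_def by blast
  obtain C2 where C2: "kernel_bound p q (\<lambda>x y. \<bar>x\<bar> powr (- b) * \<bar>y\<bar> powr (b + 1 / p - 1 / q - 1) * outer x y) C2"
    using hardy_inequality_outer[OF p b] unfolding kernel_bounded_def by blast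
  obtain C3 where C3: "kernel_bound p q (\<lambda>x y. \<bar>x\<bar> powr (- (a + b)) * k (x - y) * near x y) C3"
    using near_diagonal[OF meas k_nn k_le A k_int N ab(1) p] unfolding kernel_bounded_def by blast
  \<comment> \<open>The first summand serves the two Hardy regions, the second the region where the
    weights of x and y are exchanged.\<close>
  define K where "K = A * 2 powr (1 - \<theta>) + 2 powr \<bar>a\<bar>"
  have K: "0 < K" using A by (simp add: K_def add_nonneg_pos)
  have KA: "A * 2 powr (1 - \<theta>) \<le> K" "2 powr \<bar>a\<bar> \<le> K" using A by (auto simp: K_def)
  show ?thesis
  proof (rule kernel_boundedI[where C = "K powr q * (3 powr q * (\<bar>C1\<bar> + \<bar>C2\<bar> + \<bar>C3\<bar>))"])
    fix F :: "real \<Rightarrow> real"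
    assume F: "F \<in> borel_measurable borel" "\<And>x. 0 \<le> F x" "lp_integral p F \<le> 1"
    note [measurable] = F(1)
    define f1 where "f1 x y = \<bar>x\<bar> powr (a + 1 / p - 1 / q - 1) * \<bar>y\<bar> powr (- a) * inner x y * F y" for x y :: real
    define f2 where "f2 x y = \<bar>x\<bar> powr (- b) * \<bar>y\<bar> powr (b + 1 / p - 1 / q - 1) * outer x y * F y" for x y :: real
    define f3 where "f3 x y = \<bar>x\<bar> powr (- (a + b)) * k (x - y) * near x y * F y" for x y :: real
    have nn: "0 \<le> f1 x y" "0 \<le> f2 x y" "0 \<le> f3 x y" for x y
      using F(2) k_nn by (auto simp: f1_def f2_def f3_def)
    have [measurable]: "case_prod f1 \<in> borel_measurable (borel \<Otimes>\<^sub>M borel)" "case_prod f2 \<in> borel_measurable (borel \<Otimes>\<^sub>M borel)"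
       "case_prod f3 \<in> borel_measurable (borel \<Otimes>\<^sub>M borel)"
      unfolding f1_def[abs_def] f2_def[abs_def] f3_def[abs_def] by (simp_all add: indicator_def)
    have pw: "weighted a b k x y * F y \<le> K * (f1 x y + f2 x y + f3 x y)"
      if xy: "x \<noteq> 0" "y \<noteq> 0" "y \<noteq> x" for x y
    proof -
      \<comment> \<open>To be used with t the larger of |x| and |y|.\<close>
      have half: "k (x - y) \<le> A * 2 powr (1 - \<theta>) * t powr (\<theta> - 1)" if "0 < t" "t / 2 \<le> \<bar>x - y\<bar>" for t
      proof -
        have "k (x - y) \<le> A * \<bar>x - y\<bar> powr (\<theta> - 1)" using k_le[of "x - y"] xy by (simp add: \<theta>_def)
        also have "\<bar>x - y\<bar> powr (\<theta> - 1) \<le> (t / 2) powr (\<theta> - 1)"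
          using that \<theta> by (intro powr_mono2') auto
        also have "\<dots> = 2 powr (1 - \<theta>) * t powr (\<theta> - 1)"
          using powr_divide_minus[of t 2 "1 - \<theta>"] by simp
        finally show ?thesis using A by (simp add: mult_left_mono mult.assoc)
      qed
      consider "2 * \<bar>y\<bar> \<le> \<bar>x\<bar>" | "2 * \<bar>x\<bar> \<le> \<bar>y\<bar>" | "\<bar>x\<bar> < 2 * \<bar>y\<bar>" "\<bar>y\<bar> < 2 * \<bar>x\<bar>" by linarith
      then show ?thesis
      proof cases
        case 1
        then have d: "\<bar>x\<bar> / 2 \<le> \<bar>x - y\<bar>" by linarith
        have "weighted a b k x y * F y \<le> \<bar>x\<bar> powr (- b) * (A * 2 powr (1 - \<theta>) * \<bar>x\<bar> powr (\<theta> - 1)) * \<bar>y\<bar> powr (- a) * F y"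
          using half[of "\<bar>x\<bar>"] d xy F(2) by (intro mult_right_mono mult_left_mono) auto
        also have "\<dots> = A * 2 powr (1 - \<theta>) * ((\<bar>x\<bar> powr (- b) * \<bar>x\<bar> powr (\<theta> - 1)) * \<bar>y\<bar> powr (- a) * F y)" by simp
        also have "\<bar>x\<bar> powr (- b) * \<bar>x\<bar> powr (\<theta> - 1) = \<bar>x\<bar> powr (a + 1 / p - 1 / q - 1)"
          by (rule powr_mult_powr) (simp add: \<theta>_def)
        also have "\<bar>x\<bar> powr (a + 1 / p - 1 / q - 1) * \<bar>y\<bar> powr (- a) * F y = f1 x y"
          using 1 xy by (simp add: f1_def)
        also have "A * 2 powr (1 - \<theta>) * f1 x y \<le> K * (f1 x y + f2 x y + f3 x y)"
          using nn KA K by (intro mult_mono) auto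
        finally show ?thesis .
      next
        case 2
        then have d: "\<bar>y\<bar> / 2 \<le> \<bar>x - y\<bar>" by linarith
        have "weighted a b k x y * F y \<le> \<bar>x\<bar> powr (- b) * (A * 2 powr (1 - \<theta>) * \<bar>y\<bar> powr (\<theta> - 1)) * \<bar>y\<bar> powr (- a) * F y"
          using half[of "\<bar>y\<bar>"] d xy F(2) by (intro mult_right_mono mult_left_mono) auto
        also have "\<dots> = A * 2 powr (1 - \<theta>) * (\<bar>x\<bar> powr (- b) * (\<bar>y\<bar> powr (\<theta> - 1) * \<bar>y\<bar> powr (- a)) * F y)" by simp
        also have "\<bar>y\<bar> powr (\<theta> - 1) * \<bar>y\<bar> powr (- a) = \<bar>y\<bar> powr (b + 1 / p - 1 / q - 1)"
          by (rule powr_mult_powr) (simp add: \<theta>_def)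
        also have "\<bar>x\<bar> powr (- b) * \<bar>y\<bar> powr (b + 1 / p - 1 / q - 1) * F y = f2 x y"
          using 2 xy by (simp add: f2_def)
        also have "A * 2 powr (1 - \<theta>) * f2 x y \<le> K * (f1 x y + f2 x y + f3 x y)"
          using nn KA K by (intro mult_mono) auto
        finally show ?thesis .
      next
        case 3
        \<comment> \<open>The sign of a is not fixed: for a \<ge> 0 the lower bound |x|/2 on |y| is
          used, for a < 0 the upper bound 2 |x|.\<close>
        have "\<bar>y\<bar> powr (- a) \<le> 2 powr \<bar>a\<bar> * \<bar>x\<bar> powr (- a)"
        proof (cases "0 \<le> a")
          case True
          have "\<bar>y\<bar> powr (- a) \<le> (\<bar>x\<bar> / 2) powr (- a)" using True 3 xy by (intro powr_mono2') auto
          then show ?thesis using True by (simp add: powr_divide_minus)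
        next
          case False
          have "\<bar>y\<bar> powr (- a) \<le> (2 * \<bar>x\<bar>) powr (- a)" using False 3 by (intro powr_mono2) auto
          then show ?thesis using False by (simp add: powr_mult)
        qed
        then have "weighted a b k x y * F y \<le> \<bar>x\<bar> powr (- b) * k (x - y) * (2 powr \<bar>a\<bar> * \<bar>x\<bar> powr (- a)) * F y"
          using F(2) k_nn by (intro mult_right_mono mult_left_mono) auto
        also have "\<dots> = 2 powr \<bar>a\<bar> * ((\<bar>x\<bar> powr (- b) * \<bar>x\<bar> powr (- a)) * k (x - y) * F y)" by simp
        also have "\<bar>x\<bar> powr (- b) * \<bar>x\<bar> powr (- a) = \<bar>x\<bar> powr (- (a + b))" by (rule powr_mult_powr) simp
        also have "\<bar>x\<bar> powr (- (a + b)) * k (x - y) * F y = f3 x y" using 3 by (simp add: f3_def)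
        also have "2 powr \<bar>a\<bar> * f3 x y \<le> K * (f1 x y + f2 x y + f3 x y)"
          using nn KA K by (intro mult_mono) auto
        finally show ?thesis .
      qed
    qed
    let ?T1 = "\<lambda>x. \<integral>\<^sup>+y. ennreal (f1 x y) \<partial>lborel" and ?T2 = "\<lambda>x. \<integral>\<^sup>+y. ennreal (f2 x y) \<partial>lborel"
      and ?T3 = "\<lambda>x. \<integral>\<^sup>+y. ennreal (f3 x y) \<partial>lborel"
    have "AE x in lborel. epowr (\<integral>\<^sup>+y. ennreal (weighted a b k x y * F y) \<partial>lborel) q
        \<le> ennreal (K powr q) * (ennreal (3 powr q) * (epowr (?T1 x) q + epowr (?T2 x) q + epowr (?T3 x) q))"
      using AE_lborel_singleton[of 0]
    proof eventually_elim
      case (elim x)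
      have "(\<integral>\<^sup>+y. ennreal (weighted a b k x y * F y) \<partial>lborel)
        \<le> (\<integral>\<^sup>+y. ennreal K * (ennreal (f1 x y) + ennreal (f2 x y) + ennreal (f3 x y)) \<partial>lborel)"
      proof (rule nn_integral_mono_AE, use AE_lborel_singleton[of 0] AE_lborel_singleton[of x] in eventually_elim)
        case (elim y)
        then show ?case
          using pw[of x y] \<open>x \<noteq> 0\<close> nn K
          by (simp add: ennreal_plus[symmetric] ennreal_mult[symmetric] ennreal_leI del: ennreal_plus)
      qed
      also have "\<dots> = ennreal K * (?T1 x + ?T2 x + ?T3 x)"
        by (simp add: nn_integral_cmult nn_integral_add)
      finally have "epowr (\<integral>\<^sup>+y. ennreal (weighted a b k x y * F y) \<partial>lborel) q
        \<le> epowr (ennreal K * (?T1 x + ?T2 x + ?T3 x)) q"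
        using p by (intro epowr_mono) auto
      also have "\<dots> = ennreal (K powr q) * epowr (?T1 x + ?T2 x + ?T3 x) q"
        using K by (rule epowr_mult)
      also have "\<dots> \<le> ennreal (K powr q) * (ennreal (3 powr q) * (epowr (?T1 x) q + epowr (?T2 x) q + epowr (?T3 x) q))"
        using p by (intro mult_left_mono epowr_add3) auto
      finally show ?case .
    qed
    then have "(\<integral>\<^sup>+x. epowr (\<integral>\<^sup>+y. ennreal (weighted a b k x y * F y) \<partial>lborel) q \<partial>lborel)
      \<le> (\<integral>\<^sup>+x. ennreal (K powr q) * (ennreal (3 powr q) * (epowr (?T1 x) q + epowr (?T2 x) q + epowr (?T3 x) q)) \<partial>lborel)"
      by (rule nn_integral_mono_AE)
    also have "\<dots> = ennreal (K powr q) * (ennreal (3 powr q) * ((\<integral>\<^sup>+x. epowr (?T1 x) q \<partial>lborel) + (\<integral>\<^sup>+x. epowr (?T2 x) q \<partial>lborel) + (\<integral>\<^sup>+x. epowr (?T3 x) q \<partial>lborel)))"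
      by (simp add: nn_integral_cmult nn_integral_add)
    also have "\<dots> \<le> ennreal (K powr q) * (ennreal (3 powr q) * (ennreal C1 + ennreal C2 + ennreal C3))"
      unfolding f1_def f2_def f3_def using F by (intro mult_left_mono add_mono kernel_boundD[OF C1] kernel_boundD[OF C2] kernel_boundD[OF C3]) auto
    \<comment> \<open>\<open>ennreal\<close> is additive only on nonnegative numbers.\<close>
    also have "\<dots> \<le> ennreal (K powr q) * (ennreal (3 powr q) * (ennreal \<bar>C1\<bar> + ennreal \<bar>C2\<bar> + ennreal \<bar>C3\<bar>))"
      by (intro mult_left_mono add_mono ennreal_leI) auto
    also have "\<dots> = ennreal (K powr q * (3 powr q * (\<bar>C1\<bar> + \<bar>C2\<bar> + \<bar>C3\<bar>)))"
      by (simp add: ennreal_plus[symmetric] ennreal_mult[symmetric] del: ennreal_plus)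
    finally show "(\<integral>\<^sup>+x. epowr (\<integral>\<^sup>+y. ennreal (weighted a b k x y * F y) \<partial>lborel) q \<partial>lborel)
       \<le> ennreal (K powr q * (3 powr q * (\<bar>C1\<bar> + \<bar>C2\<bar> + \<bar>C3\<bar>)))" .
  qed
qed

section \<open>Hermite functions and Gaussian integrals\<close>


text \<open>The recurrence H_{n+1} = 2 x H_n - H_n' comes from differentiating H_n e^{-x^2} in the
  Rodrigues formula. With values in \<open>poly\<close>, Gaussian integrals of Hermite functions
  become algebra.\<close>

fun hermite_rec :: "nat \<Rightarrow> real poly" where
  "hermite_rec 0 = 1"
| "hermite_rec (Suc n) = [:0, 2:] * hermite_rec n - pderiv (hermite_rec n)"

lemma iterated_deriv_gaussian:
  "(deriv ^^ k) (\<lambda>y. exp (- (y\<^sup>2))) = (\<lambda>y. (-1) ^ k * poly (hermite_rec k) y * exp (- (y\<^sup>2)))"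
proof (induction k)
  case (Suc k)
  have "((\<lambda>y. (-1) ^ k * poly (hermite_rec k) y * exp (- (y\<^sup>2))) has_real_derivative
      (-1) ^ Suc k * poly (hermite_rec (Suc k)) y * exp (- (y\<^sup>2))) (at y)" for y
    by (auto intro!: derivative_eq_intros poly_DERIV simp: algebra_simps)
  then have "deriv (\<lambda>y. (-1) ^ k * poly (hermite_rec k) y * exp (- (y\<^sup>2))) =
      (\<lambda>y. (-1) ^ Suc k * poly (hermite_rec (Suc k)) y * exp (- (y\<^sup>2)))"
    by (intro ext DERIV_imp_deriv)
  then show ?case using Suc by (simp only: funpow.simps comp_def)
qed simp

lemma hermite_poly_eq: "hermite_poly k x = poly (hermite_rec k) x"
proof -
  have "(-1) ^ k * (-1 :: real) ^ k = 1" by (simp flip: power_mult_distrib)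
  moreover have "exp (x\<^sup>2) * exp (- (x\<^sup>2)) = 1" by (simp flip: exp_add)
  moreover have "hermite_poly k x = ((-1) ^ k * (-1) ^ k) * (exp (x\<^sup>2) * exp (- (x\<^sup>2))) * poly (hermite_rec k) x"
    unfolding hermite_poly_def iterated_deriv_gaussian by (simp only: mult_ac)
  ultimately show ?thesis by simp
qed

definition hermite_const :: "nat \<Rightarrow> real" where
  "hermite_const k = (-1) ^ k / sqrt (2 ^ k * fact k * sqrt pi)"

lemma hermite_fun_eq:
  "hermite_fun k x = hermite_const k * poly (hermite_rec k) x * exp (- (x\<^sup>2) / 2)"
  by (simp add: hermite_fun_def hermite_poly_eq hermite_const_def)

text \<open>Differentiating the recurrence and inserting the induction hypothesis reproduces the
  recurrence one degree lower.\<close>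

lemma pderiv_hermite_rec_Suc: "pderiv (hermite_rec (Suc n)) = smult (2 * real (Suc n)) (hermite_rec n)"
proof (induction n)
  case 0
  show ?case by (simp add: pderiv_pCons pderiv_mult pderiv_diff)
next
  case (Suc n)
  have 1: "pderiv ([:0, 2:] :: real poly) = [:2:]" by (simp add: pderiv_pCons)
  have "pderiv (hermite_rec (Suc (Suc n)))
      = [:2:] * hermite_rec (Suc n) + smult (2 * real (Suc n)) ([:0, 2:] * hermite_rec n - pderiv (hermite_rec n))"
    by (subst hermite_rec.simps(2)[of "Suc n"]) (simp only: pderiv_diff pderiv_mult Suc 1 pderiv_smult mult_smult_right smult_diff_right ac_simps diff_add_eq add_diff_eq)
  also have "\<dots> = smult (2 * real (Suc (Suc n))) (hermite_rec (Suc n))"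
    by (simp only: hermite_rec.simps(2)[symmetric]) (simp add: smult_add_left[symmetric] algebra_simps del: hermite_rec.simps)
  finally show ?case .
qed

section \<open>Integrals of polynomials against the Gaussian\<close>

definition gauss_integral :: "real poly \<Rightarrow> real" where
  "gauss_integral P = (\<integral>z. poly P z * exp (- (z\<^sup>2)) \<partial>lborel)"

lemma gaussian_moments:
  shows "has_bochner_integral lborel (\<lambda>x. x ^ (2 * k) * exp (- (x\<^sup>2))) (sqrt pi * (fact (2 * k) / (2 ^ (2 * k) * fact k)))"
    and "has_bochner_integral lborel (\<lambda>x. x ^ (2 * k + 1) * exp (- (x\<^sup>2))) (0 :: real)"
  using has_bochner_integral_even_function[OF gaussian_moment_even_pos[where k=k]]
    has_bochner_integral_odd_function[OF gaussian_moment_odd_pos[where k=k]]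
  by (simp_all add: mult.commute)

lemma integrable_power_gaussian: "integrable lborel (\<lambda>x. x ^ n * exp (- (x\<^sup>2)) :: real)"
  by (cases "even n") (auto elim!: evenE oddE intro: has_bochner_integral_integrable gaussian_moments[THEN integrable.intros] simp del: One_nat_def)

lemma integrable_poly_gaussian:
  fixes P :: "real poly"
  shows "integrable lborel (\<lambda>x. poly P x * exp (- (x\<^sup>2)))"
  unfolding poly_altdef sum_distrib_right mult.assoc
  by (intro Bochner_Integration.integrable_sum integrable_mult_right integrable_power_gaussian)

lemma gauss_integral_add: "gauss_integral (P + Q) = gauss_integral P + gauss_integral Q"
  unfolding gauss_integral_def poly_add distrib_right
  by (intro Bochner_Integration.integral_add integrable_poly_gaussian)

lemma gauss_integral_smult: "gauss_integral (smult c P) = c * gauss_integral P"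
  by (simp add: gauss_integral_def mult.assoc)

lemma gauss_integral_diff: "gauss_integral (P - Q) = gauss_integral P - gauss_integral Q"
  unfolding gauss_integral_def poly_diff left_diff_distrib
  by (intro Bochner_Integration.integral_diff integrable_poly_gaussian)

lemma gauss_integral_0 [simp]: "gauss_integral 0 = 0"
  by (simp add: gauss_integral_def)

lemma gauss_integral_1: "gauss_integral 1 = sqrt pi"
  using has_bochner_integral_integral_eq[OF gaussian_moments(1)[of 0]] by (simp add: gauss_integral_def)

text \<open>The derivative of e^{-z^2} is -2 z e^{-z^2}. The identity is checked on monomials
  through the known moments, which avoids boundary terms, and extends by linearity.\<close>

lemma gauss_integral_by_parts: "gauss_integral ([:0, 2:] * P) = gauss_integral (pderiv P)"
proof -
  have monom: "gauss_integral ([:0, 2:] * monom c n) = gauss_integral (pderiv (monom c n))" for c n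
  proof -
    have L: "gauss_integral ([:0, 2:] * monom c n) = 2 * c * (\<integral>z. (z::real) ^ Suc n * exp (- (z\<^sup>2)) \<partial>lborel)"
      unfolding gauss_integral_def integral_mult_right_zero[symmetric]
      by (intro Bochner_Integration.integral_cong) (auto simp: poly_monom)
    have R: "gauss_integral (pderiv (monom c n)) = real n * c * (\<integral>z. (z::real) ^ (n - 1) * exp (- (z\<^sup>2)) \<partial>lborel)"
      unfolding gauss_integral_def integral_mult_right_zero[symmetric]
      by (intro Bochner_Integration.integral_cong) (auto simp: poly_monom pderiv_monom)
    show ?thesis
    proof (cases "even n")
      case True
      then obtain k where k: "n = 2 * k" by (elim evenE)
      have "(\<integral>z. (z::real) ^ Suc n * exp (- (z\<^sup>2)) \<partial>lborel) = 0"
        using has_bochner_integral_integral_eq[OF gaussian_moments(2)[of k]] by (simp add: k)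
      \<comment> \<open>For n = 0 the exponent n - 1 is truncated to 0 and the moment does not
        vanish, but the factor n does.\<close>
      moreover have "real n * (\<integral>z. (z::real) ^ (n - 1) * exp (- (z\<^sup>2)) \<partial>lborel) = 0"
      proof (cases k)
        case (Suc j)
        then show ?thesis
          using has_bochner_integral_integral_eq[OF gaussian_moments(2)[of j]] by (simp add: k)
      qed (simp add: k)
      ultimately show ?thesis unfolding L R by (simp add: mult.commute mult.left_commute)
    next
      case False
      then obtain k where k: "n = 2 * k + 1" by (elim oddE)
      have I1: "(\<integral>z. (z::real) ^ Suc n * exp (- (z\<^sup>2)) \<partial>lborel) = sqrt pi * (fact (2 * Suc k) / (2 ^ (2 * Suc k) * fact (Suc k)))"
        using has_bochner_integral_integral_eq[OF gaussian_moments(1)[of "Suc k"]] by (simp only: k) simp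
      have I2: "(\<integral>z. (z::real) ^ (n - 1) * exp (- (z\<^sup>2)) \<partial>lborel) = sqrt pi * (fact (2 * k) / (2 ^ (2 * k) * fact k))"
        using has_bochner_integral_integral_eq[OF gaussian_moments(1)[of k]] by (simp add: k)
      \<comment> \<open>The recursion of the even moments: each is (2k + 1)/2 times its
        predecessor.\<close>
      have E: "2 * (fact (2 * Suc k) / (2 ^ (2 * Suc k) * fact (Suc k))) = real n * (fact (2 * k) / (2 ^ (2 * k) * fact k) :: real)"
        by (simp add: k divide_simps)
      have "2 * c * (u * A) = real n * c * (u * B)" if "2 * A = real n * B" for A B u :: real
      proof -
        have "2 * c * (u * A) = (2 * A) * (c * u)" by simp
        then show ?thesis unfolding that by simp
      qed
      from this[OF E] show ?thesis unfolding L R I1 I2 .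
    qed
  qed
  have "gauss_integral ([:0, 2:] * (\<Sum>i\<le>n. monom (c i) i)) = gauss_integral (pderiv (\<Sum>i\<le>n. monom (c i) i))" for c n
  proof (induction n)
    case (Suc n)
    then show ?case
      by (simp only: sum.atMost_Suc distrib_left pderiv_add gauss_integral_add monom)
  qed (use monom in simp)
  from this[of "coeff P" "degree P"] show ?thesis by (simp add: poly_as_sum_of_monoms)
qed

text \<open>Integration by parts cancels the derivative of H_k in H_{k+1} = 2 z H_k - H_k' and moves
  the derivative onto H_j, which lowers both degrees by one.\<close>

lemma gauss_integral_hermite_rec:
  "gauss_integral (hermite_rec j * hermite_rec k) = (if j = k then 2 ^ k * fact k * sqrt pi else 0)"
proof (induction k arbitrary: j)
  case 0
  show ?case
  proof (cases j)
    case (Suc i)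
    then show ?thesis by (simp add: gauss_integral_diff gauss_integral_by_parts del: mult_pCons_left)
  qed (simp add: gauss_integral_1)
next
  case (Suc k)
  have *: "gauss_integral (hermite_rec j * hermite_rec (Suc k)) = gauss_integral (pderiv (hermite_rec j) * hermite_rec k)"
  proof -
    have "hermite_rec j * hermite_rec (Suc k) = [:0, 2:] * (hermite_rec j * hermite_rec k) - hermite_rec j * pderiv (hermite_rec k)"
      by (simp only: hermite_rec.simps right_diff_distrib ac_simps)
    then show ?thesis
      by (simp only: gauss_integral_diff gauss_integral_by_parts pderiv_mult gauss_integral_add) (simp add: mult.commute)
  qed
  show ?case
  proof (cases j)
    case (Suc i)
    then show ?thesis
      unfolding * unfolding Suc pderiv_hermite_rec_Suc
      by (simp add: gauss_integral_smult Suc.IH del: hermite_rec.simps)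
  qed (unfold *, simp)
qed

lemma hermite_fun_orthonormal:
  shows "integrable lborel (\<lambda>x. hermite_fun j x * hermite_fun k x)"
    and "(\<integral>x. hermite_fun j x * hermite_fun k x \<partial>lborel) = (if j = k then 1 else 0)"
proof -
  let ?c = hermite_const
  have eq: "hermite_fun j x * hermite_fun k x = ?c j * ?c k * (poly (hermite_rec j * hermite_rec k) x * exp (- (x\<^sup>2)))" for x
  proof -
    have "exp (- (x\<^sup>2)) = exp (- (x\<^sup>2) / 2) * exp (- (x\<^sup>2) / 2)" by (simp add: exp_add[symmetric])
    then show ?thesis by (simp add: hermite_fun_eq mult_ac)
  qed
  show "integrable lborel (\<lambda>x. hermite_fun j x * hermite_fun k x)"
    unfolding eq by (intro integrable_mult_right integrable_poly_gaussian)
  have "?c k * ?c k * (2 ^ k * fact k * sqrt pi) = 1"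
  proof -
    have "(-1) ^ k * (-1 :: real) ^ k = 1" by (simp flip: power_mult_distrib)
    then show ?thesis by (simp add: hermite_const_def)
  qed
  then show "(\<integral>x. hermite_fun j x * hermite_fun k x \<partial>lborel) = (if j = k then 1 else 0)"
    unfolding eq integral_mult_right_zero gauss_integral_def[symmetric] gauss_integral_hermite_rec by simp
qed

text \<open>Eigenfunction property of the Ornstein-Uhlenbeck semigroup. Expanding H_{n+1} at r x + s
  z, the term s z and the derivative term combine to the factor s^2 - 1 = - r^2, so the recurrence
  is reproduced. The induction is strong since the derivative of H_n drops the degree by
  two.\<close>

lemma gauss_integral_hermite_rec_affine:
  assumes "r\<^sup>2 + s\<^sup>2 = 1"
  shows "gauss_integral (hermite_rec k \<circ>\<^sub>p [:r * x, s:]) = sqrt pi * r ^ k * poly (hermite_rec k) x"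
proof (induction k rule: less_induct)
  case (less k)
  show ?case
  proof (cases k)
    case 0
    then show ?thesis by (simp add: gauss_integral_1 pcompose_1)
  next
    case (Suc n)
    let ?a = "[:r * x, s:]"
    let ?P = "hermite_rec n \<circ>\<^sub>p ?a" and ?D = "pderiv (hermite_rec n) \<circ>\<^sub>p ?a"
    have dP: "pderiv ?P = smult s ?D" by (simp add: pderiv_pcompose pderiv_pCons)
    have "[:0, 2:] \<circ>\<^sub>p ?a = smult (2 * r * x) 1 + smult s [:0, 2:]"
      by (simp add: pcompose_pCons)
    then have "hermite_rec k \<circ>\<^sub>p ?a = smult (2 * r * x) ?P + smult s ([:0, 2:] * ?P) - ?D"
      unfolding Suc hermite_rec.simps pcompose_diff pcompose_mult
      by (simp only: distrib_right mult_smult_left mult_1_left)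
    then have "gauss_integral (hermite_rec k \<circ>\<^sub>p ?a) = 2 * r * x * gauss_integral ?P + (s\<^sup>2 - 1) * gauss_integral ?D"
      by (simp only: gauss_integral_add gauss_integral_diff gauss_integral_smult gauss_integral_by_parts dP)
        (simp add: power2_eq_square algebra_simps)
    also have "s\<^sup>2 - 1 = - r\<^sup>2" using assms by simp
    also have "gauss_integral ?P = sqrt pi * r ^ n * poly (hermite_rec n) x" using less Suc by simp
    also have "- r\<^sup>2 * gauss_integral ?D = - sqrt pi * r ^ k * poly (pderiv (hermite_rec n)) x"
    proof (cases n)
      case (Suc m)
      then show ?thesis using less[of m] \<open>k = Suc n\<close>
        by (simp del: hermite_rec.simps add: pderiv_hermite_rec_Suc pcompose_smult gauss_integral_smult power2_eq_square)
    qed simp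
    finally show ?thesis by (simp add: Suc algebra_simps)
  qed
qed

text \<open>Each coefficient spends half of the exponent: one factor e^{c x^2/2} absorbs x, the
  other bounds the remaining polynomial. Hence c is generalised in the induction.\<close>

lemma poly_le_exp_square:
  fixes P :: "real poly"
  shows "0 < c \<Longrightarrow> \<exists>C. \<forall>x. \<bar>poly P x\<bar> \<le> C * exp (c * x\<^sup>2)"
proof (induction P arbitrary: c)
  case (pCons a P)
  then obtain C where C: "\<And>x. \<bar>poly P x\<bar> \<le> C * exp (c / 2 * x\<^sup>2)" by (meson half_gt_zero)
  have "\<bar>poly (pCons a P) x\<bar> \<le> (\<bar>a\<bar> + (1 + 2 / c) * C) * exp (c * x\<^sup>2)" for x
  proof -
    have "\<bar>x\<bar> \<le> 1 + x\<^sup>2" using zero_le_power2[of "\<bar>x\<bar> - 1 / 2"] by (simp add: power2_diff power_divide)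
    also have "\<dots> \<le> (1 + 2 / c) * (1 + c / 2 * x\<^sup>2)" using pCons.prems by (simp add: field_simps)
    also have "\<dots> \<le> (1 + 2 / c) * exp (c / 2 * x\<^sup>2)"
      using pCons.prems exp_ge_add_one_self[of "c / 2 * x\<^sup>2"] by (intro mult_left_mono) auto
    finally have "\<bar>x\<bar> * \<bar>poly P x\<bar> \<le> ((1 + 2 / c) * exp (c / 2 * x\<^sup>2)) * (C * exp (c / 2 * x\<^sup>2))"
      using C[of x] pCons.prems by (intro mult_mono) auto
    also have "\<dots> = (1 + 2 / c) * C * exp (c * x\<^sup>2)"
      by (simp add: mult_ac exp_add[symmetric])
    finally have "\<bar>x * poly P x\<bar> \<le> (1 + 2 / c) * C * exp (c * x\<^sup>2)" by (simp add: abs_mult)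
    moreover have "\<bar>a\<bar> \<le> \<bar>a\<bar> * exp (c * x\<^sup>2)" using pCons.prems mult_left_mono[of 1 "exp (c * x\<^sup>2)" "\<bar>a\<bar>"] by simp
    ultimately show ?thesis by (simp add: distrib_right)
  qed
  then show ?case by blast
qed (auto intro: exI[of _ 0])

lemma hermite_fun_decay: "\<exists>C. \<forall>x. \<bar>x\<bar> ^ n * \<bar>hermite_fun k x\<bar> \<le> C"
proof -
  define c where "c = hermite_const k"
  obtain C where C: "\<And>x. \<bar>poly (monom c n * hermite_rec k) x\<bar> \<le> C * exp (1 / 2 * x\<^sup>2)"
    using poly_le_exp_square[of "1/2" "monom c n * hermite_rec k"] by auto
  have "\<bar>x\<bar> ^ n * \<bar>hermite_fun k x\<bar> \<le> C" for x
  proof -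
    have "\<bar>x\<bar> ^ n * \<bar>hermite_fun k x\<bar> = \<bar>poly (monom c n * hermite_rec k) x\<bar> * exp (- (x\<^sup>2) / 2)"
      by (simp add: hermite_fun_eq c_def[symmetric] poly_monom abs_mult power_abs mult_ac)
    also have "\<dots> \<le> (C * exp (1 / 2 * x\<^sup>2)) * exp (- (x\<^sup>2) / 2)"
      by (intro mult_right_mono C) auto
    also have "\<dots> = C" by (simp add: mult.assoc exp_add[symmetric])
    finally show ?thesis .
  qed
  then show ?thesis by blast
qed

lemma borel_measurable_hermite_fun [measurable]: "hermite_fun k \<in> borel_measurable borel"
  unfolding hermite_fun_eq[abs_def] by (intro borel_measurable_continuous_onI continuous_intros) auto

section \<open>Integration by parts for Stieltjes integrals\<close>


lemma total_variation_mono: "A \<subseteq> B \<Longrightarrow> total_variation f A \<le> total_variation f B"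
  unfolding total_variation_def by (intro SUP_subset_mono) auto

text \<open>Appending c and d to a list in [a,c] adds the jump from c to d. The jump from the last
  entry to c also appears and is dropped, being nonnegative.\<close>

lemma total_variation_extend:
  assumes "a \<le> c" "c \<le> d"
  shows "total_variation f {a..c} + ennreal \<bar>f d - f c\<bar> \<le> total_variation f {a..d}"
proof -
  let ?S = "\<lambda>ts. \<Sum>i<length ts - 1. ennreal \<bar>f (ts ! Suc i) - f (ts ! i)\<bar>"
  have "?S ts + ennreal \<bar>f d - f c\<bar> \<le> total_variation f {a..d}" if ts: "sorted ts" "set ts \<subseteq> {a..c}" for ts
  proof -
    let ?us = "ts @ [c, d]"
    have "?S ts \<le> (\<Sum>i<length ts. ennreal \<bar>f (?us ! Suc i) - f (?us ! i)\<bar>)"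
      by (intro order_trans[OF _ sum_mono2[of "{..<length ts}" "{..<length ts - 1}"]] sum_mono) (auto simp: nth_append)
    then have "?S ts + ennreal \<bar>f d - f c\<bar> \<le> (\<Sum>i<length ts. ennreal \<bar>f (?us ! Suc i) - f (?us ! i)\<bar>) + ennreal \<bar>f d - f c\<bar>"
      by (rule add_right_mono)
    also have "\<dots> = ?S ?us" by (simp add: nth_append)
    also have "\<dots> \<le> total_variation f {a..d}"
      unfolding total_variation_def using ts assms by (intro SUP_upper) (auto simp: sorted_append)
    finally show ?thesis .
  qed
  then show ?thesis
    unfolding total_variation_def[of f "{a..c}"]
    by (subst ennreal_SUP_add_left[symmetric]) (auto intro!: SUP_least exI[of _ "[]"])
qed

definition variation_fun :: "(real \<Rightarrow> real) \<Rightarrow> real \<Rightarrow> real" where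
  "variation_fun f t = enn2real (total_variation f {0..t})"

lemma mono_bounded_tendsto:
  fixes f :: "real \<Rightarrow> real"
  assumes "mono f" "\<And>t. f t \<le> B"
  shows "(f \<longlongrightarrow> (SUP t. f t)) at_top"
proof (rule order_tendstoI)
  have bdd: "bdd_above (range f)" using assms(2) by (rule bdd_aboveI2)
  fix y
  show "eventually (\<lambda>t. y < f t) at_top" if y: "y < (SUP t. f t)"
  proof -
    obtain s where "y < f s" using y bdd by (auto simp: less_cSUP_iff)
    then have "y < f t" if "s \<le> t" for t using monoD[OF assms(1) that] by simp
    then show ?thesis by (auto simp: eventually_at_top_linorder)
  qed
  show "eventually (\<lambda>t. f t < y) at_top" if "(SUP t. f t) < y"
    using that cSUP_upper[OF _ bdd] by (intro always_eventually) (auto intro: order.strict_trans1)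
qed

context
  fixes \<Psi> :: "real \<Rightarrow> real"
  assumes BV: "bounded_variation_on \<Psi> {0..}"
begin

lemma total_variation_eq_variation_fun: "total_variation \<Psi> {0..t} = ennreal (variation_fun \<Psi> t)"
proof -
  have "total_variation \<Psi> {0..t} < top"
    using BV total_variation_mono[of "{0..t}" "{0..}" \<Psi>] by (auto simp: bounded_variation_on_def intro: order.strict_trans1)
  then show ?thesis by (simp add: variation_fun_def)
qed

lemma variation_fun_nonneg: "0 \<le> variation_fun \<Psi> t"
  by (simp add: variation_fun_def)

lemma variation_fun_bounded: "\<exists>B. \<forall>t. variation_fun \<Psi> t \<le> B"
proof -
  have "variation_fun \<Psi> t \<le> enn2real (total_variation \<Psi> {0..})" for t
    using BV total_variation_mono[of "{0..t}" "{0..}" \<Psi>]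
    unfolding variation_fun_def by (intro enn2real_mono) (auto simp: bounded_variation_on_def)
  then show ?thesis by blast
qed

lemma abs_diff_le_variation_fun:
  assumes "0 \<le> c" "c \<le> d"
  shows "\<bar>\<Psi> d - \<Psi> c\<bar> \<le> variation_fun \<Psi> d - variation_fun \<Psi> c"
proof -
  have "ennreal (variation_fun \<Psi> c) + ennreal \<bar>\<Psi> d - \<Psi> c\<bar> \<le> ennreal (variation_fun \<Psi> d)"
    using total_variation_extend[OF assms, of \<Psi>] by (simp add: total_variation_eq_variation_fun)
  then show ?thesis
    using variation_fun_nonneg by (simp add: ennreal_plus[symmetric] del: ennreal_plus)
qed

text \<open>The Jordan decomposition, source of measurability and of the limit at infinity. Writing
  \<open>max 0 t\<close> makes both parts constant on the negative axis, where the values of \<Psi>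
  are arbitrary.\<close>

lemma mono_variation: "mono (\<lambda>t. variation_fun \<Psi> (max 0 t))"
    "mono (\<lambda>t. variation_fun \<Psi> (max 0 t) - \<Psi> (max 0 t))"
proof -
  have "variation_fun \<Psi> (max 0 s) \<le> variation_fun \<Psi> (max 0 t)"
       "variation_fun \<Psi> (max 0 s) - \<Psi> (max 0 s) \<le> variation_fun \<Psi> (max 0 t) - \<Psi> (max 0 t)" if "s \<le> t" for s t
    using abs_diff_le_variation_fun[of "max 0 s" "max 0 t"] that by (auto simp: max.coboundedI2 max.mono)
  then show "mono (\<lambda>t. variation_fun \<Psi> (max 0 t))" "mono (\<lambda>t. variation_fun \<Psi> (max 0 t) - \<Psi> (max 0 t))"
    by (auto intro!: monoI)
qed

lemma bounded_variation_measurable: "(\<lambda>t. \<Psi> (max 0 t)) \<in> borel_measurable borel"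
proof -
  note [measurable] = mono_variation[THEN borel_measurable_mono]
  have "(\<lambda>t. variation_fun \<Psi> (max 0 t) - (variation_fun \<Psi> (max 0 t) - \<Psi> (max 0 t))) \<in> borel_measurable borel"
    by measurable
  then show ?thesis by simp
qed

lemma bounded_variation_bounded: "\<exists>B. \<forall>t\<ge>0. \<bar>\<Psi> t\<bar> \<le> B"
proof -
  obtain B where B: "\<And>t. variation_fun \<Psi> t \<le> B" using variation_fun_bounded by blast
  have "\<bar>\<Psi> t\<bar> \<le> \<bar>\<Psi> 0\<bar> + B" if "0 \<le> t" for t
    using abs_diff_le_variation_fun[of 0 t] B[of t] variation_fun_nonneg[of 0] that by linarith
  then show ?thesis by blast
qed

lemma bounded_variation_tendsto: "\<exists>L. (\<Psi> \<longlongrightarrow> L) at_top"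
proof -
  obtain B where B: "\<And>t. variation_fun \<Psi> t \<le> B" using variation_fun_bounded by blast
  obtain B' where B': "\<And>t. 0 \<le> t \<Longrightarrow> \<bar>\<Psi> t\<bar> \<le> B'" using bounded_variation_bounded by blast
  have le: "variation_fun \<Psi> (max 0 t) - \<Psi> (max 0 t) \<le> B + B'" for t
    using B[of "max 0 t"] B'[of "max 0 t"] by auto
  obtain L1 where L1: "((\<lambda>t. variation_fun \<Psi> (max 0 t)) \<longlongrightarrow> L1) at_top"
    using mono_bounded_tendsto[OF mono_variation(1) B] by blast
  obtain L2 where L2: "((\<lambda>t. variation_fun \<Psi> (max 0 t) - \<Psi> (max 0 t)) \<longlongrightarrow> L2) at_top"
    using mono_bounded_tendsto[OF mono_variation(2) le] by blast
  from tendsto_diff[OF L1 L2] have "((\<lambda>t. \<Psi> (max 0 t)) \<longlongrightarrow> L1 - L2) at_top" by simp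
  then have "(\<Psi> \<longlongrightarrow> L1 - L2) at_top"
    by (rule Lim_transform_eventually) (auto simp: eventually_at_top_linorder max_def intro!: exI[of _ 0])
  then show ?thesis by blast
qed

lemma set_integrable_continuous_bounded_variation:
  assumes "continuous_on {0..R} g"
  shows "set_integrable lborel {0..R} (\<lambda>t. g t * \<Psi> t)"
proof -
  obtain B' where B': "\<And>t. 0 \<le> t \<Longrightarrow> \<bar>\<Psi> t\<bar> \<le> B'" using bounded_variation_bounded by blast
  note [measurable] = bounded_variation_measurable
  have "set_integrable lborel {0..R} g"
    using assms by (rule borel_integrable_compact[OF compact_Icc, folded set_integrable_def])
  then have "integrable lborel (\<lambda>t. (indicator {0..R} t *\<^sub>R g t) * B')"
    unfolding set_integrable_def by (rule integrable_mult_left)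
  then have bound: "integrable lborel (\<lambda>t. (indicator {0..R} t *\<^sub>R g t) * B')" .
  have [measurable]: "(\<lambda>t. indicator {0..R} t *\<^sub>R g t) \<in> borel_measurable borel"
    using borel_measurable_continuous_on_indicator[OF _ assms] by simp
  have "(\<lambda>t. indicator {0..R} t *\<^sub>R (g t * \<Psi> t)) = (\<lambda>t. (indicator {0..R} t *\<^sub>R g t) * \<Psi> (max 0 t))"
    by (auto simp: indicator_def fun_eq_iff)
  moreover have "(\<lambda>t. (indicator {0..R} t *\<^sub>R g t) * \<Psi> (max 0 t)) \<in> borel_measurable borel" by measurable
  ultimately have "(\<lambda>t. indicator {0..R} t *\<^sub>R (g t * \<Psi> t)) \<in> borel_measurable lborel" by simp
  with bound show ?thesis
    unfolding set_integrable_def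
    by (rule Bochner_Integration.integrable_bound)
      (auto simp: indicator_def abs_mult intro!: always_eventually mult_left_mono order_trans[OF B'])
qed

text \<open>On each interval of a tagged division the error is at most L times its length times the
  increase of the variation function. Lengths are at most twice the gauge radius and the increases
  telescope, so the error tends to 0 with the mesh. No continuity of \<Psi> is involved.\<close>

lemma has_rs_integral_by_parts:
  assumes R: "0 \<le> R"
    and f: "\<And>t. t \<in> {0..R} \<Longrightarrow> (f has_real_derivative f' t) (at t)"
    and f': "continuous_on {0..R} f'" "\<And>t. t \<in> {0..R} \<Longrightarrow> \<bar>f' t\<bar> \<le> L"
  shows "has_rs_integral f \<Psi> 0 R (f R * \<Psi> R - f 0 * \<Psi> 0 - integral {0..R} (\<lambda>t. f' t * \<Psi> t))"
proof -
  let ?V = "variation_fun \<Psi>"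
  have L: "0 \<le> L" using f'(2)[of 0] R by auto
  have int: "(\<lambda>t. f' t * \<Psi> t) integrable_on {c..d}" if "0 \<le> c" "d \<le> R" for c d
    by (rule integrable_on_subinterval[OF set_borel_integral_eq_integral(1)[OF set_integrable_continuous_bounded_variation[OF f'(1)]]])
      (use that in auto)
  \<comment> \<open>The candidate for the indefinite Stieltjes integral of f, up to a
    constant.\<close>
  define F where "F t = f t * \<Psi> t - integral {0..t} (\<lambda>t. f' t * \<Psi> t)" for t
  have half: "\<bar>integral {c..d} (\<lambda>t. f' t * \<Psi> t) - (f d - f c) * \<Psi> s\<bar> \<le> L * v * (d - c)"
    if cd: "0 \<le> c" "c \<le> d" "d \<le> R" and v: "\<And>t. t \<in> {c..d} \<Longrightarrow> \<bar>\<Psi> t - \<Psi> s\<bar> \<le> v" for c d s v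
  proof -
    have "(f' has_integral (f d - f c)) {c..d}"
      using cd by (intro fundamental_theorem_of_calculus)
        (auto intro!: has_field_derivative_at_within f simp flip: has_real_derivative_iff_has_vector_derivative)
    then have "((\<lambda>t. f' t * \<Psi> t - f' t * \<Psi> s) has_integral (integral {c..d} (\<lambda>t. f' t * \<Psi> t) - (f d - f c) * \<Psi> s)) {c..d}"
      using int[of c d] cd by (intro has_integral_diff has_integral_mult_left) auto
    then have hi: "((\<lambda>t. f' t * \<Psi> t - f' t * \<Psi> s) has_integral (integral {c..d} (\<lambda>t. f' t * \<Psi> t) - (f d - f c) * \<Psi> s)) (cbox c d)"
      by simp
    have bd: "norm (f' t * \<Psi> t - f' t * \<Psi> s) \<le> L * v" if "t \<in> {c..d}" for t
    proof -
      have "\<bar>f' t\<bar> * \<bar>\<Psi> t - \<Psi> s\<bar> \<le> L * v" using v[OF that] f'(2)[of t] that cd L by (intro mult_mono) auto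
      then show ?thesis by (simp add: abs_mult[symmetric] right_diff_distrib)
    qed
    have "0 \<le> v" using v[of c] cd by force
    then show ?thesis
      using has_integral_bound[OF _ hi, of "L * v"] bd L cd by (simp add: content_real)
  qed
  \<comment> \<open>The tag x cuts the interval in two. Summation by parts leaves the integral of f'
    \<Psi>, with \<Psi> frozen at c on the left piece and at d on the right one.\<close>
  have est: "\<bar>f x * (\<Psi> d - \<Psi> c) - (F d - F c)\<bar> \<le> L * (d - c) * (?V d - ?V c)"
    if cd: "0 \<le> c" "c \<le> x" "x \<le> d" "d \<le> R" for c d x
  proof -
    have Vm: "\<bar>\<Psi> t - \<Psi> d\<bar> \<le> ?V d - ?V c" "\<bar>\<Psi> t - \<Psi> c\<bar> \<le> ?V d - ?V c" if "t \<in> {c..d}" for t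
      using abs_diff_le_variation_fun[of c t] abs_diff_le_variation_fun[of t d] that cd by auto
    have 1: "\<bar>integral {x..d} (\<lambda>t. f' t * \<Psi> t) - (f d - f x) * \<Psi> d\<bar> \<le> L * (?V d - ?V c) * (d - x)"
      using cd Vm by (intro half) auto
    have 2: "\<bar>integral {c..x} (\<lambda>t. f' t * \<Psi> t) - (f x - f c) * \<Psi> c\<bar> \<le> L * (?V d - ?V c) * (x - c)"
      using cd Vm by (intro half) auto
    have "integral {0..c} (\<lambda>t. f' t * \<Psi> t) + integral {c..d} (\<lambda>t. f' t * \<Psi> t) = integral {0..d} (\<lambda>t. f' t * \<Psi> t)"
      by (rule Henstock_Kurzweil_Integration.integral_combine) (use cd int in auto)
    moreover have "integral {c..x} (\<lambda>t. f' t * \<Psi> t) + integral {x..d} (\<lambda>t. f' t * \<Psi> t) = integral {c..d} (\<lambda>t. f' t * \<Psi> t)"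
      by (rule Henstock_Kurzweil_Integration.integral_combine) (use cd int in auto)
    ultimately have "f x * (\<Psi> d - \<Psi> c) - (F d - F c)
      = (integral {x..d} (\<lambda>t. f' t * \<Psi> t) - (f d - f x) * \<Psi> d) + (integral {c..x} (\<lambda>t. f' t * \<Psi> t) - (f x - f c) * \<Psi> c)"
      by (simp add: F_def algebra_simps)
    also have "\<bar>\<dots>\<bar> \<le> L * (?V d - ?V c) * (d - x) + L * (?V d - ?V c) * (x - c)"
      using 1 2 by linarith
    also have "\<dots> = L * (d - c) * (?V d - ?V c)" by (simp add: algebra_simps)
    finally show ?thesis .
  qed
  have "has_rs_integral f \<Psi> 0 R (F R - F 0)"
    unfolding has_rs_integral_def
  proof (intro allI impI)
    fix e :: real assume e: "0 < e"
    \<comment> \<open>The summand 1 makes M positive and the final inequality strict.\<close>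
    define M where "M = L * ?V R + 1"
    define \<delta> where "\<delta> = e / (2 * M)"
    have M: "0 < M" using L variation_fun_nonneg[of R] by (simp add: M_def add_nonneg_pos)
    then have \<delta>: "0 < \<delta>" using e by (simp add: \<delta>_def)
    show "\<exists>d>0. \<forall>P. P tagged_division_of {0..R} \<longrightarrow> (\<lambda>x. ball x d) fine P \<longrightarrow>
        \<bar>(\<Sum>(x, K) \<in> P. f x * (\<Psi> (Sup K) - \<Psi> (Inf K))) - (F R - F 0)\<bar> < e"
    proof (intro exI[of _ \<delta>] conjI allI impI \<delta>)
      fix P assume P: "P tagged_division_of {0..R}" and fine: "(\<lambda>x. ball x \<delta>) fine P"
      have "(\<Sum>(x, K) \<in> P. f x * (\<Psi> (Sup K) - \<Psi> (Inf K))) - (F R - F 0)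
        = (\<Sum>(x, K) \<in> P. f x * (\<Psi> (Sup K) - \<Psi> (Inf K))) - (\<Sum>(x, K) \<in> P. F (Sup K) - F (Inf K))"
        using additive_tagged_division_1[OF R P, of F] by simp
      also have "\<dots> = (\<Sum>(x, K) \<in> P. f x * (\<Psi> (Sup K) - \<Psi> (Inf K)) - (F (Sup K) - F (Inf K)))"
        by (simp add: sum_subtractf[symmetric] case_prod_unfold)
      also have "\<bar>\<dots>\<bar> \<le> (\<Sum>(x, K) \<in> P. L * (2 * \<delta>) * (?V (Sup K) - ?V (Inf K)))"
      proof (rule order_trans[OF sum_abs sum_mono])
        fix z assume z: "z \<in> P"
        obtain x K where zx: "z = (x, K)" by (cases z)
        obtain c d where K: "K = {c..d}" using tagged_division_ofD(4)[OF P] z zx by (metis box_real(2))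
        have x: "c \<le> x" "x \<le> d" using tagged_division_ofD(2)[OF P, of x K] z zx K by auto
        have "c \<in> {0..R}" "d \<in> {0..R}" using tagged_division_ofD(3)[OF P, of x K] z zx K x by auto
        then have cd: "0 \<le> c" "d \<le> R" by auto
        have "{c..d} \<subseteq> ball x \<delta>" using fineD[OF fine, of x K] z zx K by simp
        moreover have "c \<in> {c..d}" "d \<in> {c..d}" using x by auto
        ultimately have "c \<in> ball x \<delta>" "d \<in> ball x \<delta>" by blast+
        then have dc: "d - c \<le> 2 * \<delta>" using x by (simp add: dist_real_def)
        have V: "0 \<le> ?V d - ?V c" using abs_diff_le_variation_fun[of c d] cd x by linarith
        have "\<bar>f x * (\<Psi> d - \<Psi> c) - (F d - F c)\<bar> \<le> L * (d - c) * (?V d - ?V c)"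
          using cd x by (intro est)
        also have "\<dots> \<le> L * (2 * \<delta>) * (?V d - ?V c)"
          using dc L V by (intro mult_right_mono mult_left_mono)
        finally show "\<bar>case z of (x, K) \<Rightarrow> f x * (\<Psi> (Sup K) - \<Psi> (Inf K)) - (F (Sup K) - F (Inf K))\<bar>
           \<le> (case z of (x, K) \<Rightarrow> L * (2 * \<delta>) * (?V (Sup K) - ?V (Inf K)))"
          using x by (simp add: zx K)
      qed
      also have "\<dots> = L * (2 * \<delta>) * (\<Sum>(x, K) \<in> P. ?V (Sup K) - ?V (Inf K))"
        by (simp add: sum_distrib_left case_prod_unfold)
      also have "\<dots> = L * (2 * \<delta>) * (?V R - ?V 0)"
        using additive_tagged_division_1[OF R P, of ?V] by simp
      also have "\<dots> \<le> L * (2 * \<delta>) * ?V R"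
        using L \<delta> variation_fun_nonneg[of 0] by (intro mult_left_mono) auto
      also have "\<dots> < e"
      proof -
        have "2 * \<delta> = e / M" by (simp add: \<delta>_def)
        moreover have "L * (2 * \<delta>) * ?V R = (M - 1) * (2 * \<delta>)" by (simp add: M_def)
        ultimately have "L * (2 * \<delta>) * ?V R = (M - 1) * (e / M)" by simp
        also have "(M - 1) * (e / M) < M * (e / M)" using M e by (intro mult_strict_right_mono) auto
        also have "\<dots> = e" using M by simp
        finally show ?thesis .
      qed
      finally show "\<bar>(\<Sum>(x, K) \<in> P. f x * (\<Psi> (Sup K) - \<Psi> (Inf K))) - (F R - F 0)\<bar> < e" .
    qed
  qed
  then show ?thesis by (simp add: F_def algebra_simps)
qed

end

text \<open>By Cousin's lemma there is a tagged division fine for both gauges at once.\<close>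

lemma has_rs_integral_unique:
  assumes "has_rs_integral f g a b I" "has_rs_integral f g a b J"
  shows "I = J"
proof (rule ccontr)
  assume "I \<noteq> J"
  then have e: "0 < \<bar>I - J\<bar> / 2" by simp
  let ?S = "\<lambda>P. \<Sum>(x, K) \<in> P. f x * (g (Sup K) - g (Inf K))"
  obtain d1 where d1: "0 < d1" "\<And>P. P tagged_division_of {a..b} \<Longrightarrow> (\<lambda>x. ball x d1) fine P \<Longrightarrow> \<bar>?S P - I\<bar> < \<bar>I - J\<bar> / 2"
    using assms(1) e unfolding has_rs_integral_def by meson
  obtain d2 where d2: "0 < d2" "\<And>P. P tagged_division_of {a..b} \<Longrightarrow> (\<lambda>x. ball x d2) fine P \<Longrightarrow> \<bar>?S P - J\<bar> < \<bar>I - J\<bar> / 2"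
    using assms(2) e unfolding has_rs_integral_def by meson
  have "gauge (\<lambda>x::real. ball x (min d1 d2))" using d1 d2 by (auto simp: gauge_def)
  then obtain P where P: "P tagged_division_of {a..b}" "(\<lambda>x. ball x (min d1 d2)) fine P"
    using fine_division_exists_real by blast
  then have "(\<lambda>x. ball x d1) fine P" "(\<lambda>x. ball x d2) fine P" by (auto simp: fine_def subset_iff)
  then have "\<bar>?S P - I\<bar> < \<bar>I - J\<bar> / 2" "\<bar>?S P - J\<bar> < \<bar>I - J\<bar> / 2"
    using d1(2)[OF P(1)] d2(2)[OF P(1)] by blast+
  moreover have "\<bar>I - J\<bar> \<le> \<bar>?S P - I\<bar> + \<bar>?S P - J\<bar>"
    using abs_triangle_ineq4[of "?S P - J" "?S P - I"] by simp
  ultimately show False by simp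
qed

lemma rs_integral_eq: "has_rs_integral f g a b I \<Longrightarrow> rs_integral f g a b = I"
  unfolding rs_integral_def using has_rs_integral_unique by blast

lemma set_integrable_exp_bounded_variation:
  assumes BV: "bounded_variation_on \<Psi> {0..}" and c: "0 < c"
  shows "set_integrable lborel {0..} (\<lambda>t. exp (- (c * t)) * \<Psi> t)"
proof -
  obtain B where B: "\<And>t. 0 \<le> t \<Longrightarrow> \<bar>\<Psi> t\<bar> \<le> B" using bounded_variation_bounded[OF BV] by blast
  note [measurable] = bounded_variation_measurable[OF BV]
  from integrable_I0i_exp_mscale[OF c] have bound: "integrable lborel (\<lambda>t. (indicator {0<..} t *\<^sub>R exp (- (t * c))) * B)"
    unfolding set_integrable_def by (rule integrable_mult_left)
  have "(\<lambda>t. indicator {0..} t *\<^sub>R (exp (- (c * t)) * \<Psi> t)) = (\<lambda>t. (indicator {0..} t *\<^sub>R exp (- (c * t))) * \<Psi> (max 0 t))"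
    by (auto simp: indicator_def fun_eq_iff)
  moreover have "(\<lambda>t. (indicator {0..} t *\<^sub>R exp (- (c * t))) * \<Psi> (max 0 t)) \<in> borel_measurable borel" by measurable
  ultimately have "(\<lambda>t. indicator {0..} t *\<^sub>R (exp (- (c * t)) * \<Psi> t)) \<in> borel_measurable lborel" by simp
  with bound show ?thesis
    unfolding set_integrable_def
  proof (rule Bochner_Integration.integrable_bound)
    show "AE t in lborel. norm (indicator {0..} t *\<^sub>R (exp (- (c * t)) * \<Psi> t)) \<le> norm ((indicator {0<..} t *\<^sub>R exp (- (t * c))) * B)"
      using AE_lborel_singleton[of 0]
      by eventually_elim (auto simp: indicator_def abs_mult mult.commute[of c] intro!: mult_left_mono order_trans[OF B])
  qed
qed

text \<open>Integration by parts on [0,R], then R to infinity. The boundary term at 0 vanishes by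
  \<Psi> 0 = 0, and the one at R survives in the limit only for k = 0, where the exponential does
  not decay.\<close>

lemma stieltjes_integral_exp:
  assumes BV: "bounded_variation_on \<Psi> {0..}" and \<Psi>0: "\<Psi> 0 = 0" and L: "(\<Psi> \<longlongrightarrow> L) at_top"
  shows "stieltjes_integral (\<lambda>t. exp (- (real k * t))) \<Psi> =
     (if k = 0 then L else real k * (LINT t:{0..}|lborel. exp (- (real k * t)) * \<Psi> t))"
proof -
  let ?f = "\<lambda>t. exp (- (real k * t))"
  have I: "rs_integral ?f \<Psi> 0 R = ?f R * \<Psi> R + real k * (LINT t:{0..R}|lborel. ?f t * \<Psi> t)" if "0 \<le> R" for R
  proof -
    have c: "continuous_on {0..R} (\<lambda>t. - real k * ?f t)" by (intro continuous_intros)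
    have "has_rs_integral ?f \<Psi> 0 R (?f R * \<Psi> R - ?f 0 * \<Psi> 0 - integral {0..R} (\<lambda>t. - real k * ?f t * \<Psi> t))"
    proof (rule has_rs_integral_by_parts[OF BV that _ c])
      show "(?f has_real_derivative - real k * ?f t) (at t)" for t
        by (auto intro!: derivative_eq_intros)
      show "\<bar>- real k * ?f t\<bar> \<le> real k" if "t \<in> {0..R}" for t
        using that by (simp add: abs_mult mult_left_le)
    qed
    then have "rs_integral ?f \<Psi> 0 R = ?f R * \<Psi> R - (LINT t:{0..R}|lborel. - real k * ?f t * \<Psi> t)"
      using set_borel_integral_eq_integral(2)[OF set_integrable_continuous_bounded_variation[OF BV c]]
      by (simp add: rs_integral_eq \<Psi>0)
    moreover have "(LINT t:{0..R}|lborel. - real k * (?f t * \<Psi> t)) = - real k * (LINT t:{0..R}|lborel. ?f t * \<Psi> t)"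
      by (rule set_integral_mult_right)
    ultimately show ?thesis by (simp only: mult.assoc)
  qed
  have "((\<lambda>R. rs_integral ?f \<Psi> 0 R) \<longlongrightarrow> (if k = 0 then L else real k * (LINT t:{0..}|lborel. ?f t * \<Psi> t))) at_top"
  proof (cases "k = 0")
    case True
    have I0: "rs_integral ?f \<Psi> 0 R = \<Psi> R" if "0 \<le> R" for R
      unfolding I[OF that] using True by simp
    have "eventually (\<lambda>R. \<Psi> R = rs_integral ?f \<Psi> 0 R) at_top"
      using eventually_ge_at_top[of 0] by eventually_elim (simp only: I0)
    from Lim_transform_eventually[OF L this] show ?thesis unfolding True by simp
  next
    case False
    have "((\<lambda>R. ?f R) \<longlongrightarrow> 0) at_top" using False by real_asymp
    from tendsto_mult[OF this L] have 1: "((\<lambda>R. ?f R * \<Psi> R) \<longlongrightarrow> 0) at_top" by simp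
    have 2: "((\<lambda>R. LINT t:{0..R}|lborel. ?f t * \<Psi> t) \<longlongrightarrow> (LINT t:{0..}|lborel. ?f t * \<Psi> t)) at_top"
      using set_integrable_exp_bounded_variation[OF BV, of "real k"] False
      by (intro tendsto_set_lebesgue_integral_at_top) auto
    have "((\<lambda>R. ?f R * \<Psi> R + real k * (LINT t:{0..R}|lborel. ?f t * \<Psi> t)) \<longlongrightarrow> 0 + real k * (LINT t:{0..}|lborel. ?f t * \<Psi> t)) at_top"
      by (intro tendsto_intros 1 2)
    then have "((\<lambda>R. rs_integral ?f \<Psi> 0 R) \<longlongrightarrow> 0 + real k * (LINT t:{0..}|lborel. ?f t * \<Psi> t)) at_top"
      by (rule Lim_transform_eventually) (auto simp: I eventually_at_top_linorder intro!: exI[of _ 0])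
    with False show ?thesis by simp
  qed
  then show ?thesis unfolding stieltjes_integral_def by (intro tendsto_Lim) auto
qed

section \<open>The Mehler kernel\<close>


text \<open>
  The derivative in \<open>t\<close>, at \<open>r = exp (- t)\<close>, of the Mehler kernel
  \<open>\<Sum>k. r ^ k * hermite_fun k x * hermite_fun k y\<close>.
\<close>

definition mehler_dt :: "real \<Rightarrow> real \<Rightarrow> real \<Rightarrow> real" where
  "mehler_dt r x y = exp (y\<^sup>2 / 2 - x\<^sup>2 / 2 - (y - r * x)\<^sup>2 / (1 - r\<^sup>2)) / (sqrt pi * sqrt (1 - r\<^sup>2)) *
     (2 * r\<^sup>2 * (y - r * x)\<^sup>2 / (1 - r\<^sup>2)\<^sup>2 - 2 * r * x * (y - r * x) / (1 - r\<^sup>2) - r\<^sup>2 / (1 - r\<^sup>2))"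

text \<open>In the variables x + y and x - y the Mehler exponent is diagonal. The quadratic factor
  of the derivative is linear in the same two quantities, so half of the exponential absorbs it, and
  the Gaussian in x + y is then discarded.\<close>

lemma mehler_dt_bound_ratio:
  assumes r: "0 < r" "r < 1"
  shows "\<bar>mehler_dt r x y\<bar> \<le> 24 * r / ((1 - r\<^sup>2) * sqrt (1 - r\<^sup>2)) * exp (- ((1 + r) / (1 - r) * (x - y)\<^sup>2 / 8))"
proof -
  define S where "S = 1 - r\<^sup>2"
  have S: "0 < S" "S = (1 - r) * (1 + r)"
    using power_Suc_less_one[OF r, of 1] by (auto simp: S_def power2_eq_square algebra_simps)
  define w z where "w = x + y" and "z = x - y"
  define u where "u = (1 - r) / (1 + r)"
  have u: "0 < u" using r by (simp add: u_def)
  \<comment> \<open>The exponent of the kernel equals - (\<alpha> + \<beta>)/4, shown as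
    \<open>expo\<close>, and 2 |w z| \<le> \<alpha> + \<beta> by the arithmetic-geometric mean
    inequality.\<close>
  define \<alpha> \<beta> where "\<alpha> = u * w\<^sup>2" and "\<beta> = z\<^sup>2 / u"
  have ab: "0 \<le> \<alpha>" "0 \<le> \<beta>" using u by (auto simp: \<alpha>_def \<beta>_def)
  have xy: "x = (w + z) / 2" "y = (w - z) / 2" by (auto simp: w_def z_def)
  have yrx: "y - r * x = ((1 - r) * w - (1 + r) * z) / 2" unfolding xy by (simp add: field_simps)
  have a1: "(1 - r) * w\<^sup>2 = (1 + r) * \<alpha>" "(1 - r)\<^sup>2 * w\<^sup>2 = S * \<alpha>"
    using r by (auto simp: \<alpha>_def u_def S power2_eq_square)
  have b1: "(1 + r) * z\<^sup>2 = (1 - r) * \<beta>" "(1 + r)\<^sup>2 * z\<^sup>2 = S * \<beta>"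
    using r by (auto simp: \<beta>_def u_def S power2_eq_square)
  have wz: "2 * \<bar>w * z\<bar> \<le> \<alpha> + \<beta>"
  proof -
    have "0 \<le> (u * \<bar>w\<bar> - \<bar>z\<bar>)\<^sup>2" by simp
    also have "\<dots> = u * (\<alpha> + \<beta>) - u * (2 * \<bar>w * z\<bar>)"
      using u by (simp add: \<alpha>_def \<beta>_def power2_diff power_mult_distrib abs_mult algebra_simps) (simp add: power2_eq_square)
    finally have "u * (2 * \<bar>w * z\<bar>) \<le> u * (\<alpha> + \<beta>)" by simp
    then show ?thesis using u by simp
  qed
  have sq: "(y - r * x)\<^sup>2 / S \<le> (\<alpha> + \<beta>) / 2"
  proof -
    have "(y - r * x)\<^sup>2 \<le> ((1 - r)\<^sup>2 * w\<^sup>2 + (1 + r)\<^sup>2 * z\<^sup>2) / 2"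
    proof -
      have "((c - d) / 2)\<^sup>2 \<le> (c\<^sup>2 + d\<^sup>2) / 2" for c d :: real
        using zero_le_power2[of "c + d"] by (simp add: power2_eq_square field_simps)
      from this[of "(1 - r) * w" "(1 + r) * z"] show ?thesis unfolding yrx by (simp only: power_mult_distrib)
    qed
    then have "(y - r * x)\<^sup>2 \<le> (S * \<alpha> + S * \<beta>) / 2" by (simp only: a1 b1)
    also have "\<dots> = (\<alpha> + \<beta>) / 2 * S" by (simp only: distrib_left[symmetric]) simp
    finally show ?thesis using S(1) by (simp only: pos_divide_le_eq)
  qed
  have lin: "\<bar>x * (y - r * x)\<bar> \<le> \<alpha> + \<beta>"
  proof -
    have "x * (y - r * x) = ((1 - r) * w\<^sup>2 - 2 * r * (w * z) - (1 + r) * z\<^sup>2) / 4"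
    proof -
      have "(w + z) * ((1 - r) * w - (1 + r) * z) = (1 - r) * w\<^sup>2 - 2 * r * (w * z) - (1 + r) * z\<^sup>2"
        by (simp add: power2_eq_square algebra_simps)
      moreover have "x * (y - r * x) = (w + z) * ((1 - r) * w - (1 + r) * z) / 4"
        unfolding yrx by (subst xy(1)) simp
      ultimately show ?thesis by simp
    qed
    moreover have "\<bar>(A - B - C) / 4\<bar> \<le> \<alpha> + \<beta>"
      if "\<bar>A\<bar> \<le> 2 * \<alpha>" "\<bar>B\<bar> \<le> D" "D \<le> \<alpha> + \<beta>" "\<bar>C\<bar> \<le> \<beta>" for A B C D
    proof -
      have "\<bar>A - B - C\<bar> \<le> \<bar>A\<bar> + \<bar>B\<bar> + \<bar>C\<bar>" by linarith
      then have "\<bar>A - B - C\<bar> \<le> 4 * (\<alpha> + \<beta>)" using that ab by argo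
      then show ?thesis by simp
    qed
    moreover have "\<bar>(1 - r) * w\<^sup>2\<bar> \<le> 2 * \<alpha>" using r ab by (simp add: a1 abs_mult mult_right_mono)
    moreover have "\<bar>(1 + r) * z\<^sup>2\<bar> \<le> \<beta>" using r ab by (simp add: b1 abs_mult mult_left_le_one_le)
    moreover have "\<bar>2 * r * (w * z)\<bar> \<le> 2 * \<bar>w * z\<bar>" using r by (simp add: abs_mult mult_left_le_one_le)
    ultimately show ?thesis using wz by presburger
  qed
  have expo: "y\<^sup>2 / 2 - x\<^sup>2 / 2 - (y - r * x)\<^sup>2 / S = - ((\<alpha> + \<beta>) / 4)"
  proof -
    have "S * \<alpha> + S * \<beta> = 4 * (y - r * x)\<^sup>2 + 2 * S * (x\<^sup>2 - y\<^sup>2)"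
      unfolding a1(2)[symmetric] b1(2)[symmetric] by (simp add: S w_def z_def power2_eq_square algebra_simps)
    then show ?thesis using S(1) by (simp add: field_simps)
  qed
  have Q: "\<bar>2 * r\<^sup>2 * (y - r * x)\<^sup>2 / S\<^sup>2 - 2 * r * x * (y - r * x) / S - r\<^sup>2 / S\<bar> \<le> r * (3 * (\<alpha> + \<beta>) + 1) / S"
  proof -
    have "S * (2 * r\<^sup>2 * (y - r * x)\<^sup>2 / S\<^sup>2 - 2 * r * x * (y - r * x) / S - r\<^sup>2 / S)
      = r * (2 * r * ((y - r * x)\<^sup>2 / S) - 2 * (x * (y - r * x)) - r)"
      using S(1) by (simp add: power2_eq_square field_simps)
    moreover have "\<bar>2 * r * ((y - r * x)\<^sup>2 / S) - 2 * (x * (y - r * x)) - r\<bar> \<le> 3 * (\<alpha> + \<beta>) + 1"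
    proof -
      have gen: "\<bar>2 * g - 2 * X - r\<bar> \<le> 3 * (\<alpha> + \<beta>) + 1" if "0 \<le> g" "g \<le> (\<alpha> + \<beta>) / 2" "\<bar>X\<bar> \<le> \<alpha> + \<beta>" for g X
      proof -
        have "\<bar>2 * g - 2 * X - r\<bar> \<le> 2 * g + 2 * \<bar>X\<bar> + r" using that r by linarith
        then show ?thesis using that r ab by argo
      qed
      have G: "0 \<le> (y - r * x)\<^sup>2 / S" using S by simp
      have "0 \<le> r * ((y - r * x)\<^sup>2 / S)" using r G by (intro mult_nonneg_nonneg) auto
      moreover have "r * ((y - r * x)\<^sup>2 / S) \<le> (\<alpha> + \<beta>) / 2"
        using mult_left_le_one_le[OF G, of r] r sq by linarith
      ultimately have "\<bar>2 * (r * ((y - r * x)\<^sup>2 / S)) - 2 * (x * (y - r * x)) - r\<bar> \<le> 3 * (\<alpha> + \<beta>) + 1"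
        using lin by (intro gen)
      then show ?thesis by (simp only: mult.assoc)
    qed
    ultimately have "\<bar>S * (2 * r\<^sup>2 * (y - r * x)\<^sup>2 / S\<^sup>2 - 2 * r * x * (y - r * x) / S - r\<^sup>2 / S)\<bar> \<le> r * (3 * (\<alpha> + \<beta>) + 1)"
      using r by (simp add: abs_mult mult_left_mono)
    moreover have "\<bar>e\<bar> \<le> c / S" if "\<bar>S * e\<bar> \<le> c" for e c
      using that S(1) by (simp add: abs_mult pos_le_divide_eq mult.commute)
    ultimately show ?thesis by blast
  qed
  have pi: "1 \<le> sqrt pi" using pi_gt3 by simp
  have "\<bar>mehler_dt r x y\<bar> = exp (- ((\<alpha> + \<beta>) / 4)) / (sqrt pi * sqrt S) * \<bar>2 * r\<^sup>2 * (y - r * x)\<^sup>2 / S\<^sup>2 - 2 * r * x * (y - r * x) / S - r\<^sup>2 / S\<bar>"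
    unfolding mehler_dt_def S_def[symmetric] expo using S by (simp add: abs_mult)
  also have "\<dots> \<le> exp (- ((\<alpha> + \<beta>) / 4)) / (1 * sqrt S) * (r * (3 * (\<alpha> + \<beta>) + 1) / S)"
    using pi S by (intro mult_mono Q divide_left_mono mult_right_mono mult_pos_pos) auto
  also have "\<dots> = r / (S * sqrt S) * (exp (- ((\<alpha> + \<beta>) / 4)) * (3 * (\<alpha> + \<beta>) + 1))" by (simp add: mult_ac)
  also have "\<dots> \<le> r / (S * sqrt S) * (24 * exp (- (\<beta> / 8)))"
  proof (intro mult_left_mono)
    \<comment> \<open>The 24 is 3 * 8, from e^{X/8} \<ge> 1 + X/8.\<close>
    have "3 * X + 1 \<le> 24 * exp (X / 8)" for X :: real
      using exp_ge_add_one_self[of "X / 8"] by linarith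
    then have "3 * (\<alpha> + \<beta>) + 1 \<le> 24 * exp ((\<alpha> + \<beta>) / 8)" .
    then have "exp (- ((\<alpha> + \<beta>) / 4)) * (3 * (\<alpha> + \<beta>) + 1) \<le> exp (- ((\<alpha> + \<beta>) / 4)) * (24 * exp ((\<alpha> + \<beta>) / 8))"
      by (intro mult_left_mono) auto
    also have "\<dots> = 24 * exp (- ((\<alpha> + \<beta>) / 8))" by (simp add: exp_add[symmetric])
    also have "\<dots> \<le> 24 * exp (- (\<beta> / 8))" using ab by simp
    finally show "exp (- ((\<alpha> + \<beta>) / 4)) * (3 * (\<alpha> + \<beta>) + 1) \<le> 24 * exp (- (\<beta> / 8))" .
  qed (use r S in auto)
  also have "\<beta> = (1 + r) / (1 - r) * (x - y)\<^sup>2" by (simp add: \<beta>_def u_def z_def mult.commute)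
  also have "r / (S * sqrt S) * (24 * exp (- ((1 + r) / (1 - r) * (x - y)\<^sup>2 / 8)))
     = 24 * r / (S * sqrt S) * exp (- ((1 + r) / (1 - r) * (x - y)\<^sup>2 / 8))"
    by (simp only: times_divide_eq_right times_divide_eq_left mult_ac)
  finally show ?thesis by (simp only: S_def)
qed

text \<open>For small t, S = 1 - r^2 is comparable to t. For large t it is near 1, and the factor r
  = e^{-t} in front compensates the growth of (1 + 2 t)^(3/2). The constant is 384 = 24 *
  16.\<close>

lemma mehler_dt_bound:
  assumes t: "0 < t"
  shows "\<bar>mehler_dt (exp (- t)) x y\<bar> \<le> 384 * (t powr (- 3 / 2) * exp (- ((x - y)\<^sup>2 / (16 * t))) * exp (- ((x - y)\<^sup>2 / 16)))"
proof -
  define r where "r = exp (- t)"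
  have r: "0 < r" "r < 1" using t by (auto simp: r_def)
  define S where "S = 1 - r\<^sup>2"
  define z where "z = x - y"
  have S0: "0 < S" using power_Suc_less_one[OF r, of 1] by (simp add: S_def power2_eq_square)
  have S: "t / (1 + 2 * t) \<le> S"
  proof -
    have "1 + 2 * t \<le> exp (2 * t)" by (rule exp_ge_add_one_self)
    then have "exp (- (2 * t)) \<le> 1 / (1 + 2 * t)" using t by (simp add: exp_minus field_simps)
    moreover have "r\<^sup>2 = exp (- (2 * t))" by (simp add: r_def power2_eq_square exp_add[symmetric])
    moreover have "t / (1 + 2 * t) \<le> 1 - 1 / (1 + 2 * t)" using t by (simp add: field_simps)
    ultimately show ?thesis by (simp add: S_def)
  qed
  have rS: "r / (S * sqrt S) \<le> 16 * t powr (- 3 / 2)"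
  proof -
    have "S * sqrt S = S powr (3 / 2)"
      using S0 powr_add[of S 1 "1 / 2"] by (simp add: powr_half_sqrt)
    then have "1 / (S * sqrt S) = S powr (- (3 / 2))" by (simp add: powr_minus_divide)
    also have "\<dots> \<le> (t / (1 + 2 * t)) powr (- (3 / 2))"
      using S t by (intro powr_mono2') auto
    also have "\<dots> = (1 + 2 * t) powr (3 / 2) * t powr (- (3 / 2))"
      by (rule powr_divide_minus)
    finally have "r * (1 / (S * sqrt S)) \<le> r * ((1 + 2 * t) powr (3 / 2) * t powr (- (3 / 2)))"
      using r by (intro mult_left_mono) auto
    \<comment> \<open>The exponent is rounded up to 2 so that the bound becomes the square of 4
      e^{t/2}, that is 16 e^t, which cancels r.\<close>
    also have "(1 + 2 * t) powr (3 / 2) \<le> (1 + 2 * t) powr 2" using t by (intro powr_mono) auto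
    also have "\<dots> = (1 + 2 * t)\<^sup>2" using t by simp
    also have "\<dots> \<le> (4 * exp (t / 2))\<^sup>2"
    proof (rule power_mono)
      show "1 + 2 * t \<le> 4 * exp (t / 2)" using exp_ge_add_one_self[of "t / 2"] by linarith
    qed (use t in simp)
    also have "\<dots> = 16 * exp t" by (simp add: power_mult_distrib power2_eq_square exp_add[symmetric])
    finally have "r * (1 / (S * sqrt S)) \<le> r * (16 * exp t * t powr (- (3 / 2)))"
      using r by (simp add: mult_left_mono mult_right_mono)
    also have "\<dots> = 16 * t powr (- (3 / 2))" by (simp add: r_def exp_minus)
    finally show ?thesis by simp
  qed
  have v: "(1 + r) / (1 - r) * z\<^sup>2 / 8 \<ge> z\<^sup>2 / (16 * t) + z\<^sup>2 / 16"
  proof -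
    have "1 - r \<le> t" using exp_ge_add_one_self[of "- t"] by (simp add: r_def)
    then have "1 / t \<le> 1 / (1 - r)" using r t by (intro divide_left_mono) auto
    also have "\<dots> \<le> (1 + r) / (1 - r)" using r by (intro divide_right_mono) auto
    finally have "1 / t \<le> (1 + r) / (1 - r)" .
    moreover have "1 \<le> (1 + r) / (1 - r)" using r by simp
    \<comment> \<open>Summing the two lower bounds for the same ratio doubles it: the 8 in the
      exponent becomes 16, and both Gaussians are obtained.\<close>
    ultimately have "1 / t + 1 \<le> 2 * ((1 + r) / (1 - r))" by linarith
    then have le: "(1 / t + 1) * (z\<^sup>2 / 16) \<le> (2 * ((1 + r) / (1 - r))) * (z\<^sup>2 / 16)"
      by (rule mult_right_mono) simp
    have e1: "(1 / t + 1) * (z\<^sup>2 / 16) = z\<^sup>2 / (16 * t) + z\<^sup>2 / 16"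
      using t by (simp add: field_simps)
    have e2: "(2 * V) * (c / 16) = V * c / 8" for V c :: real by simp
    show ?thesis using le unfolding e1 e2 .
  qed
  have "\<bar>mehler_dt r x y\<bar> \<le> 24 * (r / (S * sqrt S)) * exp (- ((1 + r) / (1 - r) * z\<^sup>2 / 8))"
    using mehler_dt_bound_ratio[OF r, of x y] by (simp add: S_def z_def)
  also have "\<dots> \<le> 24 * (16 * t powr (- 3 / 2)) * exp (- (z\<^sup>2 / (16 * t) + z\<^sup>2 / 16))"
    using v rS r S0 by (intro mult_mono) auto
  also have "\<dots> = 384 * (t powr (- 3 / 2) * exp (- (z\<^sup>2 / (16 * t))) * exp (- (z\<^sup>2 / 16)))"
  proof -
    have "exp (- (c + d)) = exp (- c) * exp (- d)" for c d :: real by (simp add: exp_add[symmetric])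
    then show ?thesis by (simp add: mult_ac)
  qed
  finally show ?thesis by (simp add: r_def z_def)
qed

text \<open>The t-derivative of r^k = e^{-kt} is -k r^k. The substitution y = r x + s z with s^2 = 1
  - r^2 turns the integrand into a polynomial times e^{-z^2}, to which the integration by parts rule
  and the affine eigenfunction formula apply.\<close>

lemma integral_mehler_dt_hermite_fun:
  assumes r: "0 < r" "r < 1"
  shows "(\<integral>y. mehler_dt r x y * hermite_fun k y \<partial>lborel) = - (real k * r ^ k * hermite_fun k x)"
proof -
  define s where "s = sqrt (1 - r\<^sup>2)"
  have "0 < 1 - r\<^sup>2" using power_Suc_less_one[OF r, of 1] by (simp add: power2_eq_square)
  then have s: "0 < s" "s\<^sup>2 = 1 - r\<^sup>2" "r\<^sup>2 + s\<^sup>2 = 1" by (auto simp: s_def)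
  let ?a = "[:r * x, s:]"
  define P where "P = hermite_rec k \<circ>\<^sub>p ?a"
  define Z where "Z = ([:0, 2:] :: real poly)"
  \<comment> \<open>The second factor of \<open>mehler_dt\<close> after the substitution, written in
    Z = 2 z so that \<open>gauss_integral_by_parts\<close> applies to each Z.\<close>
  define Q where "Q = smult (r\<^sup>2 / (2 * s\<^sup>2)) (Z * Z) - smult (r * x / s) Z - smult (r\<^sup>2 / s\<^sup>2) 1"
  have pt: "s * (mehler_dt r x (r * x + s * z) * hermite_fun k (r * x + s * z))
      = hermite_const k * exp (- (x\<^sup>2) / 2) / sqrt pi * (poly (Q * P) z * exp (- (z\<^sup>2)))" for z
  proof -
    define y where "y = r * x + s * z"
    have 1: "(y - r * x)\<^sup>2 / s\<^sup>2 = z\<^sup>2" "(y - r * x)\<^sup>2 / (s\<^sup>2)\<^sup>2 = z\<^sup>2 / s\<^sup>2" "x * (y - r * x) / s\<^sup>2 = x * z / s"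
      using s(1) by (auto simp: y_def power2_eq_square)
    have 2: "2 * r\<^sup>2 * (y - r * x)\<^sup>2 / (s\<^sup>2)\<^sup>2 - 2 * r * x * (y - r * x) / s\<^sup>2 - r\<^sup>2 / s\<^sup>2 = poly Q z"
    proof -
      have "2 * r\<^sup>2 * (y - r * x)\<^sup>2 / (s\<^sup>2)\<^sup>2 = 2 * r\<^sup>2 * (z\<^sup>2 / s\<^sup>2)"
        by (simp only: times_divide_eq_right[symmetric] 1(2))
      moreover have "2 * r * x * (y - r * x) / s\<^sup>2 = 2 * r * (x * z / s)"
        unfolding 1(3)[symmetric] by simp
      ultimately show ?thesis by (simp add: Q_def Z_def power2_eq_square) (simp add: algebra_simps)
    qed
    have 3: "exp (y\<^sup>2 / 2 - x\<^sup>2 / 2 - z\<^sup>2) * exp (- (y\<^sup>2) / 2) = exp (- (x\<^sup>2) / 2) * exp (- (z\<^sup>2))"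
      by (simp add: exp_add[symmetric])
    have "mehler_dt r x y = exp (y\<^sup>2 / 2 - x\<^sup>2 / 2 - (y - r * x)\<^sup>2 / s\<^sup>2) / (sqrt pi * s) *
        (2 * r\<^sup>2 * (y - r * x)\<^sup>2 / (s\<^sup>2)\<^sup>2 - 2 * r * x * (y - r * x) / s\<^sup>2 - r\<^sup>2 / s\<^sup>2)"
      unfolding mehler_dt_def s(2) by (simp only: s_def)
    then have "mehler_dt r x y = exp (y\<^sup>2 / 2 - x\<^sup>2 / 2 - z\<^sup>2) / (sqrt pi * s) * poly Q z"
      unfolding 1(1) 2 .
    moreover have "hermite_fun k y = hermite_const k * poly P z * exp (- (y\<^sup>2) / 2)"
      by (simp add: hermite_fun_eq P_def poly_pcompose y_def mult.commute)
    ultimately have "s * (mehler_dt r x y * hermite_fun k y) = hermite_const k / sqrt pi * (poly Q z * poly P z) * (exp (y\<^sup>2 / 2 - x\<^sup>2 / 2 - z\<^sup>2) * exp (- (y\<^sup>2) / 2))"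
      using s(1) by (simp add: mult_ac)
    then show ?thesis unfolding 3 by (simp add: y_def mult_ac)
  qed
  have G: "gauss_integral (Q * P) = - (real k * (sqrt pi * r ^ k * poly (hermite_rec k) x))"
  proof -
    have dP: "pderiv P = smult s (pderiv (hermite_rec k) \<circ>\<^sub>p ?a)"
      by (simp add: P_def pderiv_pcompose pderiv_pCons)
    have dZ: "pderiv Z = smult 2 1" by (simp add: Z_def pderiv_pCons)
    have bp: "gauss_integral (Z * R) = gauss_integral (pderiv R)" for R
      unfolding Z_def by (rule gauss_integral_by_parts)
    \<comment> \<open>The term with P itself cancels the last summand of Q; only derivatives of P
      remain.\<close>
    have ZZ: "gauss_integral (Z * (Z * P)) = 2 * gauss_integral P + gauss_integral (pderiv (pderiv P))"
      unfolding bp pderiv_mult gauss_integral_add dZ by (simp add: gauss_integral_smult bp)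
    have "gauss_integral (Q * P) = r\<^sup>2 / (2 * s\<^sup>2) * gauss_integral (Z * (Z * P)) - r * x / s * gauss_integral (Z * P) - r\<^sup>2 / s\<^sup>2 * gauss_integral P"
      by (simp add: Q_def left_diff_distrib gauss_integral_diff gauss_integral_smult mult.assoc)
    also have "\<dots> = r\<^sup>2 / (2 * s\<^sup>2) * gauss_integral (pderiv (pderiv P)) - r * x / s * gauss_integral (pderiv P)"
      unfolding ZZ unfolding bp by (simp add: distrib_left)
    also have "\<dots> = - (real k * (sqrt pi * r ^ k * poly (hermite_rec k) x))"
    proof (cases k)
      case 0
      then show ?thesis by (simp add: dP)
    next
      case (Suc n)
      have d1: "pderiv P = smult (s * (2 * real k)) (hermite_rec n \<circ>\<^sub>p ?a)"
        unfolding dP by (simp only: Suc pderiv_hermite_rec_Suc pcompose_smult smult_smult)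
      have d2: "pderiv (pderiv P) = smult (s\<^sup>2 * (2 * real k)) (pderiv (hermite_rec n) \<circ>\<^sub>p ?a)"
        unfolding d1 by (simp add: pderiv_smult pderiv_pcompose pderiv_pCons power2_eq_square mult_ac)
      have g1: "gauss_integral (pderiv P) = s * (2 * real k) * (sqrt pi * r ^ n * poly (hermite_rec n) x)"
        unfolding d1 gauss_integral_smult gauss_integral_hermite_rec_affine[OF s(3)] ..
      have g2: "r * gauss_integral (pderiv (hermite_rec n) \<circ>\<^sub>p ?a) = sqrt pi * r ^ n * poly (pderiv (hermite_rec n)) x"
      proof (cases n)
        case (Suc m)
        then show ?thesis
          by (simp only: pderiv_hermite_rec_Suc pcompose_smult gauss_integral_smult gauss_integral_hermite_rec_affine[OF s(3)]) simp
      qed simp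
      have "r\<^sup>2 / (2 * s\<^sup>2) * gauss_integral (pderiv (pderiv P)) = r * real k * (r * gauss_integral (pderiv (hermite_rec n) \<circ>\<^sub>p ?a))"
        unfolding d2 gauss_integral_smult using s(1) by (simp add: power2_eq_square)
      also have "\<dots> = real k * (sqrt pi * r ^ k * poly (pderiv (hermite_rec n)) x)"
        unfolding g2 by (simp add: Suc)
      finally have A: "r\<^sup>2 / (2 * s\<^sup>2) * gauss_integral (pderiv (pderiv P)) = real k * (sqrt pi * r ^ k * poly (pderiv (hermite_rec n)) x)" .
      have B: "r * x / s * gauss_integral (pderiv P) = real k * (sqrt pi * r ^ k * (2 * x * poly (hermite_rec n) x))"
        unfolding g1 using s(1) by (simp add: Suc)
      have C: "poly (hermite_rec k) x = 2 * x * poly (hermite_rec n) x - poly (pderiv (hermite_rec n)) x"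
        by (simp add: Suc)
      show ?thesis unfolding A B C by (simp add: right_diff_distrib)
    qed
    finally show ?thesis .
  qed
  have "(\<integral>y. mehler_dt r x y * hermite_fun k y \<partial>lborel) = \<bar>s\<bar> *\<^sub>R (\<integral>z. mehler_dt r x (r * x + s * z) * hermite_fun k (r * x + s * z) \<partial>lborel)"
    using s(1) by (intro lborel_integral_real_affine) auto
  also have "\<dots> = (\<integral>z. s * (mehler_dt r x (r * x + s * z) * hermite_fun k (r * x + s * z)) \<partial>lborel)"
    using s(1) by simp
  also have "\<dots> = hermite_const k * exp (- (x\<^sup>2) / 2) / sqrt pi * gauss_integral (Q * P)"
    unfolding pt by (simp add: gauss_integral_def)
  also have "\<dots> = - (real k * r ^ k * hermite_fun k x)"
    unfolding G by (simp add: hermite_fun_eq)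
  finally show ?thesis .
qed

section \<open>The majorant of the kernel and its time integral\<close>

abbreviation heat_time :: "real \<Rightarrow> real \<Rightarrow> real \<Rightarrow> ennreal" where
  "heat_time \<sigma> z t \<equiv> ennreal (t powr (\<sigma> - 3 / 2) * exp (- (z\<^sup>2 / (16 * t)))) * indicator {0<..} t"

definition majorant :: "real \<Rightarrow> real \<Rightarrow> real" where
  "majorant \<sigma> z = \<bar>z\<bar> powr (2 * \<sigma> - 1) * exp (- (z\<^sup>2 / 16))"

lemma majorant_nonneg: "0 \<le> majorant \<sigma> z"
  by (simp add: majorant_def)

lemma borel_measurable_majorant [measurable]: "majorant \<sigma> \<in> borel_measurable borel"
  unfolding majorant_def by measurable

lemma powr_le_exp_square:
  fixes z :: real
  assumes "0 \<le> e" "e \<le> 1"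
  shows "\<bar>z\<bar> powr e \<le> 16 * exp (z\<^sup>2 / 16)"
proof -
  have "\<bar>z\<bar> powr e \<le> 1 + z\<^sup>2"
  proof (cases "\<bar>z\<bar> \<le> 1")
    case True
    then have "\<bar>z\<bar> powr e \<le> 1" using powr_mono2[of e "\<bar>z\<bar>" 1] assms by simp
    also have "\<dots> \<le> 1 + z\<^sup>2" by simp
    finally show ?thesis .
  next
    case False
    then have "\<bar>z\<bar> powr e \<le> \<bar>z\<bar> powr 2" using assms by (intro powr_mono) auto
    also have "\<dots> \<le> 1 + z\<^sup>2" by simp
    finally show ?thesis .
  qed
  also have "\<dots> \<le> 16 * exp (z\<^sup>2 / 16)" using exp_ge_add_one_self[of "z\<^sup>2 / 16"] zero_le_power2[of z] by linarith
  finally show ?thesis .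
qed

text \<open>The surplus power |z|^(2\<sigma> - \<theta>), with exponent between 0 and 1, is absorbed
  by the Gaussian. This is what admits a whole range of a + b instead of one homogeneous
  value.\<close>

lemma majorant_le_powr:
  assumes "0 \<le> \<theta>" "\<theta> \<le> 2 * \<sigma>" "\<sigma> \<le> 1 / 2"
  shows "majorant \<sigma> z \<le> 16 * \<bar>z\<bar> powr (\<theta> - 1)"
proof -
  have "majorant \<sigma> z = \<bar>z\<bar> powr (2 * \<sigma> - \<theta>) * (\<bar>z\<bar> powr (\<theta> - 1) * exp (- (z\<^sup>2 / 16)))"
    by (simp add: majorant_def powr_mult_powr[of "2 * \<sigma> - \<theta>" "\<theta> - 1" "2 * \<sigma> - 1"] flip: mult.assoc)
  also have "\<dots> \<le> (16 * exp (z\<^sup>2 / 16)) * (\<bar>z\<bar> powr (\<theta> - 1) * exp (- (z\<^sup>2 / 16)))"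
    using assms by (intro mult_right_mono powr_le_exp_square) auto
  also have "\<dots> = 16 * \<bar>z\<bar> powr (\<theta> - 1)" by (simp add: exp_minus)
  finally show ?thesis .
qed

text \<open>Near 0 the exponent exceeds -1 because \<sigma> > 0; at infinity the Gaussian is at most
  16/z^2.\<close>

lemma nn_integral_majorant:
  assumes "0 < \<sigma>" "\<sigma> < 1 / 2"
  shows "\<exists>N\<ge>0. (\<integral>\<^sup>+z. ennreal (majorant \<sigma> z) \<partial>lborel) \<le> ennreal N"
proof -
  have "(\<integral>\<^sup>+z. ennreal (majorant \<sigma> z) \<partial>lborel)
     \<le> (\<integral>\<^sup>+z. ennreal (\<bar>z\<bar> powr (2 * \<sigma> - 1)) * indicator {z. \<bar>z\<bar> < 1} z
          + 16 * (ennreal (\<bar>z\<bar> powr (- 2)) * indicator {z. 1 \<le> \<bar>z\<bar>} z) \<partial>lborel)"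
  proof (rule nn_integral_mono)
    fix z :: real
    show "ennreal (majorant \<sigma> z) \<le> ennreal (\<bar>z\<bar> powr (2 * \<sigma> - 1)) * indicator {z. \<bar>z\<bar> < 1} z
          + 16 * (ennreal (\<bar>z\<bar> powr (- 2)) * indicator {z. 1 \<le> \<bar>z\<bar>} z)"
    proof (cases "\<bar>z\<bar> < 1")
      case True
      then show ?thesis by (simp add: majorant_def mult_left_le ennreal_leI)
    next
      case False
      have "z\<^sup>2 / 16 \<le> exp (z\<^sup>2 / 16)" using exp_ge_add_one_self[of "z\<^sup>2 / 16"] by linarith
      then have "exp (- (z\<^sup>2 / 16)) \<le> 16 / z\<^sup>2" using False by (auto simp: exp_minus field_simps)
      moreover have "\<bar>z\<bar> powr (2 * \<sigma> - 1) \<le> 1"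
        using powr_mono[of "2 * \<sigma> - 1" 0 "\<bar>z\<bar>"] False assms by (auto split: if_splits)
      ultimately have "majorant \<sigma> z \<le> 1 * (16 / z\<^sup>2)"
        unfolding majorant_def by (intro mult_mono) auto
      also have "\<dots> = 16 * \<bar>z\<bar> powr (- 2)" using False by (simp add: powr_minus field_simps)
      finally show ?thesis using False by (simp add: ennreal_leI ennreal_mult[symmetric] flip: ennreal_numeral)
    qed
  qed
  also have "\<dots> = (\<integral>\<^sup>+z. ennreal (\<bar>z\<bar> powr (2 * \<sigma> - 1)) * indicator {z. \<bar>z\<bar> < 1} z \<partial>lborel)
          + 16 * (\<integral>\<^sup>+z. ennreal (\<bar>z\<bar> powr (- 2)) * indicator {z. 1 \<le> \<bar>z\<bar>} z \<partial>lborel)"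
    by (simp add: nn_integral_add nn_integral_cmult indicator_def)
  also have "\<dots> = ennreal (2 / (2 * \<sigma>) + 16 * 2)"
    using assms nn_integral_abs_powr_0[of "2 * \<sigma> - 1" 1] nn_integral_abs_powr_inf[of "- 2" 1]
    by (simp add: ennreal_plus[symmetric] ennreal_mult[symmetric] flip: ennreal_numeral del: ennreal_plus)
  finally show ?thesis using assms by (intro exI[of _ "2 / (2 * \<sigma>) + 16 * 2"]) auto
qed

text \<open>\<open>heat_time\<close> is what the bound for \<open>mehler_dt\<close> times t^\<sigma>
  leaves once e^{-z^2/16} is taken out. Scaling t = z^2 u extracts the power of |z|. The remaining
  integral converges at 0 by the exponential and at infinity because \<sigma> < 1/2.\<close>

lemma nn_integral_heat_time:
  assumes \<sigma>: "0 < \<sigma>" "\<sigma> < 1 / 2"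
  obtains J where "0 \<le> J" "\<And>z. z \<noteq> 0 \<Longrightarrow>
    (\<integral>\<^sup>+t. heat_time \<sigma> z t \<partial>lborel) \<le> ennreal (J * \<bar>z\<bar> powr (2 * \<sigma> - 1))"
proof -
  let ?g = "\<lambda>u. ennreal (u powr (\<sigma> - 3 / 2) * exp (- (1 / (16 * u)))) * indicator {0<..} u"
  define J where "J = 512 / (\<sigma> + 3 / 2) + 1 / (1 / 2 - \<sigma>)"
  have J0: "0 \<le> J" using \<sigma> by (simp add: J_def)
  have "(\<integral>\<^sup>+u. ?g u \<partial>lborel)
     \<le> (\<integral>\<^sup>+u. 512 * (ennreal (u powr (\<sigma> + 1 / 2)) * indicator {0<..<1} u) + ennreal (u powr (\<sigma> - 3 / 2)) * indicator {1..} u \<partial>lborel)"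
  proof (rule nn_integral_mono)
    fix u :: real
    show "?g u \<le> 512 * (ennreal (u powr (\<sigma> + 1 / 2)) * indicator {0<..<1} u) + ennreal (u powr (\<sigma> - 3 / 2)) * indicator {1..} u"
    proof (cases "0 < u")
      case True
      show ?thesis
      proof (cases "u < 1")
        case u1: True
        \<comment> \<open>From e^y \<ge> y^2/2 at y = 1/(16 u), so 512 = 2 * 16^2.\<close>
        have "exp (- (1 / (16 * u))) \<le> 512 * u powr 2"
        proof -
          define y where "y = 1 / (16 * u)"
          have y: "0 < y" using True by (simp add: y_def)
          have "y\<^sup>2 / 2 \<le> exp y" using exp_lower_Taylor_quadratic[of y] y by simp
          then have "exp (- y) \<le> 2 / y\<^sup>2" using y by (simp add: exp_minus field_simps)
          also have "\<dots> = 512 * u powr 2" using True by (simp add: y_def power_divide power_mult_distrib)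
          finally show ?thesis by (simp add: y_def)
        qed
        then have "u powr (\<sigma> - 3 / 2) * exp (- (1 / (16 * u))) \<le> u powr (\<sigma> - 3 / 2) * (512 * u powr 2)"
          by (rule mult_left_mono) simp
        also have "\<dots> = 512 * (u powr (\<sigma> - 3 / 2) * u powr 2)" by simp
        also have "u powr (\<sigma> - 3 / 2) * u powr 2 = u powr (\<sigma> + 1 / 2)" by (rule powr_mult_powr) simp
        finally show ?thesis using True u1 by (simp add: ennreal_leI ennreal_mult[symmetric] flip: ennreal_numeral)
      next
        case False
        with True show ?thesis by (simp add: ennreal_leI mult_left_le)
      qed
    qed simp
  qed
  also have "\<dots> = 512 * (\<integral>\<^sup>+u. ennreal (u powr (\<sigma> + 1 / 2)) * indicator {0<..<1} u \<partial>lborel) + (\<integral>\<^sup>+u. ennreal (u powr (\<sigma> - 3 / 2)) * indicator {1..} u \<partial>lborel)"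
    by (simp add: nn_integral_add nn_integral_cmult)
  also have "\<dots> = ennreal J"
    using \<sigma> nn_integral_powr_0[of "\<sigma> + 1 / 2" 1] nn_integral_powr_inf[of "\<sigma> - 3 / 2" 1]
    by (simp add: J_def ennreal_plus[symmetric] ennreal_mult[symmetric] flip: ennreal_numeral del: ennreal_plus)
  finally have J: "(\<integral>\<^sup>+u. ?g u \<partial>lborel) \<le> ennreal J" .
  have "(\<integral>\<^sup>+t. heat_time \<sigma> z t \<partial>lborel) \<le> ennreal (J * \<bar>z\<bar> powr (2 * \<sigma> - 1))"
    if z: "z \<noteq> 0" for z
  proof -
    have z2: "0 < z\<^sup>2" using z by simp
    have zz: "z\<^sup>2 = \<bar>z\<bar> powr 2" using z by simp
    have "(\<integral>\<^sup>+t. heat_time \<sigma> z t \<partial>lborel)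
      = ennreal \<bar>z\<^sup>2\<bar> * (\<integral>\<^sup>+u. ennreal ((0 + z\<^sup>2 * u) powr (\<sigma> - 3 / 2) * exp (- (z\<^sup>2 / (16 * (0 + z\<^sup>2 * u))))) * indicator {0<..} (0 + z\<^sup>2 * u) \<partial>lborel)"
      using z2 by (intro nn_integral_real_affine) auto
    also have "\<dots> = ennreal (z\<^sup>2) * (\<integral>\<^sup>+u. ennreal ((z\<^sup>2) powr (\<sigma> - 3 / 2)) * ?g u \<partial>lborel)"
    proof -
      have "ennreal ((0 + z\<^sup>2 * u) powr (\<sigma> - 3 / 2) * exp (- (z\<^sup>2 / (16 * (0 + z\<^sup>2 * u))))) * indicator {0<..} (0 + z\<^sup>2 * u)
          = ennreal ((z\<^sup>2) powr (\<sigma> - 3 / 2)) * ?g u" for u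
      proof -
        have e: "z\<^sup>2 / (16 * (0 + z\<^sup>2 * u)) = 1 / (16 * u)" using z by simp
        have i: "indicator {0<..} (0 + z\<^sup>2 * u) = (indicator {0<..} u :: ennreal)"
          using z2 by (simp add: indicator_def zero_less_mult_iff)
        show ?thesis unfolding e i by (simp only: add_0 powr_mult mult.assoc ennreal_mult'[OF powr_ge_zero])
      qed
      then show ?thesis using z2 by simp
    qed
    also have "\<dots> = ennreal (z\<^sup>2) * (ennreal ((z\<^sup>2) powr (\<sigma> - 3 / 2)) * (\<integral>\<^sup>+u. ?g u \<partial>lborel))"
      by (subst nn_integral_cmult) auto
    also have "\<dots> \<le> ennreal (z\<^sup>2) * (ennreal ((z\<^sup>2) powr (\<sigma> - 3 / 2)) * ennreal J)"
      by (intro mult_left_mono J) auto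
    also have "\<dots> = ennreal (J * (z\<^sup>2 * (z\<^sup>2) powr (\<sigma> - 3 / 2)))"
      using J0 by (simp add: ennreal_mult[symmetric] mult_ac)
    also have "z\<^sup>2 * (z\<^sup>2) powr (\<sigma> - 3 / 2) = \<bar>z\<bar> powr (2 * \<sigma> - 1)"
      unfolding zz powr_powr by (rule powr_mult_powr) simp
    finally show ?thesis .
  qed
  with J0 show thesis using that by blast
qed

section \<open>The multiplier kernel\<close>

text \<open>\<open>\<Psi> (max 0 t)\<close> agrees with \<Psi> t where the indicator is nonzero, and
  is measurable on the whole line.\<close>

abbreviation time_integrand :: "(real \<Rightarrow> real) \<Rightarrow> real \<Rightarrow> real \<Rightarrow> real \<Rightarrow> real" where
  "time_integrand \<Psi> x y t \<equiv> indicator {0<..} t * (mehler_dt (exp (- t)) x y * \<Psi> (max 0 t))"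

lemma borel_measurable_mehler_dt [measurable (raw)]:
  assumes [measurable]: "f \<in> borel_measurable M" "g \<in> borel_measurable M" "h \<in> borel_measurable M"
  shows "(\<lambda>w. mehler_dt (f w) (g w) (h w)) \<in> borel_measurable M"
  unfolding mehler_dt_def by measurable

text \<open>Since x^2/2 + y^2/2 \<ge> z^2/4, the product of the two Gaussians is at most e^{-z^2/8}.
  Half of this exponent pays for the missing power |z|^(1 - 2\<sigma>), the other half is the one in
  \<open>majorant\<close>. The diagonal is excluded because \<open>majorant \<sigma> 0\<close> is
  0.\<close>

lemma hermite_fun_0_mult_le:
  assumes \<sigma>: "0 < \<sigma>" "\<sigma> < 1 / 2" and "x \<noteq> y"
  shows "\<bar>hermite_fun 0 x * hermite_fun 0 y\<bar> \<le> 16 * majorant \<sigma> (x - y)"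
proof -
  define z where "z = x - y"
  have z: "z \<noteq> 0" using assms by (simp add: z_def)
  have "1 \<le> sqrt (sqrt pi)" using pi_gt3 by simp
  then have c: "0 \<le> hermite_const 0" "hermite_const 0 \<le> 1" by (auto simp: hermite_const_def)
  have "\<bar>hermite_fun 0 x * hermite_fun 0 y\<bar> = (hermite_const 0 * hermite_const 0) * (exp (- (x\<^sup>2) / 2) * exp (- (y\<^sup>2) / 2))"
    using c by (simp add: hermite_fun_eq abs_mult)
  also have "\<dots> \<le> 1 * exp (- (z\<^sup>2 / 8))"
  proof (intro mult_mono)
    have "z\<^sup>2 / 4 \<le> x\<^sup>2 / 2 + y\<^sup>2 / 2"
      using zero_le_power2[of "x + y"] by (simp add: z_def power2_eq_square field_simps)
    then have "z\<^sup>2 / 8 \<le> x\<^sup>2 / 2 + y\<^sup>2 / 2" using zero_le_power2[of z] by linarith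
    then show "exp (- (x\<^sup>2) / 2) * exp (- (y\<^sup>2) / 2) \<le> exp (- (z\<^sup>2 / 8))"
      by (simp flip: exp_add)
    show "hermite_const 0 * hermite_const 0 \<le> 1" using c by (simp add: mult_le_one)
  qed auto
  also have "\<dots> = (\<bar>z\<bar> powr (1 - 2 * \<sigma>) * exp (- (z\<^sup>2 / 16))) * majorant \<sigma> z"
  proof -
    have "\<bar>z\<bar> powr (1 - 2 * \<sigma>) * \<bar>z\<bar> powr (2 * \<sigma> - 1) = 1"
      using z powr_mult_powr[of "1 - 2 * \<sigma>" "2 * \<sigma> - 1" 0 "\<bar>z\<bar>"] by simp
    moreover have "exp (- (z\<^sup>2 / 8)) = exp (- (z\<^sup>2 / 16)) * exp (- (z\<^sup>2 / 16))" by (simp flip: exp_add)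
    moreover have "(P * e) * (R * e) = (P * R) * (e * e)" for P R e :: real by simp
    ultimately show ?thesis by (simp add: majorant_def)
  qed
  also have "\<dots> \<le> ((16 * exp (z\<^sup>2 / 16)) * exp (- (z\<^sup>2 / 16))) * majorant \<sigma> z"
    using \<sigma> by (intro mult_right_mono powr_le_exp_square majorant_nonneg) auto
  also have "\<dots> = 16 * majorant \<sigma> z" by (simp add: exp_minus)
  finally show ?thesis by (simp add: z_def)
qed

lemma nn_integral_majorant_mult_bounded:
  assumes \<sigma>: "0 < \<sigma>" "\<sigma> < 1 / 2"
    and [measurable]: "g \<in> borel_measurable borel" and g: "\<And>y. \<bar>g y\<bar> \<le> H"
  shows "(\<integral>\<^sup>+y. ennreal (B * majorant \<sigma> (x - y)) * ennreal \<bar>g y\<bar> \<partial>lborel) < \<infinity>"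
proof -
  obtain N where N: "(\<integral>\<^sup>+z. ennreal (majorant \<sigma> z) \<partial>lborel) \<le> ennreal N"
    using nn_integral_majorant[OF \<sigma>] by blast
  have H: "0 \<le> H" using g[of 0] by linarith
  have "(\<integral>\<^sup>+y. ennreal (B * majorant \<sigma> (x - y)) * ennreal \<bar>g y\<bar> \<partial>lborel)
    \<le> (\<integral>\<^sup>+y. ennreal (\<bar>B\<bar> * H) * ennreal (majorant \<sigma> (x - y)) \<partial>lborel)"
  proof (rule nn_integral_mono)
    fix y
    have "ennreal (B * majorant \<sigma> (x - y)) * ennreal \<bar>g y\<bar> \<le> ennreal (\<bar>B\<bar> * majorant \<sigma> (x - y)) * ennreal H"
      using g majorant_nonneg by (intro mult_mono ennreal_leI mult_right_mono) auto
    also have "\<dots> = ennreal (\<bar>B\<bar> * H) * ennreal (majorant \<sigma> (x - y))"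
      using H majorant_nonneg by (simp add: ennreal_mult[symmetric] mult_ac)
    finally show "ennreal (B * majorant \<sigma> (x - y)) * ennreal \<bar>g y\<bar> \<le> ennreal (\<bar>B\<bar> * H) * ennreal (majorant \<sigma> (x - y))" .
  qed
  also have "\<dots> = ennreal (\<bar>B\<bar> * H) * (\<integral>\<^sup>+z. ennreal (majorant \<sigma> z) \<partial>lborel)"
    using nn_integral_translate_reflect(1)[of "\<lambda>z. ennreal (majorant \<sigma> z)" x] by (simp add: nn_integral_cmult)
  also have "\<dots> \<le> ennreal (\<bar>B\<bar> * H) * ennreal N" by (intro mult_left_mono N) auto
  also have "\<dots> < \<infinity>" by (simp add: ennreal_mult_less_top)
  finally show ?thesis .
qed

lemma hermite_fun_bounded: "\<exists>H. \<forall>y. \<bar>hermite_fun k y\<bar> \<le> H"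
  using hermite_fun_decay[of 0 k] by simp

text \<open>The first term carries the multiplier at k = 0, which the t-derivative annihilates. The
  minus sign cancels that of d/dt e^{-kt} = -k e^{-kt}.\<close>

definition multiplier_kernel :: "(real \<Rightarrow> real) \<Rightarrow> real \<Rightarrow> real \<Rightarrow> real \<Rightarrow> real" where
  "multiplier_kernel \<Psi> L x y = L * hermite_fun 0 x * hermite_fun 0 y
     - (\<integral>t. time_integrand \<Psi> x y t \<partial>lborel)"

context
  fixes \<Psi> :: "real \<Rightarrow> real" and \<sigma> C L :: real
  assumes BV: "bounded_variation_on \<Psi> {0..}"
    and \<sigma>: "0 < \<sigma>" "\<sigma> < 1 / 2"
    and C: "0 \<le> C" "\<And>t. 0 \<le> t \<Longrightarrow> \<bar>\<Psi> t\<bar> \<le> C * t powr \<sigma>"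
    and L: "(\<Psi> \<longlongrightarrow> L) at_top"
begin

lemma borel_measurable_multiplier_kernel [measurable]:
  "case_prod (multiplier_kernel \<Psi> L) \<in> borel_measurable (borel \<Otimes>\<^sub>M borel)"
proof -
  note [measurable] = bounded_variation_measurable[OF BV]
  show ?thesis
    unfolding multiplier_kernel_def[abs_def] case_prod_unfold
    by measurable
qed

text \<open>The bounds for \<open>mehler_dt\<close> and \<Psi> multiply to \<open>heat_time\<close>
  times e^{-z^2/16}. On the diagonal the bound would be the divergent integral of t^(\<sigma> -
  3/2), so x \<noteq> y is required.\<close>

lemma mehler_dt_time_integral:
  obtains B where "0 \<le> B" "\<And>x y. x \<noteq> y \<Longrightarrow>
    (\<integral>\<^sup>+t. ennreal \<bar>time_integrand \<Psi> x y t\<bar> \<partial>lborel) \<le> ennreal (B * majorant \<sigma> (x - y))"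
proof -
  obtain J where J: "0 \<le> J" "\<And>z. z \<noteq> 0 \<Longrightarrow>
    (\<integral>\<^sup>+t. heat_time \<sigma> z t \<partial>lborel) \<le> ennreal (J * \<bar>z\<bar> powr (2 * \<sigma> - 1))"
    using nn_integral_heat_time[OF \<sigma>] by blast
  show thesis
  proof (rule that[of "384 * C * J"])
    show "0 \<le> 384 * C * J" using C J by simp
    fix x y :: real assume "x \<noteq> y"
    define z where "z = x - y"
    have z: "z \<noteq> 0" using \<open>x \<noteq> y\<close> by (simp add: z_def)
    have "(\<integral>\<^sup>+t. ennreal \<bar>time_integrand \<Psi> x y t\<bar> \<partial>lborel)
      \<le> (\<integral>\<^sup>+t. ennreal (384 * C * exp (- (z\<^sup>2 / 16))) * (heat_time \<sigma> z t) \<partial>lborel)"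
    proof (rule nn_integral_mono)
      fix t :: real
      show "ennreal \<bar>time_integrand \<Psi> x y t\<bar>
        \<le> ennreal (384 * C * exp (- (z\<^sup>2 / 16))) * (heat_time \<sigma> z t)"
      proof (cases "0 < t")
        case True
        have "\<bar>mehler_dt (exp (- t)) x y\<bar> * \<bar>\<Psi> t\<bar>
          \<le> (384 * (t powr (- 3 / 2) * exp (- (z\<^sup>2 / (16 * t))) * exp (- (z\<^sup>2 / 16)))) * (C * t powr \<sigma>)"
          unfolding z_def using True C by (intro mult_mono mehler_dt_bound) auto
        also have "\<dots> = 384 * C * exp (- (z\<^sup>2 / 16)) * ((t powr \<sigma> * t powr (- 3 / 2)) * exp (- (z\<^sup>2 / (16 * t))))"
          by (simp only: mult_ac)
        also have "t powr \<sigma> * t powr (- 3 / 2) = t powr (\<sigma> - 3 / 2)" by (rule powr_mult_powr) simp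
        finally show ?thesis using True C by (simp add: abs_mult ennreal_mult[symmetric] ennreal_leI)
      qed simp
    qed
    also have "\<dots> = ennreal (384 * C * exp (- (z\<^sup>2 / 16))) * (\<integral>\<^sup>+t. heat_time \<sigma> z t \<partial>lborel)"
      by (rule nn_integral_cmult) measurable
    also have "\<dots> \<le> ennreal (384 * C * exp (- (z\<^sup>2 / 16))) * ennreal (J * \<bar>z\<bar> powr (2 * \<sigma> - 1))"
      by (intro mult_left_mono J z) auto
    also have "\<dots> = ennreal (384 * C * J * majorant \<sigma> z)"
      using C J by (simp add: majorant_def ennreal_mult[symmetric] mult_ac)
    finally show "(\<integral>\<^sup>+t. ennreal \<bar>time_integrand \<Psi> x y t\<bar> \<partial>lborel)
       \<le> ennreal (384 * C * J * majorant \<sigma> (x - y))"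
      by (simp add: z_def)
  qed
qed

lemma multiplier_kernel_bound:
  obtains B where "0 \<le> B" "\<And>x y. x \<noteq> y \<Longrightarrow> \<bar>multiplier_kernel \<Psi> L x y\<bar> \<le> B * majorant \<sigma> (x - y)"
proof -
  obtain B where B: "0 \<le> B" "\<And>x y. x \<noteq> y \<Longrightarrow>
    (\<integral>\<^sup>+t. ennreal \<bar>time_integrand \<Psi> x y t\<bar> \<partial>lborel) \<le> ennreal (B * majorant \<sigma> (x - y))"
    using mehler_dt_time_integral by blast
  show thesis
  proof (rule that[of "\<bar>L\<bar> * 16 + B"])
    show "0 \<le> \<bar>L\<bar> * 16 + B" using B by simp
    fix x y :: real assume xy: "x \<noteq> y"
    let ?g = "\<lambda>t. time_integrand \<Psi> x y t"
    note [measurable] = bounded_variation_measurable[OF BV]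
    have "integrable lborel ?g"
      using B(2)[OF xy] by (intro integrableI_bounded) (auto simp: less_top[symmetric] top_unique intro: order.strict_trans1)
    then have "ennreal (norm (\<integral>t. ?g t \<partial>lborel)) \<le> (\<integral>\<^sup>+t. ennreal (norm (?g t)) \<partial>lborel)"
      by (rule integral_norm_bound_ennreal)
    also have "\<dots> \<le> ennreal (B * majorant \<sigma> (x - y))" using B(2)[OF xy] by simp
    finally have "\<bar>\<integral>t. ?g t \<partial>lborel\<bar> \<le> B * majorant \<sigma> (x - y)"
      using B(1) majorant_nonneg by simp
    moreover have "\<bar>L * hermite_fun 0 x * hermite_fun 0 y\<bar> \<le> \<bar>L\<bar> * (16 * majorant \<sigma> (x - y))"
      using mult_left_mono[OF hermite_fun_0_mult_le[OF \<sigma> xy], of "\<bar>L\<bar>"] by (simp add: abs_mult mult.assoc)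
    ultimately show "\<bar>multiplier_kernel \<Psi> L x y\<bar> \<le> (\<bar>L\<bar> * 16 + B) * majorant \<sigma> (x - y)"
      unfolding multiplier_kernel_def by (simp add: distrib_right)
  qed
qed

lemma integrable_multiplier_kernel_hermite_fun:
  "integrable lborel (\<lambda>y. multiplier_kernel \<Psi> L x y * hermite_fun k y)"
proof -
  obtain B where B: "0 \<le> B" "\<And>x y. x \<noteq> y \<Longrightarrow> \<bar>multiplier_kernel \<Psi> L x y\<bar> \<le> B * majorant \<sigma> (x - y)"
    using multiplier_kernel_bound by blast
  obtain H where H: "\<And>y. \<bar>hermite_fun k y\<bar> \<le> H" using hermite_fun_bounded by blast
  have "(\<integral>\<^sup>+y. ennreal (norm (multiplier_kernel \<Psi> L x y * hermite_fun k y)) \<partial>lborel)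
     \<le> (\<integral>\<^sup>+y. ennreal (B * majorant \<sigma> (x - y)) * ennreal \<bar>hermite_fun k y\<bar> \<partial>lborel)"
    by (rule nn_integral_mono_AE, use AE_lborel_singleton[of x] in eventually_elim)
      (use B majorant_nonneg in \<open>auto simp: abs_mult ennreal_mult[symmetric] intro!: ennreal_leI mult_right_mono\<close>)
  also have "\<dots> < \<infinity>" using H by (intro nn_integral_majorant_mult_bounded \<sigma>) auto
  finally show ?thesis by (intro integrableI_bounded) auto
qed

text \<open>Exchanging the integrals in y and t reduces the claim to the action of
  \<open>mehler_dt\<close> on one Hermite function; the t-integral that is left is the one in
  \<open>stieltjes_integral_exp\<close>. Orthonormality accounts for the first term of the
  kernel.\<close>

lemma integral_multiplier_kernel_hermite_fun:
  "(\<integral>y. multiplier_kernel \<Psi> L x y * hermite_fun k y \<partial>lborel)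
    = stieltjes_integral (\<lambda>t. exp (- (real k * t))) \<Psi> * hermite_fun k x"
proof -
  note [measurable] = bounded_variation_measurable[OF BV]
  obtain B where B: "0 \<le> B" "\<And>x y. x \<noteq> y \<Longrightarrow>
    (\<integral>\<^sup>+t. ennreal \<bar>time_integrand \<Psi> x y t\<bar> \<partial>lborel) \<le> ennreal (B * majorant \<sigma> (x - y))"
    using mehler_dt_time_integral by blast
  obtain H where H: "\<And>y. \<bar>hermite_fun k y\<bar> \<le> H" using hermite_fun_bounded by blast
  define g where "g y t = time_integrand \<Psi> x y t * hermite_fun k y" for y t
  have [measurable]: "case_prod g \<in> borel_measurable (borel \<Otimes>\<^sub>M borel)"
    unfolding g_def[abs_def] case_prod_unfold by measurable
  \<comment> \<open>Absolute integrability on the product justifies the exchange; the exceptional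
    line y = x is a null set.\<close>
  have g_int: "integrable (lborel \<Otimes>\<^sub>M lborel) (case_prod g)"
  proof (rule integrableI_bounded)
    have "(\<integral>\<^sup>+w. ennreal (norm (case_prod g w)) \<partial>(lborel \<Otimes>\<^sub>M lborel)) = (\<integral>\<^sup>+y. \<integral>\<^sup>+t. ennreal \<bar>g y t\<bar> \<partial>lborel \<partial>lborel)"
      by (subst lborel.nn_integral_fst[symmetric]) (auto simp: case_prod_unfold)
    also have "\<dots> \<le> (\<integral>\<^sup>+y. ennreal (B * majorant \<sigma> (x - y)) * ennreal \<bar>hermite_fun k y\<bar> \<partial>lborel)"
    proof (rule nn_integral_mono_AE, use AE_lborel_singleton[of x] in eventually_elim)
      case (elim y)
      have "(\<integral>\<^sup>+t. ennreal \<bar>g y t\<bar> \<partial>lborel) = (\<integral>\<^sup>+t. ennreal \<bar>time_integrand \<Psi> x y t\<bar> * ennreal \<bar>hermite_fun k y\<bar> \<partial>lborel)"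
        by (intro nn_integral_cong) (simp add: g_def abs_mult[of _ "hermite_fun k y"] ennreal_mult)
      also have "\<dots> = (\<integral>\<^sup>+t. ennreal \<bar>time_integrand \<Psi> x y t\<bar> \<partial>lborel) * ennreal \<bar>hermite_fun k y\<bar>"
        by (rule nn_integral_multc) measurable
      also have "\<dots> \<le> ennreal (B * majorant \<sigma> (x - y)) * ennreal \<bar>hermite_fun k y\<bar>"
        using elim by (intro mult_right_mono B) auto
      finally show ?case .
    qed
    also have "\<dots> < \<infinity>" using H by (intro nn_integral_majorant_mult_bounded \<sigma>) auto
    finally show "(\<integral>\<^sup>+w. ennreal (norm (case_prod g w)) \<partial>(lborel \<Otimes>\<^sub>M lborel)) < \<infinity>" .
  qed simp
  have K: "multiplier_kernel \<Psi> L x y * hermite_fun k y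
     = L * hermite_fun 0 x * (hermite_fun 0 y * hermite_fun k y) - (\<integral>t. g y t \<partial>lborel)" for y
    by (simp add: multiplier_kernel_def g_def left_diff_distrib)
  have "integrable lborel (\<lambda>y. \<integral>t. g y t \<partial>lborel)"
    using lborel_pair.integrable_fst'[OF g_int] by simp
  then have "(\<integral>y. multiplier_kernel \<Psi> L x y * hermite_fun k y \<partial>lborel)
     = L * hermite_fun 0 x * (if k = 0 then 1 else 0) - (\<integral>y. \<integral>t. g y t \<partial>lborel \<partial>lborel)"
    unfolding K using hermite_fun_orthonormal[of 0 k]
    by (subst Bochner_Integration.integral_diff) auto
  also have "(\<integral>y. \<integral>t. g y t \<partial>lborel \<partial>lborel) = (\<integral>t. \<integral>y. g y t \<partial>lborel \<partial>lborel)"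
    using lborel_pair.Fubini_integral[OF g_int] by simp
  also have "\<dots> = (\<integral>t. - (real k * hermite_fun k x) * (indicator {0..} t *\<^sub>R (exp (- (real k * t)) * \<Psi> t)) \<partial>lborel)"
  proof (rule integral_cong_AE)
    show "AE t in lborel. (\<integral>y. g y t \<partial>lborel) = - (real k * hermite_fun k x) * (indicator {0..} t *\<^sub>R (exp (- (real k * t)) * \<Psi> t))"
      using AE_lborel_singleton[of 0]
    proof eventually_elim
      case (elim t)
      show ?case
      proof (cases "0 < t")
        case True
        have "(\<integral>y. g y t \<partial>lborel) = (\<integral>y. \<Psi> t * (mehler_dt (exp (- t)) x y * hermite_fun k y) \<partial>lborel)"
          using True by (intro Bochner_Integration.integral_cong) (auto simp: g_def)
        also have "\<dots> = \<Psi> t * - (real k * exp (- t) ^ k * hermite_fun k x)"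
          using True by (simp add: integral_mehler_dt_hermite_fun)
        also have "exp (- t) ^ k = exp (- (real k * t))" by (simp flip: exp_of_nat_mult)
        finally show ?thesis using True by simp
      qed (use elim in \<open>simp add: g_def\<close>)
    qed
    have "(\<lambda>t. - (real k * hermite_fun k x) * (indicator {0..} t *\<^sub>R (exp (- (real k * t)) * \<Psi> t)))
        = (\<lambda>t. - (real k * hermite_fun k x) * (indicator {0..} t *\<^sub>R (exp (- (real k * t)) * \<Psi> (max 0 t))))"
      by (auto simp: indicator_def)
    moreover have "(\<lambda>t. - (real k * hermite_fun k x) * (indicator {0..} t *\<^sub>R (exp (- (real k * t)) * \<Psi> (max 0 t)))) \<in> borel_measurable lborel"
      by measurable
    ultimately show "(\<lambda>t. - (real k * hermite_fun k x) * (indicator {0..} t *\<^sub>R (exp (- (real k * t)) * \<Psi> t))) \<in> borel_measurable lborel"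
      by (simp only:)
  qed measurable
  also have "\<dots> = - (real k * hermite_fun k x) * (LINT t:{0..}|lborel. exp (- (real k * t)) * \<Psi> t)"
    unfolding set_lebesgue_integral_def by (rule integral_mult_right_zero)
  finally have "(\<integral>y. multiplier_kernel \<Psi> L x y * hermite_fun k y \<partial>lborel) =
     L * hermite_fun 0 x * (if k = 0 then 1 else 0) + (real k * hermite_fun k x) * (LINT t:{0..}|lborel. exp (- (real k * t)) * \<Psi> t)"
    by simp
  \<comment> \<open>The growth bound at t = 0 reads |\<Psi> 0| \<le> 0, as
    \<open>0 powr \<sigma>\<close> is 0.\<close>
  moreover have "\<Psi> 0 = 0" using C(2)[of 0] by simp
  ultimately show ?thesis by (simp add: stieltjes_integral_exp[OF BV _ L])
qed

end

section \<open>From kernel bounds to operators between weighted spaces\<close>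

abbreviation hermite_sum :: "nat \<Rightarrow> (nat \<Rightarrow> complex) \<Rightarrow> real \<Rightarrow> complex" where
  "hermite_sum n d \<equiv> \<lambda>x. \<Sum>k<n. d k * complex_of_real (hermite_fun k x)"

text \<open>Homogeneity: apply the bound to F divided by N^(1/p). For N = 0 this is impossible, but
  then F vanishes almost everywhere.\<close>

lemma kernel_bound_scaled:
  assumes K: "kernel_bound p q K C" and p: "0 < p" "0 < q"
    and [measurable]: "F \<in> borel_measurable borel" and F: "\<And>x. 0 \<le> F x" "0 \<le> N"
    "lp_integral p F \<le> ennreal N"
    and measK [measurable]: "case_prod K \<in> borel_measurable (borel \<Otimes>\<^sub>M borel)"
  shows "(\<integral>\<^sup>+x. epowr (\<integral>\<^sup>+y. ennreal (K x y * F y) \<partial>lborel) q \<partial>lborel) \<le> ennreal (N powr (q / p) * \<bar>C\<bar>)"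
proof (cases "N = 0")
  case True
  then have "lp_integral p F = 0" using F(3) by simp
  then have "AE y in lborel. ennreal (F y powr p) = 0" by (subst (asm) nn_integral_0_iff_AE) auto
  then have F0: "AE y in lborel. F y = 0" by eventually_elim simp
  have "(\<integral>\<^sup>+y. ennreal (K x y * F y) \<partial>lborel) = 0" for x
  proof -
    have "(\<integral>\<^sup>+y. ennreal (K x y * F y) \<partial>lborel) = (\<integral>\<^sup>+y. 0 \<partial>(lborel :: real measure))"
      by (rule nn_integral_cong_AE, use F0 in eventually_elim) simp
    then show ?thesis by simp
  qed
  then show ?thesis using p by (simp add: epowr_def)
next
  case False
  define s where "s = N powr (1 / p)"
  have s: "0 < s" "s powr p = N" using False F p by (auto simp: s_def powr_powr)
  have [measurable]: "K x \<in> borel_measurable borel" for x by measurable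
  have "(\<integral>\<^sup>+y. ennreal ((F y / s) powr p) \<partial>lborel) = (\<integral>\<^sup>+y. ennreal (1 / N) * ennreal (F y powr p) \<partial>lborel)"
    using s F(1,2) by (intro nn_integral_cong) (simp add: powr_divide ennreal_mult[symmetric])
  also have "\<dots> = ennreal (1 / N) * lp_integral p F"
    by (rule nn_integral_cmult) measurable
  also have "\<dots> \<le> ennreal (1 / N) * ennreal N" by (intro mult_left_mono F) auto
  also have "\<dots> = 1" using False F(2) by (simp add: ennreal_mult[symmetric])
  finally have "(\<integral>\<^sup>+x. epowr (\<integral>\<^sup>+y. ennreal (K x y * (F y / s)) \<partial>lborel) q \<partial>lborel) \<le> ennreal C"
    using F s by (intro kernel_boundD[OF K]) auto
  then have le: "ennreal (s powr q) * (\<integral>\<^sup>+x. epowr (\<integral>\<^sup>+y. ennreal (K x y * (F y / s)) \<partial>lborel) q \<partial>lborel) \<le> ennreal (s powr q) * ennreal C"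
    by (rule mult_left_mono) simp
  have "epowr (\<integral>\<^sup>+y. ennreal (K x y * F y) \<partial>lborel) q = ennreal (s powr q) * epowr (\<integral>\<^sup>+y. ennreal (K x y * (F y / s)) \<partial>lborel) q" for x
  proof -
    have "(\<integral>\<^sup>+y. ennreal (K x y * F y) \<partial>lborel) = (\<integral>\<^sup>+y. ennreal s * ennreal (K x y * (F y / s)) \<partial>lborel)"
      using s by (intro nn_integral_cong) (simp flip: ennreal_mult')
    also have "\<dots> = ennreal s * (\<integral>\<^sup>+y. ennreal (K x y * (F y / s)) \<partial>lborel)"
      by (rule nn_integral_cmult) measurable
    finally show ?thesis using s by (simp add: epowr_mult)
  qed
  then have "(\<integral>\<^sup>+x. epowr (\<integral>\<^sup>+y. ennreal (K x y * F y) \<partial>lborel) q \<partial>lborel)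
    = ennreal (s powr q) * (\<integral>\<^sup>+x. epowr (\<integral>\<^sup>+y. ennreal (K x y * (F y / s)) \<partial>lborel) q \<partial>lborel)"
    by (simp add: nn_integral_cmult)
  also note le
  also have "ennreal (s powr q) * ennreal C = ennreal (s powr q * C)" by (simp add: ennreal_mult')
  also have "\<dots> \<le> ennreal (N powr (q / p) * \<bar>C\<bar>)"
    by (intro ennreal_leI) (auto simp: s_def powr_powr intro: mult_left_mono)
  finally show ?thesis .
qed

text \<open>The weight is integrable near 0 because c > -1, and at infinity Hermite functions decay
  faster than any power.\<close>

lemma hermite_span_weighted_Lp:
  assumes r: "1 < r" and c: "- 1 < c"
  shows "(hermite_sum n d) \<in> weighted_Lp r (\<lambda>x. \<bar>x\<bar> powr c)"
proof -
  define f where "f x = (\<Sum>k<n. d k * complex_of_real (hermite_fun k x))" for x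
  have [measurable]: "f \<in> borel_measurable borel" unfolding f_def by measurable
  \<comment> \<open>Large enough that the decay |x|^(-m r) leaves at most |x|^(-2) after
    multiplication by the weight.\<close>
  obtain m :: nat where m: "\<bar>c\<bar> + 2 \<le> real m" using real_arch_simple by blast
  have decay: "\<exists>D\<ge>0. \<forall>x. \<bar>x\<bar> ^ j * norm (f x) \<le> D" for j
  proof -
    obtain D where D: "\<And>k x. \<bar>x\<bar> ^ j * \<bar>hermite_fun k x\<bar> \<le> D k" using hermite_fun_decay by metis
    have "\<bar>x\<bar> ^ j * norm (f x) \<le> (\<Sum>k<n. norm (d k) * D k)" for x
    proof -
      have "\<bar>x\<bar> ^ j * norm (f x) \<le> \<bar>x\<bar> ^ j * (\<Sum>k<n. norm (d k) * \<bar>hermite_fun k x\<bar>)"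
        unfolding f_def by (intro mult_left_mono order_trans[OF norm_sum] sum_mono) (auto simp: norm_mult)
      also have "\<dots> = (\<Sum>k<n. norm (d k) * (\<bar>x\<bar> ^ j * \<bar>hermite_fun k x\<bar>))"
        by (simp add: sum_distrib_left mult_ac)
      also have "\<dots> \<le> (\<Sum>k<n. norm (d k) * D k)" by (intro sum_mono mult_left_mono D) auto
      finally show ?thesis .
    qed
    moreover have "0 \<le> D k" for k by (rule order_trans[OF _ D[of 0 k]]) simp
    then have "0 \<le> (\<Sum>k<n. norm (d k) * D k)" by (intro sum_nonneg mult_nonneg_nonneg) auto
    ultimately show ?thesis by blast
  qed
  obtain D0 where D0: "0 \<le> D0" "\<And>x. norm (f x) \<le> D0" using decay[of 0] by auto
  obtain D1 where D1: "0 \<le> D1" "\<And>x. \<bar>x\<bar> ^ m * norm (f x) \<le> D1" using decay[of m] by auto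
  have "(\<integral>\<^sup>+x. ennreal (norm (f x) powr r * \<bar>x\<bar> powr c) \<partial>lborel)
    \<le> (\<integral>\<^sup>+x. ennreal (D0 powr r) * (ennreal (\<bar>x\<bar> powr c) * indicator {x. \<bar>x\<bar> < 1} x)
         + ennreal (D1 powr r) * (ennreal (\<bar>x\<bar> powr (- 2)) * indicator {x. 1 \<le> \<bar>x\<bar>} x) \<partial>lborel)"
  proof (rule nn_integral_mono)
    fix x :: real
    show "ennreal (norm (f x) powr r * \<bar>x\<bar> powr c) \<le> ennreal (D0 powr r) * (ennreal (\<bar>x\<bar> powr c) * indicator {x. \<bar>x\<bar> < 1} x)
         + ennreal (D1 powr r) * (ennreal (\<bar>x\<bar> powr (- 2)) * indicator {x. 1 \<le> \<bar>x\<bar>} x)"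
    proof (cases "\<bar>x\<bar> < 1")
      case True
      have "norm (f x) powr r * \<bar>x\<bar> powr c \<le> D0 powr r * \<bar>x\<bar> powr c"
        using D0 r by (intro mult_right_mono powr_mono2) auto
      then show ?thesis using True by (simp add: ennreal_mult[symmetric] ennreal_leI)
    next
      case False
      then have x: "1 \<le> \<bar>x\<bar>" by simp
      have "\<bar>x\<bar> powr (c + 2) \<le> \<bar>x\<bar> powr (real m * r)"
      proof (rule powr_mono[OF _ x])
        have "c + 2 \<le> real m * 1" using m by simp
        also have "\<dots> \<le> real m * r" using r by (intro mult_left_mono) auto
        finally show "c + 2 \<le> real m * r" .
      qed
      also have "\<dots> = (\<bar>x\<bar> ^ m) powr r" using x by (subst powr_powr[symmetric]) (simp add: powr_realpow)
      finally have "norm (f x) powr r * \<bar>x\<bar> powr (c + 2) \<le> norm (f x) powr r * (\<bar>x\<bar> ^ m) powr r"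
        by (rule mult_left_mono) simp
      also have "\<dots> = (\<bar>x\<bar> ^ m * norm (f x)) powr r" by (simp add: powr_mult mult.commute)
      also have "\<dots> \<le> D1 powr r" using D1 r by (intro powr_mono2) auto
      finally have "norm (f x) powr r * \<bar>x\<bar> powr (c + 2) * \<bar>x\<bar> powr (- 2) \<le> D1 powr r * \<bar>x\<bar> powr (- 2)"
        by (rule mult_right_mono) simp
      moreover have "\<bar>x\<bar> powr (c + 2) * \<bar>x\<bar> powr (- 2) = \<bar>x\<bar> powr c" by (rule powr_mult_powr) simp
      ultimately have "norm (f x) powr r * \<bar>x\<bar> powr c \<le> D1 powr r * \<bar>x\<bar> powr (- 2)" by (simp only: mult.assoc)
      then show ?thesis using x False by (simp add: ennreal_mult[symmetric] ennreal_leI)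
    qed
  qed
  also have "\<dots> = ennreal (D0 powr r) * (\<integral>\<^sup>+x. ennreal (\<bar>x\<bar> powr c) * indicator {x. \<bar>x\<bar> < 1} x \<partial>lborel)
         + ennreal (D1 powr r) * (\<integral>\<^sup>+x. ennreal (\<bar>x\<bar> powr (- 2)) * indicator {x. 1 \<le> \<bar>x\<bar>} x \<partial>lborel)"
    by (subst nn_integral_add) (auto simp: nn_integral_cmult indicator_def)
  also have "\<dots> < \<infinity>"
    using c by (simp add: nn_integral_abs_powr_0 nn_integral_abs_powr_inf ennreal_mult_less_top)
  finally have "integrable lborel (\<lambda>x. norm (f x) powr r * \<bar>x\<bar> powr c)"
    by (intro integrableI_bounded) auto
  then show ?thesis by (simp add: weighted_Lp_def f_def[abs_def, symmetric])
qed

lemma hermite_coeff_hermite_span: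
  "hermite_coeff k (hermite_sum n d) = (if k < n then d k else 0)"
proof -
  have "hermite_coeff k (hermite_sum n d)
     = (\<integral>x. (\<Sum>j<n. d j * complex_of_real (hermite_fun j x * hermite_fun k x)) \<partial>lborel)"
    by (simp add: hermite_coeff_def sum_distrib_right mult.assoc)
  also have "\<dots> = (\<Sum>j<n. d j * (\<integral>x. complex_of_real (hermite_fun j x * hermite_fun k x) \<partial>lborel))"
    using hermite_fun_orthonormal(1) by (subst Bochner_Integration.integral_sum) (auto simp del: of_real_mult)
  also have "\<dots> = (\<Sum>j<n. if k = j then d j else 0)"
    by (intro sum.cong) (auto simp: hermite_fun_orthonormal simp del: of_real_mult)
  also have "\<dots> = (if k < n then d k else 0)" by simp
  finally show ?thesis .
qed

lemma hermite_multiplier_hermite_span: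
  "hermite_multiplier m (hermite_sum n d)
     = (\<lambda>x. \<Sum>k<n. (d k * of_real (m k)) * complex_of_real (hermite_fun k x))"
proof
  fix x
  show "hermite_multiplier m (hermite_sum n d) x
     = (\<Sum>k<n. (d k * of_real (m k)) * complex_of_real (hermite_fun k x))"
    unfolding hermite_multiplier_def hermite_coeff_hermite_span
    by (subst suminf_finite[of "{..<n}"]) auto
qed

text \<open>All estimates are made for the integral I x of the absolute values. Its weighted L^q
  bound gives both the almost everywhere convergence of the integral defining T and the norm
  inequality.\<close>

lemma weighted_operator_bound:
  fixes K :: "real \<Rightarrow> real \<Rightarrow> real" and f :: "real \<Rightarrow> complex"
  assumes C: "kernel_bound p q (\<lambda>x y. weighted a b k x y) C"
    and p: "1 < p" "p \<le> q"
    and [measurable]: "k \<in> borel_measurable borel" "case_prod K \<in> borel_measurable (borel \<Otimes>\<^sub>M borel)"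
    and K: "\<And>x y. x \<noteq> y \<Longrightarrow> \<bar>K x y\<bar> \<le> B * k (x - y)" and k: "\<And>z. 0 \<le> k z" and B: "0 \<le> B"
    and f: "f \<in> weighted_Lp p (\<lambda>x. \<bar>x\<bar> powr (a * p))"
  defines "T \<equiv> \<lambda>x. \<integral>y. of_real (K x y) * f y \<partial>lborel"
  shows "AE x in lborel. integrable lborel (\<lambda>y. of_real (K x y) * f y)"
    and "T \<in> weighted_Lp q (\<lambda>x. \<bar>x\<bar> powr (- b * q))"
    and "weighted_Lp_norm q (\<lambda>x. \<bar>x\<bar> powr (- b * q)) T
      \<le> (B powr q * \<bar>C\<bar>) powr (1 / q) * weighted_Lp_norm p (\<lambda>x. \<bar>x\<bar> powr (a * p)) f"
proof -
  have [measurable]: "f \<in> borel_measurable borel" using f by (simp add: weighted_Lp_def)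
  have [measurable]: "K x \<in> borel_measurable borel" for x by measurable
  define N where "N = (\<integral>x. norm (f x) powr p * \<bar>x\<bar> powr (a * p) \<partial>lborel)"
  have N0: "0 \<le> N" unfolding N_def by (intro integral_nonneg_AE) auto
  have N: "(\<integral>\<^sup>+x. ennreal (norm (f x) powr p * \<bar>x\<bar> powr (a * p)) \<partial>lborel) = ennreal N"
    unfolding N_def using f by (intro nn_integral_eq_integral) (auto simp: weighted_Lp_def)
  define F where "F y = \<bar>y\<bar> powr a * norm (f y)" for y
  have [measurable]: "F \<in> borel_measurable borel" unfolding F_def by measurable
  have "F y powr p = norm (f y) powr p * \<bar>y\<bar> powr (a * p)" for y
    by (simp add: F_def powr_mult powr_powr mult.commute)
  then have F: "lp_integral p F \<le> ennreal N" using N by simp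
  define I where "I x = (\<integral>\<^sup>+y. ennreal (\<bar>K x y\<bar> * norm (f y)) \<partial>lborel)" for x
  have [measurable]: "I \<in> borel_measurable borel" unfolding I_def by measurable
  have I_le: "ennreal (\<bar>x\<bar> powr (- b)) * I x
     \<le> ennreal B * (\<integral>\<^sup>+y. ennreal (weighted a b k x y * F y) \<partial>lborel)" for x
  proof -
    have "ennreal (\<bar>x\<bar> powr (- b)) * I x = (\<integral>\<^sup>+y. ennreal (\<bar>x\<bar> powr (- b)) * ennreal (\<bar>K x y\<bar> * norm (f y)) \<partial>lborel)"
      unfolding I_def by (rule nn_integral_cmult[symmetric]) measurable
    also have "\<dots> \<le> (\<integral>\<^sup>+y. ennreal B * ennreal (weighted a b k x y * F y) \<partial>lborel)"
    proof (rule nn_integral_mono_AE, use AE_lborel_singleton[of x] AE_lborel_singleton[of 0] in eventually_elim)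
      case (elim y)
      have "\<bar>y\<bar> powr (- a) * \<bar>y\<bar> powr a = 1" using elim by (simp flip: powr_add)
      then have "\<bar>y\<bar> powr (- a) * F y = norm (f y)" by (simp add: F_def flip: mult.assoc)
      moreover have "\<bar>x\<bar> powr (- b) * (\<bar>K x y\<bar> * norm (f y)) \<le> \<bar>x\<bar> powr (- b) * (B * k (x - y) * norm (f y))"
        using elim by (intro mult_left_mono mult_right_mono K) auto
      ultimately have "\<bar>x\<bar> powr (- b) * (\<bar>K x y\<bar> * norm (f y)) \<le> B * (weighted a b k x y * F y)"
        by (simp only: mult.assoc mult.left_commute[of B])
      then show ?case using B by (simp add: ennreal_mult'[symmetric] ennreal_leI)
    qed
    also have "\<dots> = ennreal B * (\<integral>\<^sup>+y. ennreal (weighted a b k x y * F y) \<partial>lborel)"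
      by (rule nn_integral_cmult) (simp add: F_def)
    finally show ?thesis .
  qed
  define M where "M = B powr q * (N powr (q / p) * \<bar>C\<bar>)"
  have M0: "0 \<le> M" by (simp add: M_def)
  \<comment> \<open>\<open>epowr_mult\<close> needs a positive factor, hence the case B = 0
    apart.\<close>
  have key: "(\<integral>\<^sup>+x. epowr (ennreal (\<bar>x\<bar> powr (- b)) * I x) q \<partial>lborel) \<le> ennreal M"
  proof (cases "B = 0")
    case True
    then have 0: "ennreal (\<bar>x\<bar> powr (- b)) * I x = 0" for x using I_le[of x] by simp
    show ?thesis unfolding 0 using p by (simp add: epowr_def)
  next
    case False
    let ?W = "\<lambda>x. \<integral>\<^sup>+y. ennreal (weighted a b k x y * F y) \<partial>lborel"
    have "(\<integral>\<^sup>+x. epowr (ennreal (\<bar>x\<bar> powr (- b)) * I x) q \<partial>lborel) \<le> (\<integral>\<^sup>+x. ennreal (B powr q) * epowr (?W x) q \<partial>lborel)"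
    proof (rule nn_integral_mono)
      fix x
      have "epowr (ennreal (\<bar>x\<bar> powr (- b)) * I x) q \<le> epowr (ennreal B * ?W x) q"
        using p by (intro epowr_mono I_le) auto
      also have "\<dots> = ennreal (B powr q) * epowr (?W x) q" using False B by (intro epowr_mult) simp
      finally show "epowr (ennreal (\<bar>x\<bar> powr (- b)) * I x) q \<le> ennreal (B powr q) * epowr (?W x) q" .
    qed
    also have "\<dots> = ennreal (B powr q) * (\<integral>\<^sup>+x. epowr (?W x) q \<partial>lborel)"
      by (rule nn_integral_cmult) measurable
    also have "\<dots> \<le> ennreal (B powr q) * ennreal (N powr (q / p) * \<bar>C\<bar>)"
      using p N0 F by (intro mult_left_mono kernel_bound_scaled[OF C]) (auto simp: F_def)
    also have "\<dots> = ennreal M" by (simp add: M_def ennreal_mult')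
    finally show ?thesis .
  qed
  have "AE x in lborel. epowr (ennreal (\<bar>x\<bar> powr (- b)) * I x) q \<noteq> \<infinity>"
    using key by (intro nn_integral_PInf_AE) (auto simp: top_unique)
  then show int: "AE x in lborel. integrable lborel (\<lambda>y. of_real (K x y) * f y)"
    using AE_lborel_singleton[of 0]
  proof eventually_elim
    case (elim x)
    \<comment> \<open>For x \<noteq> 0 the weight is positive, so an infinite I x would make the
      product infinite.\<close>
    then have "I x < top" by (auto simp: epowr_eq_top_iff ennreal_mult_eq_top_iff less_top)
    then show ?case by (intro integrableI_bounded) (auto simp: I_def norm_mult)
  qed
  have T_meas [measurable]: "T \<in> borel_measurable borel" unfolding T_def by measurable
  \<comment> \<open>Valid at every x: where the integral does not converge, T x has the default
    value 0.\<close>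
  have T_le: "ennreal (norm (T x)) \<le> I x" for x
  proof (cases "integrable lborel (\<lambda>y. of_real (K x y) * f y)")
    case True
    then show ?thesis
      unfolding T_def I_def using integral_norm_bound_ennreal[OF True] by (simp add: norm_mult)
  qed (simp add: T_def not_integrable_integral_eq)
  have T_int: "(\<integral>\<^sup>+x. ennreal (norm (T x) powr q * \<bar>x\<bar> powr (- b * q)) \<partial>lborel) \<le> ennreal M"
  proof -
    have "ennreal (norm (T x) powr q * \<bar>x\<bar> powr (- b * q)) \<le> epowr (ennreal (\<bar>x\<bar> powr (- b)) * I x) q" for x
    proof -
      have "ennreal (norm (T x) powr q * \<bar>x\<bar> powr (- b * q)) = epowr (ennreal (\<bar>x\<bar> powr (- b)) * ennreal (norm (T x))) q"
        by (simp add: epowr_ennreal powr_mult powr_powr mult.commute flip: ennreal_mult)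
      also have "\<dots> \<le> epowr (ennreal (\<bar>x\<bar> powr (- b)) * I x) q"
        using p by (intro epowr_mono mult_left_mono T_le) auto
      finally show ?thesis .
    qed
    then show ?thesis by (intro order_trans[OF nn_integral_mono key])
  qed
  then have T_integrable: "integrable lborel (\<lambda>x. norm (T x) powr q * \<bar>x\<bar> powr (- b * q))"
    by (intro integrableI_bounded) (auto simp: top_unique less_top[symmetric] intro: order.strict_trans1)
  then show "T \<in> weighted_Lp q (\<lambda>x. \<bar>x\<bar> powr (- b * q))" by (simp add: weighted_Lp_def)
  have "ennreal (\<integral>x. norm (T x) powr q * \<bar>x\<bar> powr (- b * q) \<partial>lborel) \<le> ennreal M"
    using T_int by (subst (asm) nn_integral_eq_integral[OF T_integrable]) auto
  then have "(\<integral>x. norm (T x) powr q * \<bar>x\<bar> powr (- b * q) \<partial>lborel) \<le> M" using M0 by simp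
  then have "weighted_Lp_norm q (\<lambda>x. \<bar>x\<bar> powr (- b * q)) T \<le> M powr (1 / q)"
    unfolding weighted_Lp_norm_def using p by (intro powr_mono2 integral_nonneg_AE) auto
  also have "M = (B powr q * \<bar>C\<bar>) * N powr (q / p)" by (simp add: M_def)
  also have "\<dots> powr (1 / q) = (B powr q * \<bar>C\<bar>) powr (1 / q) * N powr (1 / p)"
    using p powr_mult[of "B powr q * \<bar>C\<bar>" "N powr (q / p)" "1 / q"] by (simp only: powr_powr) simp
  also have "N powr (1 / p) = weighted_Lp_norm p (\<lambda>x. \<bar>x\<bar> powr (a * p)) f"
    by (simp add: weighted_Lp_norm_def N_def)
  finally show "weighted_Lp_norm q (\<lambda>x. \<bar>x\<bar> powr (- b * q)) T
      \<le> (B powr q * \<bar>C\<bar>) powr (1 / q) * weighted_Lp_norm p (\<lambda>x. \<bar>x\<bar> powr (a * p)) f" .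
qed

theorem theorem1p2:
  fixes \<Psi> :: "real \<Rightarrow> real" and m :: "nat \<Rightarrow> real"
    and \<delta> \<sigma> C\<^sub>0 p q a b :: real
  assumes BV: "bounded_variation_on \<Psi> {0..}"
    and m_def: "\<And>k. m k = stieltjes_integral (\<lambda>t. exp (- (real k * t))) \<Psi>"
    and H1h: "(\<integral>\<^sup>+t\<in>{0..}. 1 \<partial>total_variation_measure \<Psi>) < \<infinity>"
    and H2h: "\<delta> > 0" "0 < \<sigma>" "\<sigma> < 1/2" "C\<^sub>0 > 0"
      "\<And>t. 0 \<le> t \<Longrightarrow> t \<le> \<delta> \<Longrightarrow> \<bar>\<Psi> t\<bar> \<le> C\<^sub>0 * t powr \<sigma>"
    and p: "1 < p" "p \<le> q"
    and a: "a < 1 / (p / (p - 1))"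
    and b: "b < 1 / q"
    and ab: "0 \<le> a + b" "a + b \<le> 1 / q - 1 / p + 2 * \<sigma>"
  shows "\<exists>T C. linear_on_Lp p (\<lambda>x. \<bar>x\<bar> powr (a * p)) T \<and>
     (\<forall>f \<in> weighted_Lp p (\<lambda>x. \<bar>x\<bar> powr (a * p)).
        T f \<in> weighted_Lp q (\<lambda>x. \<bar>x\<bar> powr (- b * q)) \<and>
        weighted_Lp_norm q (\<lambda>x. \<bar>x\<bar> powr (- b * q)) (T f)
          \<le> C * weighted_Lp_norm p (\<lambda>x. \<bar>x\<bar> powr (a * p)) f) \<and>
     (\<forall>f \<in> hermite_span.
        f \<in> weighted_Lp p (\<lambda>x. \<bar>x\<bar> powr (a * p)) \<and>
        hermite_multiplier m f \<in> weighted_Lp q (\<lambda>x. \<bar>x\<bar> powr (- b * q)) \<and>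
        (AE x in lborel. T f x = hermite_multiplier m f x) \<and>
        weighted_Lp_norm q (\<lambda>x. \<bar>x\<bar> powr (- b * q)) (hermite_multiplier m f)
          \<le> C * weighted_Lp_norm p (\<lambda>x. \<bar>x\<bar> powr (a * p)) f)"
proof -
  have a': "a < 1 - 1 / p" using a p by (simp add: field_simps)
  have pq: "1 / q \<le> 1 / p" using p by (simp add: frac_le)
  \<comment> \<open>The homogeneity exponent of the inequality. The conditions on a + b together
    with p \<le> q say that it lies in [0, 2\<sigma>].\<close>
  define \<theta> where "\<theta> = a + b + 1 / p - 1 / q"
  have \<theta>: "0 \<le> \<theta>" "\<theta> \<le> 2 * \<sigma>" "\<theta> \<le> 1" using ab pq H2h by (auto simp: \<theta>_def)
  have \<sigma>: "0 < \<sigma>" "\<sigma> < 1 / 2" using H2h by auto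
  obtain B' where B': "\<And>t. 0 \<le> t \<Longrightarrow> \<bar>\<Psi> t\<bar> \<le> B'" using bounded_variation_bounded[OF BV] by blast
  \<comment> \<open>Extends the bound to all t \<ge> 0: beyond \<delta> the function is bounded by
    B', and t^\<sigma> is at least \<delta>^\<sigma>.\<close>
  define C1 where "C1 = C\<^sub>0 + B' / \<delta> powr \<sigma>"
  have B'0: "0 \<le> B'" using B'[of 0] by simp
  have C1: "0 \<le> C1" using H2h B'0 by (simp add: C1_def)
  have \<Psi>: "\<bar>\<Psi> t\<bar> \<le> C1 * t powr \<sigma>" if "0 \<le> t" for t
  proof (cases "t \<le> \<delta>")
    case True
    have "\<bar>\<Psi> t\<bar> \<le> C\<^sub>0 * t powr \<sigma>" using H2h(5) that True .
    also have "\<dots> \<le> C1 * t powr \<sigma>" using H2h B'0 by (intro mult_right_mono) (auto simp: C1_def)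
    finally show ?thesis .
  next
    case False
    have "\<bar>\<Psi> t\<bar> \<le> B' / \<delta> powr \<sigma> * \<delta> powr \<sigma>" using B'[OF that] H2h by simp
    also have "\<dots> \<le> C1 * t powr \<sigma>"
      using False H2h B'0 by (intro mult_mono powr_mono2) (auto simp: C1_def)
    finally show ?thesis .
  qed
  obtain L where L: "(\<Psi> \<longlongrightarrow> L) at_top" using bounded_variation_tendsto[OF BV] by blast
  define K where "K = multiplier_kernel \<Psi> L"
  have K_meas: "case_prod K \<in> borel_measurable (borel \<Otimes>\<^sub>M borel)"
    unfolding K_def by (rule borel_measurable_multiplier_kernel[OF BV \<sigma> C1 \<Psi> L])
  obtain B where B: "0 \<le> B" "\<And>x y. x \<noteq> y \<Longrightarrow> \<bar>K x y\<bar> \<le> B * majorant \<sigma> (x - y)"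
    unfolding K_def using multiplier_kernel_bound[OF BV \<sigma> C1 \<Psi> L] by blast
  obtain N where N: "0 \<le> N" "(\<integral>\<^sup>+z. ennreal (majorant \<sigma> z) \<partial>lborel) \<le> ennreal N"
    using nn_integral_majorant[OF \<sigma>] by blast
  have maj: "majorant \<sigma> z \<le> 16 * \<bar>z\<bar> powr (a + b + 1 / p - 1 / q - 1)" for z
    using majorant_le_powr[OF \<theta>(1,2)] \<sigma> by (simp add: \<theta>_def)
  have "kernel_bounded p q (\<lambda>x y. \<bar>x\<bar> powr (- b) * majorant \<sigma> (x - y) * \<bar>y\<bar> powr (- a))"
    using p a' b ab \<theta> N maj majorant_nonneg
    by (intro stein_weiss[where A = 16 and N = N]) (auto simp: \<theta>_def)
  then obtain C where C: "kernel_bound p q (\<lambda>x y. \<bar>x\<bar> powr (- b) * majorant \<sigma> (x - y) * \<bar>y\<bar> powr (- a)) C"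
    unfolding kernel_bounded_def by blast
  \<comment> \<open>The extension, given on the whole weighted space by one formula.\<close>
  define T where "T f x = (\<integral>y. of_real (K x y) * f y \<partial>lborel)" for f :: "real \<Rightarrow> complex" and x
  define D where "D = (B powr q * \<bar>C\<bar>) powr (1 / q)"
  let ?v = "\<lambda>x::real. \<bar>x\<bar> powr (a * p)" and ?w = "\<lambda>x::real. \<bar>x\<bar> powr (- b * q)"
  note bound = weighted_operator_bound[OF C p borel_measurable_majorant K_meas B(2) majorant_nonneg B(1)]
  have int: "AE x in lborel. integrable lborel (\<lambda>y. of_real (K x y) * f y)" if "f \<in> weighted_Lp p ?v" for f
    using bound(1)[OF _ that] .
  have T: "T f \<in> weighted_Lp q ?w" "weighted_Lp_norm q ?w (T f) \<le> D * weighted_Lp_norm p ?v f"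
    if "f \<in> weighted_Lp p ?v" for f
    using bound(2,3)[OF _ that] by (simp_all add: T_def[abs_def] D_def)
  \<comment> \<open>On the span the agreement holds at every x, since the kernel against a Hermite
    function is integrable for each x.\<close>
  have T_span: "T (hermite_sum n d)
      = hermite_multiplier m (hermite_sum n d)" for n d
  proof
    fix x
    have i: "integrable lborel (\<lambda>y. K x y * hermite_fun j y)" for j
      unfolding K_def by (rule integrable_multiplier_kernel_hermite_fun[OF BV \<sigma> C1 \<Psi> L])
    have e: "(\<integral>y. K x y * hermite_fun j y \<partial>lborel) = m j * hermite_fun j x" for j
      unfolding K_def m_def by (rule integral_multiplier_kernel_hermite_fun[OF BV \<sigma> C1 \<Psi> L])
    have "T (hermite_sum n d) x
       = (\<integral>y. (\<Sum>j<n. d j * complex_of_real (K x y * hermite_fun j y)) \<partial>lborel)"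
      by (simp add: T_def sum_distrib_left mult_ac)
    also have "\<dots> = (\<Sum>j<n. d j * (\<integral>y. complex_of_real (K x y * hermite_fun j y) \<partial>lborel))"
      using i by (subst Bochner_Integration.integral_sum) (auto simp del: of_real_mult)
    also have "\<dots> = (\<Sum>j<n. d j * of_real (m j) * complex_of_real (hermite_fun j x))"
    proof (rule sum.cong[OF refl])
      fix j
      have "(\<integral>y. complex_of_real (K x y * hermite_fun j y) \<partial>lborel) = complex_of_real (m j * hermite_fun j x)"
        unfolding e[symmetric] by (rule integral_of_real[OF i])
      then show "d j * (\<integral>y. complex_of_real (K x y * hermite_fun j y) \<partial>lborel) = d j * of_real (m j) * complex_of_real (hermite_fun j x)"
        by simp
    qed
    finally show "T (hermite_sum n d) x
        = hermite_multiplier m (hermite_sum n d) x"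
      by (simp add: hermite_multiplier_hermite_span)
  qed
  have q: "1 < q" using p by simp
  \<comment> \<open>The lower bound a \<ge> -b > -1/q \<ge> -1/p makes the weight locally
    integrable, so the span lies in the domain.\<close>
  have ap: "- 1 < a * p"
  proof -
    have "- (1 / p) < a" using ab b pq by linarith
    then show ?thesis using p by (simp add: field_simps)
  qed
  show ?thesis
  proof (intro exI[of _ T] exI[of _ D] conjI ballI)
    show "linear_on_Lp p ?v T"
      unfolding linear_on_Lp_def
    proof (intro conjI ballI allI)
      \<comment> \<open>Additivity requires both integrals to converge, hence only almost every x.
        For scalar multiples the default value 0 is compatible, and every x is allowed.\<close>
      fix f g assume "f \<in> weighted_Lp p ?v" "g \<in> weighted_Lp p ?v"
      from int[OF this(1)] int[OF this(2)] show "AE x in lborel. T (\<lambda>y. f y + g y) x = T f x + T g x"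
        by eventually_elim (simp add: T_def distrib_left)
    next
      fix c f
      have "T (\<lambda>y. c * f y) x = c * T f x" for x
        by (simp add: T_def mult.left_commute)
      then show "AE x in lborel. T (\<lambda>y. c * f y) x = c * T f x" by simp
    qed
  next
    fix f assume "f \<in> hermite_span"
    then obtain n d where f: "f = (hermite_sum n d)"
      unfolding hermite_span_def by blast
    show fp: "f \<in> weighted_Lp p ?v" unfolding f using p(1) ap by (rule hermite_span_weighted_Lp)
    have Tf: "T f = hermite_multiplier m f" unfolding f by (rule T_span)
    show "hermite_multiplier m f \<in> weighted_Lp q ?w"
      "weighted_Lp_norm q ?w (hermite_multiplier m f) \<le> D * weighted_Lp_norm p ?v f"
      unfolding Tf[symmetric] using T[OF fp] by auto
    show "AE x in lborel. T f x = hermite_multiplier m f x" unfolding Tf by simp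
  qed (use T in auto)
qed

end
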